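(* The following decision problems are in coNP: given a formula $A$ of the conditional language, decide whether $\mathsf{H}\mathsf{CK}\mathsf{CEM}\vdash A$; and given such a formula $A$, decide whether $\mathsf{H}\mathsf{CK}\mathsf{ID}\mathsf{CEM}\vdash A$.
   Context: Fix a countable set $V$ of propositional variables. Conditional formulas: $A ::= \bot\mid p\mid\neg A\mid A\land B\mid A\Rightarrow B$ ($p\in V$); $\top,\lor,\to,\leftrightarrow$ abbreviations. A rule is $\Gamma_1\dots\Gamma_n/\Gamma_0$ with finite multisets of formulas (sequents), read disjunctively via $\bigvee$. For a rule set $\mathsf{R}$, $\mathsf{H}\mathsf{R}\vdash A$ iff $A$ lies in the least set of formulas containing all substitution instances of propositional tautologies, closed under modus ponens, and containing $\bigvee\Gamma_0$ whenever it contains $\bigvee\Gamma_1,\dots,\bigvee\Gamma_n$ for $\Gamma_1\dots\Gamma_n/\Gamma_0\in\mathsf{R}$. $\mathsf{CK}\mathsf{CEM}$ is the rule set of all instances of $(\mathsf{RCEA})$ $\frac{A\leftrightarrow A'}{(A\Rightarrow B)\leftrightarrow(A'\Rightarrow B)}$, $(\mathsf{RCK})$ $\frac{B_1\land\dots\land B_n\to B}{(A\Rightarrow B_1)\land\dots\land(A\Rightarrow B_n)\to(A\Rightarrow B)}$ ($n\ge0$; $n=0$ reads $B/(A\Rightarrow B)$) and the axiom $(\mathsf{CEM})$ $(A\Rightarrow B)\lor(A\Rightarrow\neg B)$; $\mathsf{CK}\mathsf{ID}\mathsf{CEM}$ additionally contains all instances of the axiom $(\mathsf{ID})$ $A\Rightarrow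 A$. *)

theory Defs
  imports "HOL-Library.Multiset" "HOL-Computational_Algebra.Polynomial"
begin

section \<open>Conditional formulas and Hilbert-style derivability\<close>

datatype 'v fm =
    Bot
  | Var 'v
  | Neg "'v fm"
  | Conj "'v fm" "'v fm"
  | Cond "'v fm" "'v fm"

abbreviation Disj :: "'v fm \<Rightarrow> 'v fm \<Rightarrow> 'v fm" where
  "Disj A B \<equiv> Neg (Conj (Neg A) (Neg B))"

abbreviation Imp :: "'v fm \<Rightarrow> 'v fm \<Rightarrow> 'v fm" where
  "Imp A B \<equiv> Neg (Conj A (Neg B))"

abbreviation Iff :: "'v fm \<Rightarrow> 'v fm \<Rightarrow> 'v fm" where
  "Iff A B \<equiv> Conj (Imp A B) (Imp B A)"

primrec cond_free :: "'v fm \<Rightarrow> bool" where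
  "cond_free Bot \<longleftrightarrow> True"
| "cond_free (Var p) \<longleftrightarrow> True"
| "cond_free (Neg A) \<longleftrightarrow> cond_free A"
| "cond_free (Conj A B) \<longleftrightarrow> cond_free A \<and> cond_free B"
| "cond_free (Cond A B) \<longleftrightarrow> False"

text \<open>Only used on formulas without conditionals; the last equation is a dummy.\<close>

primrec peval :: "('v \<Rightarrow> bool) \<Rightarrow> 'v fm \<Rightarrow> bool" where
  "peval e Bot \<longleftrightarrow> False"
| "peval e (Var p) \<longleftrightarrow> e p"
| "peval e (Neg A) \<longleftrightarrow> \<not> peval e A"
| "peval e (Conj A B) \<longleftrightarrow> peval e A \<and> peval e B"
| "peval e (Cond A B) \<longleftrightarrow> False"

definition tautology :: "'v fm \<Rightarrow> bool" where
  "tautology P \<longleftrightarrow> cond_free P \<and> (\<forall>e. peval e P)"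

primrec subst :: "('u \<Rightarrow> 'v fm) \<Rightarrow> 'u fm \<Rightarrow> 'v fm" where
  "subst \<sigma> Bot = Bot"
| "subst \<sigma> (Var p) = \<sigma> p"
| "subst \<sigma> (Neg A) = Neg (subst \<sigma> A)"
| "subst \<sigma> (Conj A B) = Conj (subst \<sigma> A) (subst \<sigma> B)"
| "subst \<sigma> (Cond A B) = Cond (subst \<sigma> A) (subst \<sigma> B)"

type_synonym 'v sequent = "'v fm multiset"
type_synonym 'v rule = "'v sequent list \<times> 'v sequent"

fun disj_list :: "'v fm list \<Rightarrow> 'v fm" where
  "disj_list [] = Bot"
| "disj_list [A] = A"
| "disj_list (A # B # As) = Disj A (disj_list (B # As))"

text \<open>The disjunction of a multiset is taken along an arbitrary ordering; all choices are
  equivalent up to propositional reasoning.\<close>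

definition bigor :: "'v sequent \<Rightarrow> 'v fm" where
  "bigor \<Gamma> = disj_list (SOME As. mset As = \<Gamma>)"

text \<open>Tautologies are taken over an infinite supply of schematic letters (\<open>nat\<close>), so that
  sufficiently many are available even if the object language has only finitely many variables.\<close>

inductive hilbert :: "'v rule set \<Rightarrow> 'v fm \<Rightarrow> bool" for \<R> where
  taut: "tautology (P :: nat fm) \<Longrightarrow> hilbert \<R> (subst \<sigma> P)"
| mp: "hilbert \<R> (Imp A B) \<Longrightarrow> hilbert \<R> A \<Longrightarrow> hilbert \<R> B"
| rule: "(\<Gamma>s, \<Gamma>\<^sub>0) \<in> \<R> \<Longrightarrow> \<forall>\<Gamma>\<in>set \<Gamma>s. hilbert \<R> (bigor \<Gamma>) \<Longrightarrow> hilbert \<R> (bigor \<Gamma>\<^sub>0)"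

fun conj_list :: "'v fm list \<Rightarrow> 'v fm" where
  "conj_list [] = Neg Bot"
| "conj_list [A] = A"
| "conj_list (A # B # As) = Conj A (conj_list (B # As))"

definition imp_list :: "'v fm list \<Rightarrow> 'v fm \<Rightarrow> 'v fm" where
  "imp_list As B = (if As = [] then B else Imp (conj_list As) B)"

definition RCEA :: "'v rule set" where
  "RCEA = {([{#Iff A A'#}], {#Iff (Cond A B) (Cond A' B)#}) | A A' B. True}"

definition RCK :: "'v rule set" where
  "RCK = {([{#imp_list Bs B#}], {#imp_list (map (Cond A) Bs) (Cond A B)#}) | A Bs B. True}"

definition CEM :: "'v rule set" where
  "CEM = {([], {#Disj (Cond A B) (Cond A (Neg B))#}) | A B. True}"

definition ID :: "'v rule set" where
  "ID = {([], {#Cond A A#}) | A. True}"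

definition CKCEM :: "'v rule set" where
  "CKCEM = RCEA \<union> RCK \<union> CEM"

definition CKIDCEM :: "'v rule set" where
  "CKIDCEM = CKCEM \<union> ID"


section \<open>Formulas as words over a finite alphabet\<close>

datatype token = TBot | TVar | TNeg | TConj | TCond | TBit bool

instance token :: finite
proof
  have "(UNIV :: token set) \<subseteq> {TBot, TVar, TNeg, TConj, TCond} \<union> range TBit"
  proof
    fix x :: token
    show "x \<in> {TBot, TVar, TNeg, TConj, TCond} \<union> range TBit"
      by (cases x) auto
  qed
  then show "finite (UNIV :: token set)"
    by (rule finite_subset) simp
qed

text \<open>Binary representation, least significant bit first, without leading zeros; \<open>0\<close> is the
  empty word.\<close>

fun binary :: "nat \<Rightarrow> bool list" where
  "binary n = (if n = 0 then [] else odd n # binary (n div 2))"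

declare binary.simps [simp del]

text \<open>Prefix notation; a variable is written as the binary numeral of its index in an
  enumeration \<open>idx\<close> of the variables.\<close>

primrec encode :: "('v \<Rightarrow> nat) \<Rightarrow> 'v fm \<Rightarrow> token list" where
  "encode idx Bot = [TBot]"
| "encode idx (Var p) = TVar # map TBit (binary (idx p))"
| "encode idx (Neg A) = TNeg # encode idx A"
| "encode idx (Conj A B) = TConj # encode idx A @ encode idx B"
| "encode idx (Cond A B) = TCond # encode idx A @ encode idx B"

text \<open>An enumeration of the type of variables: a bijection onto the naturals, or onto an
  initial segment of them. With an arbitrary injection, the set of well-formed words might be
  undecidable.\<close>

definition enumeration :: "('v \<Rightarrow> nat) \<Rightarrow> bool" where
  "enumeration idx \<longleftrightarrow> inj idx \<and> (range idx = UNIV \<or> (\<exists>n. range idx = {..<n}))"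


section \<open>Nondeterministic Turing machines, NP and coNP\<close>

datatype 'a cell = Blank | Inp 'a | Work nat

datatype move = MoveL | Stay | MoveR

text \<open>A tape is infinite in both directions; the second component is the head position.\<close>

type_synonym 'a tape = "(int \<Rightarrow> 'a cell) \<times> int"

type_synonym 'a config = "nat \<times> 'a tape list"

text \<open>A transition \<open>(q, xs, q', as)\<close> is enabled in state \<open>q\<close> when the symbols under the heads are
  \<open>xs\<close>. It changes the state to \<open>q'\<close> and performs on each tape the corresponding write-and-move
  action in \<open>as\<close>. As there are only finitely many transitions, only finitely many states and
  work symbols are relevant.\<close>

record 'a ntm =
  tapes :: nat
  start :: nat
  accept :: nat
  trans :: "(nat \<times> 'a cell list \<times> nat \<times> ('a cell \<times> move) list) set"

definition wf_ntm :: "'a ntm \<Rightarrow> bool" where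
  "wf_ntm M \<longleftrightarrow> 0 < tapes M \<and> finite (trans M) \<and>
     (\<forall>(q, xs, q', as) \<in> trans M. length xs = tapes M \<and> length as = tapes M)"

fun read :: "'a tape \<Rightarrow> 'a cell" where
  "read (T, h) = T h"

fun shift :: "move \<Rightarrow> int \<Rightarrow> int" where
  "shift MoveL h = h - 1"
| "shift Stay h = h"
| "shift MoveR h = h + 1"

fun act :: "'a cell \<times> move \<Rightarrow> 'a tape \<Rightarrow> 'a tape" where
  "act (x, m) (T, h) = (T(h := x), shift m h)"

definition step :: "'a ntm \<Rightarrow> 'a config \<Rightarrow> 'a config \<Rightarrow> bool" where
  "step M c c' \<longleftrightarrow>
     (\<exists>as. (fst c, map read (snd c), fst c', as) \<in> trans M \<and> snd c' = map2 act as (snd c))"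

definition blank_tape :: "'a tape" where
  "blank_tape = (\<lambda>_. Blank, 0)"

definition input_tape :: "'a list \<Rightarrow> 'a tape" where
  "input_tape w = (\<lambda>i. if 0 \<le> i \<and> i < int (length w) then Inp (w ! nat i) else Blank, 0)"

definition init :: "'a ntm \<Rightarrow> 'a list \<Rightarrow> 'a config" where
  "init M w = (start M, input_tape w # replicate (tapes M - 1) blank_tape)"

definition accepts_in :: "'a ntm \<Rightarrow> 'a list \<Rightarrow> nat \<Rightarrow> bool" where
  "accepts_in M w t \<longleftrightarrow> (\<exists>c. (step M ^^ t) (init M w) c \<and> fst c = accept M)"

definition language :: "'a ntm \<Rightarrow> 'a list set" where
  "language M = {w. \<exists>t. accepts_in M w t}"

text \<open>As usual for nondeterministic machines, the running time on an accepted word is the length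
  of a shortest accepting computation, and rejected words do not count (Garey and Johnson).\<close>

definition NP :: "'a::finite list set set" where
  "NP = {L. \<exists>(M :: 'a ntm) (p :: nat poly). wf_ntm M \<and> language M = L \<and>
             (\<forall>w\<in>L. \<exists>t \<le> poly p (length w). accepts_in M w t)}"

definition coNP :: "'a::finite list set set" where
  "coNP = {L. - L \<in> NP}"

end

theory Submission imports Defs begin

text \<open>
  By \<open>CEM\<close>, the consequents of \<open>C\<close> at a maximal consistent set \<open>T\<close> form a maximal consistent set
  again, or contain \<open>\<bottom>\<close>. So the canonical model has at most one successor per world and antecedent,
  and evaluating a formula there visits no more worlds than the formula has symbols. The worlds
  visited by an underivable \<open>A\<close>, together with those visited by pairs of inequivalent antecedents of
  \<open>A\<close> at a set that separates them, form a countermodel of cubic size: the selection function can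
  be read off extensions, because antecedents with the same extension are provably equivalent.

  A machine guesses the number of worlds, the truth vectors of the variables, and for each truth
  vector of an antecedent the successor of each world, and evaluates the formula read backwards
  with a stack of truth vectors. It accepts malformed words at once. Except for the guesses the
  machine is deterministic, so exhibiting one run of a phase determines the outcome of every run.
  Machines are compiled from structured programs over stacks; a stack is a tape with the head on
  the top symbol.
\<close>

section \<open>Nondeterministic stack programs\<close>

text \<open>The obstacle is that a selection function sees only the extension of an antecedent. In a
  truncated canonical model two inequivalent antecedents may acquire the same extension although
  their canonical successors differ, and then no selection function reproduces both. One separating
  world per pair does not suffice by itself: an antecedent with nested conditionals keeps its
  canonical truth value there only if the worlds that its evaluation visits from there are present
  too. No further closure is needed, because antecedents with equal extension agree in particular at
  the world meant to separate them. Elsewhere truth may deviate from membership, which is harmless.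
  The guess is never verified. Every guessed table denotes a model, since missing or ill-placed
  entries are read as falsity or as an absent successor, so acceptance is justified by soundness
  alone; completeness only has to exhibit one guess of polynomial length.\<close>

datatype ('r, 'a) prog =
    Skip
  | Fail
  | Push 'r 'a
  | Case 'r "'a option \<Rightarrow> ('r, 'a) prog"
  | Seq "('r, 'a) prog" "('r, 'a) prog" (infixr ";;" 60)
  | While 'r "'a option set" "('r, 'a) prog"
  | Choice "('r, 'a) prog" "('r, 'a) prog"
  | Star "('r, 'a) prog"

definition peek :: "'a list \<Rightarrow> 'a option" where
  "peek xs = (case xs of [] \<Rightarrow> None | a # _ \<Rightarrow> Some a)"

lemma peek_simps [simp]: "peek [] = None" "peek (a # xs) = Some a"
  by (simp_all add: peek_def)

text \<open>The index is the exact number of steps of the compiled machine: two for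
  \<open>Push\<close>, whose head moves before it writes, and one for each control decision.
  \<open>Fail\<close> has no rule and blocks.\<close>

inductive run :: "('r, 'a) prog \<Rightarrow> nat \<Rightarrow> ('r \<Rightarrow> 'a list) \<Rightarrow> ('r \<Rightarrow> 'a list) \<Rightarrow> bool" where
  Skip: "run Skip 1 s s"
| Push: "run (Push r a) 2 s (s(r := a # s r))"
| Case: "run (f (peek (s r))) t (s(r := tl (s r))) s' \<Longrightarrow> run (Case r f) (Suc t) s s'"
| Seq: "run P t s s' \<Longrightarrow> run Q u s' s'' \<Longrightarrow> run (P ;; Q) (Suc (t + u)) s s''"
| While_stop: "peek (s r) \<notin> S \<Longrightarrow> run (While r S P) 1 s s"
| While_step: "peek (s r) \<in> S \<Longrightarrow> run P t s s' \<Longrightarrow> run (While r S P) u s' s'' \<Longrightarrow>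
    run (While r S P) (Suc (t + u)) s s''"
| Choice1: "run P t s s' \<Longrightarrow> run (Choice P Q) (Suc t) s s'"
| Choice2: "run Q t s s' \<Longrightarrow> run (Choice P Q) (Suc t) s s'"
| Star_stop: "run (Star P) 1 s s"
| Star_step: "run P t s s' \<Longrightarrow> run (Star P) u s' s'' \<Longrightarrow> run (Star P) (Suc (t + u)) s s''"

inductive_cases run_SkipE [elim!]: "run Skip t s s'"
inductive_cases run_FailE [elim!]: "run Fail t s s'"
inductive_cases run_PushE [elim!]: "run (Push r a) t s s'"
inductive_cases run_CaseE [elim!]: "run (Case r f) t s s'"
inductive_cases run_SeqE [elim!]: "run (P ;; Q) t s s'"
inductive_cases run_WhileE: "run (While r S P) t s s'"
inductive_cases run_ChoiceE [elim!]: "run (Choice P Q) t s s'"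

primrec deterministic :: "('r, 'a) prog \<Rightarrow> bool" where
  "deterministic Skip \<longleftrightarrow> True"
| "deterministic Fail \<longleftrightarrow> True"
| "deterministic (Push r a) \<longleftrightarrow> True"
| "deterministic (Case r f) \<longleftrightarrow> (\<forall>x. deterministic (f x))"
| "deterministic (P ;; Q) \<longleftrightarrow> deterministic P \<and> deterministic Q"
| "deterministic (While r S P) \<longleftrightarrow> deterministic P"
| "deterministic (Choice P Q) \<longleftrightarrow> False"
| "deterministic (Star P) \<longleftrightarrow> False"

lemma run_unique:
  assumes "run P t s s'" "run P u s s''" "deterministic P"
  shows "s'' = s'"
  using assms
proof (induction arbitrary: u s'' rule: run.induct)
  case (While_stop s r S P)
  then show ?case by (auto elim: run_WhileE)
next
  case (While_step s r S P t s' v s1)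
  from While_step.prems(1) While_step.hyps(1) obtain t' v' s2
    where "run P t' s s2" "run (While r S P) v' s2 s''"
    by (auto elim: run_WhileE)
  with While_step show ?case by (metis deterministic.simps(6))
qed (fastforce)+

section \<open>Compiling stack programs to Turing machines\<close>

text \<open>The continuations reachable while \<open>P\<close> runs above \<open>K\<close>. A loop
  re-enters through itself, so unbounded executions still pass through finitely many of them; these
  become the machine states.\<close>

primrec conts :: "('r, 'a) prog \<Rightarrow> ('r, 'a) prog list \<Rightarrow> ('r, 'a) prog list set" where
  "conts Skip K = {Skip # K}"
| "conts Fail K = {Fail # K}"
| "conts (Push r a) K = {Push r a # K}"
| "conts (Case r f) K = insert (Case r f # K) (\<Union>x. conts (f x) K)"
| "conts (P ;; Q) K = insert ((P ;; Q) # K) (conts P (Q # K) \<union> conts Q K)"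
| "conts (While r S P) K = insert (While r S P # K) (conts P (While r S P # K))"
| "conts (Choice P Q) K = insert (Choice P Q # K) (conts P K \<union> conts Q K)"
| "conts (Star P) K = insert (Star P # K) (conts P (Star P # K))"

text \<open>Finiteness of the alphabet enters through \<open>Case\<close>, which has one branch for
  each possible top symbol.\<close>

lemma finite_conts: "finite (conts (P :: ('r, 'a::finite) prog) K)"
  by (induction P arbitrary: K) auto

lemma conts_self: "P # K \<in> conts P K"
  by (cases P) auto

definition stay :: "('r \<Rightarrow> 'a cell) \<Rightarrow> 'r \<Rightarrow> 'a cell \<times> move" where
  "stay x = (\<lambda>r. (x r, Stay))"

fun symbol :: "'a cell \<Rightarrow> 'a option" where
  "symbol (Inp a) = Some a"
| "symbol _ = None"

type_synonym ('r, 'a) control = "('r \<times> 'a) option \<times> ('r, 'a) prog list"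

text \<open>A state is a continuation, together with the symbol still to be written when a
  push is in progress: the head has to move left before it can write.\<close>

inductive trans_rel ::
  "('r, 'a) control \<Rightarrow> ('r \<Rightarrow> 'a cell) \<Rightarrow> ('r, 'a) control \<Rightarrow> ('r \<Rightarrow> 'a cell \<times> move) \<Rightarrow> bool" where
  "trans_rel (None, Skip # K) x (None, K) (stay x)"
| "trans_rel (None, Push r a # K) x (Some (r, a), K) ((stay x)(r := (x r, MoveL)))"
| "trans_rel (Some (r, a), K) x (None, K) ((stay x)(r := (Inp a, Stay)))"
| "trans_rel (None, Case r f # K) x (None, f (symbol (x r)) # K)
     ((stay x)(r := (Blank, if x r = Blank then Stay else MoveR)))"
| "trans_rel (None, (P ;; Q) # K) x (None, P # Q # K) (stay x)"
| "symbol (x r) \<notin> S \<Longrightarrow> trans_rel (None, While r S P # K) x (None, K) (stay x)"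
| "symbol (x r) \<in> S \<Longrightarrow> trans_rel (None, While r S P # K) x (None, P # While r S P # K) (stay x)"
| "trans_rel (None, Choice P Q # K) x (None, P # K) (stay x)"
| "trans_rel (None, Choice P Q # K) x (None, Q # K) (stay x)"
| "trans_rel (None, Star P # K) x (None, K) (stay x)"
| "trans_rel (None, Star P # K) x (None, P # Star P # K) (stay x)"

inductive_cases trans_relE: "trans_rel (None, K) x q f"
inductive_cases trans_rel_writeE: "trans_rel (Some (r, a), K) x q f"

text \<open>The bottom of the stack is fixed on the tape and the top wanders, hence the head
  position as a parameter. All other cells are blank, so a blank under the head means an empty
  stack. With \<open>h = 0\<close> this is the input tape, first letter on top.\<close>

definition stack_tape :: "int \<Rightarrow> 'a list \<Rightarrow> 'a tape" where
  "stack_tape h xs =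
     (\<lambda>i. if h \<le> i \<and> i < h + int (length xs) then Inp (xs ! nat (i - h)) else Blank, h)"

lemma symbol_read_stack_tape [simp]: "symbol (read (stack_tape h xs)) = peek xs"
  by (cases xs) (auto simp: stack_tape_def)

lemma read_stack_tape_Blank [simp]: "read (stack_tape h xs) = Blank \<longleftrightarrow> xs = []"
  by (cases xs) (auto simp: stack_tape_def)

lemma read_stack_tape_in: "read (stack_tape h xs) \<in> insert Blank (range Inp)"
  by (cases xs) (auto simp: stack_tape_def)

lemma act_stay [simp]: "act (read T, Stay) T = T"
  by (cases T) auto

lemma act_stay_Nil: "act (Blank, Stay) (stack_tape h []) = stack_tape h []"
  by (simp add: stack_tape_def fun_eq_iff)

lemma act_pop: "act (Blank, MoveR) (stack_tape h (a # xs)) = stack_tape (h + 1) xs"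
  by (auto simp: stack_tape_def fun_eq_iff nth_Cons' nat_diff_distrib' intro!: arg_cong[of _ _ "(!) xs"])

lemma act_push:
  "act (Inp a, Stay) (act (read (stack_tape h xs), MoveL) (stack_tape h xs)) =
   stack_tape (h - 1) (a # xs)"
  by (auto simp: stack_tape_def fun_eq_iff nth_Cons' intro!: arg_cong[of _ _ "(!) xs"])

text \<open>Transitions exist only for symbols in \<open>insert Blank (range Inp)\<close>, so the
  half-finished push must again read such a symbol.\<close>

lemma read_move_left: "read (act (read (stack_tape h xs), MoveL) (stack_tape h xs)) = Blank"
  by (auto simp: stack_tape_def)

definition stack_tapes :: "('r \<Rightarrow> int) \<Rightarrow> ('r \<Rightarrow> 'a list) \<Rightarrow> 'r \<Rightarrow> 'a tape" where
  "stack_tapes h s r = stack_tape (h r) (s r)"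

definition initial :: "'r \<Rightarrow> 'a list \<Rightarrow> 'r \<Rightarrow> 'a list" where
  "initial r w = (\<lambda>_. [])(r := w)"

text \<open>Machine states must be naturals and the transition set finite. So controls are
  restricted to continuations of \<open>P0\<close> and numbered injectively, and tape symbols are
  restricted to \<open>Blank\<close> and the input alphabet.\<close>

locale compiled =
  fixes regs rs :: "'r list" and r0 :: 'r and P0 :: "('r, 'a::finite) prog"
    and code :: "('r, 'a) control \<Rightarrow> nat" and S and M
  assumes rs: "set regs = UNIV" "r0 \<notin> set rs" and regs: "regs = r0 # rs"
    and S_def: "S = insert None (range Some) \<times> insert [] (conts P0 [])"
    and code: "inj_on code S"
    and M_def: "M = \<lparr>tapes = length regs, start = code (None, [P0]), accept = code (None, []),
       trans = {(code q, map x regs, code q', map f regs) | q x q' f.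
         q \<in> S \<and> q' \<in> S \<and> range x \<subseteq> insert Blank (range Inp) \<and> trans_rel q x q' f}\<rparr>"
begin

lemma in_trans: "(n, xs, n', as) \<in> trans M \<longleftrightarrow> (\<exists>q x q' f. n = code q \<and> xs = map x regs \<and>
    n' = code q' \<and> as = map f regs \<and> q \<in> S \<and> q' \<in> S \<and>
    range x \<subseteq> insert Blank (range Inp) \<and> trans_rel q x q' f)"
  unfolding M_def by (simp del: split_paired_Ex)

lemma M_simps [simp]: "tapes M = length regs" "start M = code (None, [P0])" "accept M = code (None, [])"
  unfolding M_def by simp_all

lemma code_final: "q \<in> S \<Longrightarrow> code q = code (None, []) \<Longrightarrow> q = (None, [])"
  using inj_onD[OF code, of q "(None, [])"] by (auto simp: S_def)

lemma map_regs_eq: "map f regs = map g regs \<longleftrightarrow> f = g"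
  using rs(1) by (metis UNIV_I ext list.map_cong0 map_eq_conv)

lemma wf: "wf_ntm M"
proof -
  let ?\<Sigma> = "insert Blank (range Inp) :: 'a cell set"
  have UNIV_move: "UNIV = {MoveL, Stay, MoveR}"
  proof -
    have "m \<in> {MoveL, Stay, MoveR}" for m by (cases m) auto
    then show ?thesis by blast
  qed
  have finUNIV: "finite (UNIV :: 'r set)"
    using rs(1) by (metis List.finite_set)
  have S: "finite S"
    unfolding S_def using finite_conts[of P0 "[]"] finUNIV
    by (intro finite_cartesian_product) (auto simp: finite_prod)
  have ran: "range f \<subseteq> ?\<Sigma> \<times> UNIV" if "trans_rel q x q' f" "range x \<subseteq> ?\<Sigma>" for q x q' f
    using that by (induction rule: trans_rel.induct) (auto simp: stay_def)
  have "trans M \<subseteq> code ` S \<times> {xs. set xs \<subseteq> ?\<Sigma> \<and> length xs = length regs} \<times>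
      code ` S \<times> {as. set as \<subseteq> ?\<Sigma> \<times> UNIV \<and> length as = length regs}"
  proof
    fix z assume "z \<in> trans M"
    then obtain q x q' f where z: "z = (code q, map x regs, code q', map f regs)"
      "q \<in> S" "q' \<in> S" "range x \<subseteq> ?\<Sigma>" "trans_rel q x q' f"
      using in_trans by (cases z) (metis (no_types, lifting))
    then show "z \<in> code ` S \<times> {xs. set xs \<subseteq> ?\<Sigma> \<and> length xs = length regs} \<times>
        code ` S \<times> {as. set as \<subseteq> ?\<Sigma> \<times> UNIV \<and> length as = length regs}"
      using ran[OF z(5,4)] by (auto simp: image_subset_iff)
  qed
  moreover have "finite (code ` S \<times> {xs. set xs \<subseteq> ?\<Sigma> \<and> length xs = length regs} \<times>
      code ` S \<times> {as. set as \<subseteq> ?\<Sigma> \<times> (UNIV :: move set) \<and> length as = length regs})"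
    using S by (intro finite_cartesian_product finite_lists_length_eq) (auto simp: UNIV_move)
  ultimately have "finite (trans M)" by (rule finite_subset)
  then show ?thesis unfolding wf_ntm_def by (auto simp: in_trans regs simp del: split_paired_Ex)
qed

lemma step_iff:
  assumes "q \<in> S" "\<And>r. read (T r) \<in> insert Blank (range Inp)"
  shows "step M (code q, map T regs) c \<longleftrightarrow>
    (\<exists>q' f. q' \<in> S \<and> trans_rel q (\<lambda>r. read (T r)) q' f \<and>
       c = (code q', map (\<lambda>r. act (f r) (T r)) regs))" (is "?L \<longleftrightarrow> ?R")
proof
  assume ?L
  then obtain as where "(code q, map read (map T regs), fst c, as) \<in> trans M"
    and c: "snd c = map2 act as (map T regs)"
    by (auto simp: step_def)
  then obtain q1 x q' f where *: "code q = code q1" "map (\<lambda>r. read (T r)) regs = map x regs"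
    "fst c = code q'" "as = map f regs" "q1 \<in> S" "q' \<in> S" "trans_rel q1 x q' f"
    unfolding in_trans o_def map_map by metis
  have "q1 = q"
    using * assms(1) code by (auto dest: inj_onD)
  moreover have "x = (\<lambda>r. read (T r))"
    using *(2) map_regs_eq by metis
  moreover have "snd c = map (\<lambda>r. act (f r) (T r)) regs"
    using c *(4) by (simp add: map2_map_map)
  ultimately show ?R using * by (metis prod.collapse)
next
  assume ?R
  then obtain q' f where *: "q' \<in> S" "trans_rel q (\<lambda>r. read (T r)) q' f"
    and c: "c = (code q', map (\<lambda>r. act (f r) (T r)) regs)" by blast
  have "(code q, map (\<lambda>r. read (T r)) regs, code q', map f regs) \<in> trans M"
    unfolding in_trans using * assms by blast
  moreover have "snd c = map2 act (map f regs) (map T regs)"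
    by (simp add: c map2_map_map)
  ultimately show ?L unfolding step_def c by (auto simp: o_def)
qed

lemma step_I:
  assumes "q \<in> S" "\<And>r. read (T r) \<in> insert Blank (range Inp)" "q' \<in> S"
    "trans_rel q (\<lambda>r. read (T r)) q' f" "c = (code q', map (\<lambda>r. act (f r) (T r)) regs)"
  shows "step M (code q, map T regs) c"
  using assms(3-5) by (subst step_iff[OF assms(1,2)]) blast

lemma read_stack_tapes_in: "read (stack_tapes h s r) \<in> insert Blank (range Inp)"
  unfolding stack_tapes_def by (rule read_stack_tape_in)

lemma symbol_stack_tapes: "symbol (read (stack_tapes h s r)) = peek (s r)"
  by (simp add: stack_tapes_def)

lemma stack_step:
  assumes "trans_rel (None, K) (\<lambda>r. read (stack_tapes h s r)) (None, K') f"
    "K \<in> conts P0 []" "K' \<in> insert [] (conts P0 [])"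
    "\<And>r. act (f r) (stack_tapes h s r) = stack_tapes h' s' r"
  shows "step M (code (None, K), map (stack_tapes h s) regs)
    (code (None, K'), map (stack_tapes h' s') regs)"
  using assms by (intro step_I[where f = f, OF _ read_stack_tapes_in]) (auto simp: S_def)

lemma stay_step:
  assumes "trans_rel (None, K) (\<lambda>r. read (stack_tapes h s r)) (None, K') (stay (\<lambda>r. read (stack_tapes h s r)))"
    "K \<in> conts P0 []" "K' \<in> insert [] (conts P0 [])"
  shows "step M (code (None, K), map (stack_tapes h s) regs)
    (code (None, K'), map (stack_tapes h s) regs)"
  using assms by (rule stack_step) (simp add: stay_def)

lemma act_case:
  "act (((stay (\<lambda>r. read (stack_tapes h s r)))
      (r := (Blank, if read (stack_tapes h s r) = Blank then Stay else MoveR))) r') (stack_tapes h s r') =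
   stack_tapes (h(r := if s r = [] then h r else h r + 1)) (s(r := tl (s r))) r'"
proof (cases "r' = r")
  case True
  show ?thesis
  proof (cases "s r")
    case Nil
    then have "read (stack_tapes h s r) = Blank" by (simp add: stack_tapes_def)
    then show ?thesis using True Nil by (simp add: stack_tapes_def act_stay_Nil)
  next
    case (Cons a xs)
    then show ?thesis using True by (simp add: stack_tapes_def act_pop)
  qed
qed (simp add: stay_def stack_tapes_def)

lemma read_after_move:
  "read (act (((stay (\<lambda>r. read (stack_tapes h s r)))(r := (read (stack_tapes h s r), MoveL))) r')
     (stack_tapes h s r')) \<in> insert Blank (range Inp)"
  using read_stack_tapes_in[of h s r'] by (auto simp: stay_def stack_tapes_def read_move_left)

lemma act_write:
  fixes r :: 'r and a :: 'a
  defines "T \<equiv> \<lambda>h s r'. act (((stay (\<lambda>r. read (stack_tapes h s r)))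
    (r := (read (stack_tapes h s r), MoveL))) r') (stack_tapes h s r')"
  shows "act (((stay (\<lambda>r. read (T h s r)))(r := (Inp a, Stay))) r') (T h s r') =
    stack_tapes (h(r := h r - 1)) (s(r := a # s r)) r'"
  by (auto simp: T_def stay_def stack_tapes_def act_push)

lemma steps_Suc: "step M c c' \<Longrightarrow> (step M ^^ n) c' c'' \<Longrightarrow> (step M ^^ Suc n) c c''"
  by (rule relpowp_Suc_I2)

text \<open>The simulation preserves the step count, which transfers time bounds from programs to
  machines. The condition on \<open>conts\<close> keeps every intermediate control inside
  \<open>S\<close>. The final head positions depend on the run, so they are existentially
  quantified.\<close>

lemma steps_of_run:
  assumes "run P t s s'" "conts P K \<subseteq> conts P0 []" "K \<in> insert [] (conts P0 [])"
  shows "\<exists>h'. (step M ^^ t) (code (None, P # K), map (stack_tapes h s) regs)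
    (code (None, K), map (stack_tapes h' s') regs)"
  using assms
proof (induction arbitrary: K h rule: run.induct)
  case (Skip s)
  then show ?case using stay_step[OF trans_rel.intros(1), of K h s] by auto
next
  case (Push r a s)
  let ?T = "\<lambda>r'. act (((stay (\<lambda>r. read (stack_tapes h s r)))
    (r := (read (stack_tapes h s r), MoveL))) r') (stack_tapes h s r')"
  have "step M (code (None, Push r a # K), map (stack_tapes h s) regs) (code (Some (r, a), K), map ?T regs)"
    using Push.prems by (intro step_I[OF _ read_stack_tapes_in _ trans_rel.intros(2)]) (auto simp: S_def)
  moreover have "step M (code (Some (r, a), K), map ?T regs)
      (code (None, K), map (stack_tapes (h(r := h r - 1)) (s(r := a # s r))) regs)"
    using Push.prems by (intro step_I[OF _ read_after_move _ trans_rel.intros(3)]) (simp_all only: act_write, auto simp: S_def)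
  ultimately show ?case unfolding numeral_2_eq_2 by (blast intro: relpowp_Suc_I relpowp_0_I)
next
  case (Case f s r t s')
  let ?h = "h(r := if s r = [] then h r else h r + 1)"
  have "f (peek (s r)) # K \<in> conts P0 []"
    using Case.prems(1) conts_self[of "f (peek (s r))" K] by auto
  then have "step M (code (None, Case r f # K), map (stack_tapes h s) regs)
      (code (None, f (peek (s r)) # K), map (stack_tapes ?h (s(r := tl (s r)))) regs)"
    using Case.prems trans_rel.intros(4)[of r f K "\<lambda>r. read (stack_tapes h s r)", unfolded symbol_stack_tapes]
    by (intro stack_step[where f = "(stay (\<lambda>r. read (stack_tapes h s r)))
        (r := (Blank, if read (stack_tapes h s r) = Blank then Stay else MoveR))"] act_case) auto
  moreover obtain h' where "(step M ^^ t) (code (None, f (peek (s r)) # K),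
      map (stack_tapes ?h (s(r := tl (s r)))) regs) (code (None, K), map (stack_tapes h' s') regs)"
    using Case.IH[of K ?h] Case.prems by (simp add: UN_subset_iff del: fun_upd_apply) blast
  ultimately show ?case by (blast intro: relpowp_Suc_I2)
next
  case (Seq P t s s' Q u s'')
  have *: "P # Q # K \<in> conts P0 []" "Q # K \<in> conts P0 []"
    using Seq.prems(1) conts_self by fastforce+
  obtain h1 where 1: "(step M ^^ t) (code (None, P # Q # K), map (stack_tapes h s) regs)
      (code (None, Q # K), map (stack_tapes h1 s') regs)"
    using Seq.IH(1)[of "Q # K" h] Seq.prems * by auto
  obtain h2 where 2: "(step M ^^ u) (code (None, Q # K), map (stack_tapes h1 s') regs)
      (code (None, K), map (stack_tapes h2 s'') regs)"
    using Seq.IH(2)[of K h1] Seq.prems * by auto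
  have "step M (code (None, (P ;; Q) # K), map (stack_tapes h s) regs)
      (code (None, P # Q # K), map (stack_tapes h s) regs)"
    using Seq.prems * by (intro stay_step trans_rel.intros(5)) (auto )
  from steps_Suc[OF this relpowp_trans[OF 1 2]] show ?case by blast
next
  case (While_stop s r S P)
  then have "step M (code (None, While r S P # K), map (stack_tapes h s) regs)
      (code (None, K), map (stack_tapes h s) regs)"
    by (intro stay_step trans_rel.intros(6)) (auto simp: symbol_stack_tapes)
  then show ?case by auto
next
  case (While_step s r S P t s' u s'')
  have *: "P # While r S P # K \<in> conts P0 []" "While r S P # K \<in> conts P0 []"
    using While_step.prems(1) conts_self by fastforce+
  obtain h1 where 1: "(step M ^^ t) (code (None, P # While r S P # K), map (stack_tapes h s) regs)
      (code (None, While r S P # K), map (stack_tapes h1 s') regs)"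
    using While_step.IH(1)[of "While r S P # K" h] While_step.prems * by auto
  obtain h2 where 2: "(step M ^^ u) (code (None, While r S P # K), map (stack_tapes h1 s') regs)
      (code (None, K), map (stack_tapes h2 s'') regs)"
    using While_step.IH(2)[of K h1] While_step.prems * by auto
  have "step M (code (None, While r S P # K), map (stack_tapes h s) regs)
      (code (None, P # While r S P # K), map (stack_tapes h s) regs)"
    using While_step * by (intro stay_step trans_rel.intros(7)) (auto simp: symbol_stack_tapes)
  from steps_Suc[OF this relpowp_trans[OF 1 2]] show ?case by blast
next
  case (Choice1 P t s s' Q)
  have *: "P # K \<in> conts P0 []"
    using Choice1.prems(1) conts_self by fastforce+
  have st: "step M (code (None, Choice P Q # K), map (stack_tapes h s) regs)
      (code (None, P # K), map (stack_tapes h s) regs)"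
    using Choice1.prems * by (intro stay_step trans_rel.intros(8)) auto
  have "\<exists>h'. (step M ^^ t) (code (None, P # K), map (stack_tapes h s) regs)
      (code (None, K), map (stack_tapes h' s') regs)"
    using Choice1 by auto
  then show ?case using steps_Suc[OF st] by (elim exE) blast
next
  case (Choice2 Q t s s' P)
  have *: "Q # K \<in> conts P0 []"
    using Choice2.prems(1) conts_self by fastforce+
  have st: "step M (code (None, Choice P Q # K), map (stack_tapes h s) regs)
      (code (None, Q # K), map (stack_tapes h s) regs)"
    using Choice2.prems * by (intro stay_step trans_rel.intros(9)) auto
  have "\<exists>h'. (step M ^^ t) (code (None, Q # K), map (stack_tapes h s) regs)
      (code (None, K), map (stack_tapes h' s') regs)"
    using Choice2 by auto
  then show ?case using steps_Suc[OF st] by (elim exE) blast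
next
  case (Star_stop P s)
  then have "step M (code (None, Star P # K), map (stack_tapes h s) regs)
      (code (None, K), map (stack_tapes h s) regs)"
    by (intro stay_step trans_rel.intros(10)) (auto )
  then show ?case by auto
next
  case (Star_step P t s s' u s'')
  have *: "P # Star P # K \<in> conts P0 []" "Star P # K \<in> conts P0 []"
    using Star_step.prems(1) conts_self by fastforce+
  obtain h1 where 1: "(step M ^^ t) (code (None, P # Star P # K), map (stack_tapes h s) regs)
      (code (None, Star P # K), map (stack_tapes h1 s') regs)"
    using Star_step.IH(1)[of "Star P # K" h] Star_step.prems * by auto
  obtain h2 where 2: "(step M ^^ u) (code (None, Star P # K), map (stack_tapes h1 s') regs)
      (code (None, K), map (stack_tapes h2 s'') regs)"
    using Star_step.IH(2)[of K h1] Star_step.prems * by auto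
  have "step M (code (None, Star P # K), map (stack_tapes h s) regs)
      (code (None, P # Star P # K), map (stack_tapes h s) regs)"
    using Star_step * by (intro stay_step trans_rel.intros(11)) (auto )
  from steps_Suc[OF this relpowp_trans[OF 1 2]] show ?case by blast
qed

text \<open>The accepting control has an empty continuation, so an accepting computation that starts
  with \<open>P\<close> on top must finish \<open>P\<close> at some moment; the computation is split
  there. The induction is on the whole length because sequences and loops apply the hypothesis again
  to the remainder of the first split.\<close>

lemma run_of_steps:
  assumes "(step M ^^ t) (code (None, P # K), map (stack_tapes h s) regs) c"
    "fst c = accept M" "P # K \<in> conts P0 []"
  shows "\<exists>t1 t2 s' h'. t = t1 + t2 \<and> run P t1 s s' \<and> K \<in> insert [] (conts P0 []) \<and>
    (step M ^^ t2) (code (None, K), map (stack_tapes h' s') regs) c"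
  using assms
proof (induction t arbitrary: P K h s rule: less_induct)
  case (less t)
  have PK: "(None, P # K) \<in> S" using less.prems(3) by (simp add: S_def)
  have "t \<noteq> 0"
  proof
    assume "t = 0"
    then have "code (None, P # K) = code (None, [])"
      using less.prems(1,2) by auto
    then show False using PK code_final by blast
  qed
  then obtain n where t: "t = Suc n" by (cases t) auto
  from less.prems(1) obtain c1 where c1: "step M (code (None, P # K), map (stack_tapes h s) regs) c1"
    and rest: "(step M ^^ n) c1 c"
    unfolding t by (blast elim: relpowp_Suc_E2)
  let ?x = "\<lambda>r. read (stack_tapes h s r)"
  obtain q' f where q': "q' \<in> S" "trans_rel (None, P # K) ?x q' f"
    and c1': "c1 = (code q', map (\<lambda>r. act (f r) (stack_tapes h s r)) regs)"
    using c1 unfolding step_iff[OF PK read_stack_tapes_in] by blast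
  note IH = less.IH[OF _ _ less.prems(2)]
  have stay: "(step M ^^ n) (code q', map (stack_tapes h s) regs) c" if "f = stay ?x"
    using rest that by (simp add: c1' stay_def)
  from q'(2) show ?case
  proof (cases rule: trans_relE[consumes 1])
    case 1
    then show ?thesis using stay q'(1) 1 t run.Skip by - (rule exI[of _ 1], rule exI[of _ n], auto simp: S_def)
  next
    case (2 r a K')
    let ?T = "\<lambda>r'. act (((stay ?x)(r := (?x r, MoveL))) r') (stack_tapes h s r')"
    have c1: "c1 = (code (Some (r, a), K), map ?T regs)"
      using c1' 2 by simp
    \<comment> \<open>Between the two steps of a push the control carries a pending symbol, so it is
      not the accepting one.\<close>
    have "n \<noteq> 0"
    proof
      assume "n = 0"
      then have "code (Some (r, a), K) = code (None, [])"
        using rest less.prems(2) c1 by auto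
      then show False using q'(1) 2 code_final by blast
    qed
    then obtain m where n: "n = Suc m" by (cases n) auto
    from rest obtain c2 where c2: "step M (code (Some (r, a), K), map ?T regs) c2"
      and rest': "(step M ^^ m) c2 c"
      unfolding n c1 by (blast elim: relpowp_Suc_E2)
    have "(Some (r, a), K) \<in> S"
      using q'(1) 2 by simp
    note step_iff[OF this read_after_move, THEN iffD1, OF c2]
    then obtain q'' f' where "q'' \<in> S" "trans_rel (Some (r, a), K) (\<lambda>r. read (?T r)) q'' f'"
      "c2 = (code q'', map (\<lambda>r. act (f' r) (?T r)) regs)" by blast
    then have "c2 = (code (None, K), map (stack_tapes (h(r := h r - 1)) (s(r := a # s r))) regs)"
      by (elim trans_rel_writeE) (simp only: act_write)
    then show ?thesis using rest' q'(1) 2 t n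
      by - (rule exI[of _ 2], rule exI[of _ m], rule exI[of _ "s(r := a # s r)"], rule exI[of _ "h(r := h r - 1)"],
        use run.Push[of r a s] in \<open>auto simp: S_def simp del: fun_upd_apply\<close>)
  next
    case (3 r g K')
    let ?h = "h(r := if s r = [] then h r else h r + 1)"
    have f: "f = (stay ?x)(r := (Blank, if ?x r = Blank then Stay else MoveR))" and g: "P = Case r g"
      and q1: "q' = (None, g (peek (s r)) # K)"
      using 3 by (simp_all add: stack_tapes_def)
    have "(step M ^^ n) (code (None, g (peek (s r)) # K), map (stack_tapes ?h (s(r := tl (s r)))) regs) c"
      using rest unfolding c1' q1 f act_case .
    moreover have "g (peek (s r)) # K \<in> conts P0 []" "n < t"
      using q'(1) q1 by (simp_all add: S_def t)
    ultimately obtain t1 t2 s' h' where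
      "n = t1 + t2" "run (g (peek (s r))) t1 (s(r := tl (s r))) s'" "K \<in> insert [] (conts P0 [])"
      "(step M ^^ t2) (code (None, K), map (stack_tapes h' s') regs) c"
      using IH by blast
    then show ?thesis unfolding g t by - (rule exI[of _ "Suc t1"], rule exI[of _ t2], auto intro: run.Case)
  next
    case (4 P1 P2 K')
    have "P1 # P2 # K \<in> conts P0 []" "n < t"
      and st: "(step M ^^ n) (code (None, P1 # P2 # K), map (stack_tapes h s) regs) c"
      using q'(1) 4 stay by (simp_all add: S_def t)
    from IH[OF this(2) st this(1)] obtain t1 t2 s' h' where
      1: "n = t1 + t2" "run P1 t1 s s'" "P2 # K \<in> conts P0 []"
      "(step M ^^ t2) (code (None, P2 # K), map (stack_tapes h' s') regs) c"
      by blast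
    have "t2 < t"
      using t 1(1) by simp
    from IH[OF this 1(4)] 1(3) obtain t3 t4 s'' h'' where
      "t2 = t3 + t4" "run P2 t3 s' s''" "K \<in> insert [] (conts P0 [])"
      "(step M ^^ t4) (code (None, K), map (stack_tapes h'' s'') regs) c"
      by blast
    then show ?thesis using 4 1 t
      by - (rule exI[of _ "Suc (t1 + t3)"], rule exI[of _ t4], auto intro: run.Seq)
  next
    case (5 r S' P1 K')
    then show ?thesis using stay q'(1) 5 t
      by - (rule exI[of _ 1], rule exI[of _ n], rule exI[of _ s], rule exI[of _ h],
        use run.While_stop run.Star_stop in \<open>auto simp: S_def symbol_stack_tapes\<close>)
  next
    case (6 r S' P1 K')
    then have q'_eq: "q' = (None, P1 # P # K)" "peek (s r) \<in> S'" "P = While r S' P1"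
      by (auto simp: symbol_stack_tapes)
    have "P1 # P # K \<in> conts P0 []" "n < t"
      and st: "(step M ^^ n) (code (None, P1 # P # K), map (stack_tapes h s) regs) c"
      using q'(1) 6 stay by (simp_all add: S_def t)
    from IH[OF this(2) st this(1)] obtain t1 t2 s' h' where
      1: "n = t1 + t2" "run P1 t1 s s'" "P # K \<in> conts P0 []"
      "(step M ^^ t2) (code (None, P # K), map (stack_tapes h' s') regs) c"
      by blast
    have "t2 < t"
      using t 1(1) by simp
    from IH[OF this 1(4)] 1(3) obtain t3 t4 s'' h'' where
      "t2 = t3 + t4" "run P t3 s' s''" "K \<in> insert [] (conts P0 [])"
      "(step M ^^ t4) (code (None, K), map (stack_tapes h'' s'') regs) c"
      by blast
    then show ?thesis using q'_eq 1 t
      by - (rule exI[of _ "Suc (t1 + t3)"], rule exI[of _ t4], auto intro: run.While_step)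
  next
    case (7 P1 P2 K')
    have "P1 # K \<in> conts P0 []" "n < t"
      and st: "(step M ^^ n) (code (None, P1 # K), map (stack_tapes h s) regs) c"
      using q'(1) 7 stay by (simp_all add: S_def t)
    from IH[OF this(2) st this(1)] obtain t1 t2 s' h' where
      1: "n = t1 + t2" "run P1 t1 s s'" "K \<in> insert [] (conts P0 [])"
      "(step M ^^ t2) (code (None, K), map (stack_tapes h' s') regs) c"
      by blast
    then show ?thesis unfolding t using 7 by - (rule exI[of _ "Suc t1"], rule exI[of _ t2], auto intro: run.Choice1)
  next
    case (8 P1 P2 K')
    have "P2 # K \<in> conts P0 []" "n < t"
      and st: "(step M ^^ n) (code (None, P2 # K), map (stack_tapes h s) regs) c"
      using q'(1) 8 stay by (simp_all add: S_def t)
    from IH[OF this(2) st this(1)] obtain t1 t2 s' h' where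
      1: "n = t1 + t2" "run P2 t1 s s'" "K \<in> insert [] (conts P0 [])"
      "(step M ^^ t2) (code (None, K), map (stack_tapes h' s') regs) c"
      by blast
    then show ?thesis unfolding t using 8 by - (rule exI[of _ "Suc t1"], rule exI[of _ t2], auto intro: run.Choice2)
  next
    case (9 P1 K')
    then show ?thesis using stay q'(1) 9 t
      by - (rule exI[of _ 1], rule exI[of _ n], rule exI[of _ s], rule exI[of _ h],
        use run.While_stop run.Star_stop in \<open>auto simp: S_def symbol_stack_tapes\<close>)
  next
    case (10 P1 K')
    then have q'_eq: "q' = (None, P1 # P # K)" "P = Star P1"
      by (auto simp: stack_tapes_def)
    have "P1 # P # K \<in> conts P0 []" "n < t"
      and st: "(step M ^^ n) (code (None, P1 # P # K), map (stack_tapes h s) regs) c"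
      using q'(1) 10 stay by (simp_all add: S_def t)
    from IH[OF this(2) st this(1)] obtain t1 t2 s' h' where
      1: "n = t1 + t2" "run P1 t1 s s'" "P # K \<in> conts P0 []"
      "(step M ^^ t2) (code (None, P # K), map (stack_tapes h' s') regs) c"
      by blast
    have "t2 < t"
      using t 1(1) by simp
    from IH[OF this 1(4)] 1(3) obtain t3 t4 s'' h'' where
      "t2 = t3 + t4" "run P t3 s' s''" "K \<in> insert [] (conts P0 [])"
      "(step M ^^ t4) (code (None, K), map (stack_tapes h'' s'') regs) c"
      by blast
    then show ?thesis using q'_eq 1 t
      by - (rule exI[of _ "Suc (t1 + t3)"], rule exI[of _ t4], auto intro: run.Star_step)
  qed
qed

lemma init_eq: "init M w = (code (None, [P0]), map (stack_tapes (\<lambda>_. 0) (initial r0 w)) regs)"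
proof -
  have "map (stack_tapes (\<lambda>_. 0) (initial r0 w)) rs = replicate (length rs) blank_tape"
    using rs(2) by (intro nth_equalityI)
      (auto simp: stack_tapes_def stack_tape_def initial_def blank_tape_def)
  moreover have "stack_tapes (\<lambda>_. 0) (initial r0 w) r0 = input_tape w"
    by (simp add: stack_tapes_def initial_def stack_tape_def input_tape_def fun_eq_iff)
  ultimately show ?thesis by (simp add: init_def M_def regs)
qed

lemma accepts_of_run:
  assumes "run P0 t (initial r0 w) s"
  shows "accepts_in M w t"
  using steps_of_run[OF assms, of "[]" "\<lambda>_. 0"]
  by (auto simp: accepts_in_def init_eq)

lemma run_of_accepts:
  assumes "accepts_in M w t"
  shows "\<exists>t s. run P0 t (initial r0 w) s"
proof -
  obtain c where "(step M ^^ t) (init M w) c" "fst c = accept M"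
    using assms by (auto simp: accepts_in_def)
  then show ?thesis
    using run_of_steps[of t P0 "[]" "\<lambda>_. 0" "initial r0 w" c] conts_self[of P0 "[]"]
    by (auto simp: init_eq)
qed

end

text \<open>From here on machines disappear: membership in \<open>NP\<close> is shown by a program
  whose halting set is \<open>L\<close> and which has one short run on each member.\<close>

theorem stack_program_NP:
  fixes P :: "('r, 'a::finite) prog"
  assumes rs: "set (r0 # rs) = UNIV" "r0 \<notin> set rs"
    and L: "\<And>w. w \<in> L \<longleftrightarrow> (\<exists>t s. run P t (initial r0 w) s)"
    and time: "\<And>w. w \<in> L \<Longrightarrow> \<exists>t \<le> poly p (length w). \<exists>s. run P t (initial r0 w) s"
  shows "L \<in> NP"
proof -
  define S :: "('r, 'a) control set" where
    "S = insert None (range Some) \<times> insert [] (conts P [])"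
  have "finite (UNIV :: 'r set)"
    using rs(1) by (metis List.finite_set)
  then have "finite S"
    unfolding S_def using finite_conts[of P "[]"]
    by (intro finite_cartesian_product) (auto simp: finite_prod)
  then obtain code :: "('r, 'a) control \<Rightarrow> nat" where code: "inj_on code S"
    using finite_imp_inj_to_nat_seg by metis
  define M where "M = \<lparr>tapes = length (r0 # rs), start = code (None, [P]), accept = code (None, []),
       trans = {(code q, map x (r0 # rs), code q', map f (r0 # rs)) | q x q' f.
         q \<in> S \<and> q' \<in> S \<and> range x \<subseteq> insert Blank (range Inp) \<and> trans_rel q x q' f}\<rparr>"
  interpret compiled "r0 # rs" rs r0 P code S M
    by unfold_locales (use rs S_def code M_def in simp_all)
  have "language M = L"
    using accepts_of_run run_of_accepts L by (auto simp: language_def) blast+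
  moreover have "\<forall>w\<in>L. \<exists>t \<le> poly p (length w). accepts_in M w t"
    using time accepts_of_run by meson
  ultimately show ?thesis using wf unfolding NP_def by blast
qed

section \<open>Small countermodels\<close>

text \<open>Selection-function semantics with at most one selected world. Taking the extension of
  the antecedent as argument builds in \<open>RCEA\<close>, and the option type builds in
  \<open>CEM\<close>.\<close>

primrec ext :: "('v \<Rightarrow> 'w set) \<Rightarrow> ('w set \<Rightarrow> 'w \<Rightarrow> 'w option) \<Rightarrow> 'v fm \<Rightarrow> 'w set" where
  "ext V f Bot = {}"
| "ext V f (Var p) = V p"
| "ext V f (Neg A) = - ext V f A"
| "ext V f (Conj A B) = ext V f A \<inter> ext V f B"
| "ext V f (Cond A B) = {w. \<forall>u. f (ext V f A) w = Some u \<longrightarrow> u \<in> ext V f B}"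

definition rules :: "bool \<Rightarrow> 'v rule set" where
  "rules idf = (if idf then CKIDCEM else CKCEM)"

lemma bigor_single [simp]: "bigor {#A#} = A"
proof -
  have "(SOME As. mset As = {#A#}) = [A]"
    by (rule some_equality) (auto simp: mset_single_iff)
  then show ?thesis by (simp add: bigor_def)
qed

lemma ext_conj_list: "w \<in> ext V f (conj_list As) \<longleftrightarrow> (\<forall>A\<in>set As. w \<in> ext V f A)"
  by (induction As rule: conj_list.induct) auto

lemma ext_imp_list:
  "w \<in> ext V f (imp_list As B) \<longleftrightarrow> ((\<forall>A\<in>set As. w \<in> ext V f A) \<longrightarrow> w \<in> ext V f B)"
  by (auto simp: imp_list_def ext_conj_list)

lemma ext_subst:
  "cond_free P \<Longrightarrow> w \<in> ext V f (subst \<sigma> P) \<longleftrightarrow> peval (\<lambda>p. w \<in> ext V f (\<sigma> p)) P"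
  by (induction P) auto

text \<open>\<open>RCEA\<close> holds since \<open>f\<close> sees only extensions,
  \<open>RCK\<close> since a conditional is truth at the selected world if there is one,
  \<open>CEM\<close> since there is at most one, and \<open>ID\<close> by the hypothesis on
  \<open>f\<close>.\<close>

theorem soundness:
  assumes "hilbert (rules idf) A" and idf: "\<And>X w u. idf \<Longrightarrow> f X w = Some u \<Longrightarrow> u \<in> X"
  shows "w \<in> ext V f A"
  using assms(1)
proof (induction arbitrary: w rule: hilbert.induct)
  case (taut P \<sigma>)
  then show ?case by (simp add: tautology_def ext_subst)
next
  case (mp A B)
  from mp.IH(1)[of w] mp.IH(2)[of w] show ?case by auto
next
  case (rule \<Gamma>s \<Gamma>\<^sub>0)
  then consider "(\<Gamma>s, \<Gamma>\<^sub>0) \<in> RCEA" | "(\<Gamma>s, \<Gamma>\<^sub>0) \<in> RCK" | "(\<Gamma>s, \<Gamma>\<^sub>0) \<in> CEM" | "idf" "(\<Gamma>s, \<Gamma>\<^sub>0) \<in> ID"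
    by (auto simp: rules_def CKCEM_def CKIDCEM_def split: if_splits)
  then show ?case
  proof cases
    case 1
    then obtain A A' B where *: "\<Gamma>s = [{#Iff A A'#}]" "\<Gamma>\<^sub>0 = {#Iff (Cond A B) (Cond A' B)#}"
      by (auto simp: RCEA_def)
    have "u \<in> ext V f (Iff A A')" for u
      using rule.IH * by simp
    then have "ext V f A = ext V f A'" by auto
    then show ?thesis by (simp add: *)
  next
    case 2
    then obtain A Bs B where *: "\<Gamma>s = [{#imp_list Bs B#}]"
      "\<Gamma>\<^sub>0 = {#imp_list (map (Cond A) Bs) (Cond A B)#}"
      by (auto simp: RCK_def)
    have "u \<in> ext V f (imp_list Bs B)" for u
      using rule.IH * by simp
    then show ?thesis by (auto simp: * ext_imp_list)
  next
    case 3
    then show ?thesis by (auto simp: CEM_def)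
  next
    case 4
    then show ?thesis using idf by (auto simp: ID_def)
  qed
qed

section \<open>Maximal consistent sets and the canonical successor\<close>

context
  fixes idf :: bool
begin

abbreviation prov :: "'v fm \<Rightarrow> bool" where
  "prov \<equiv> hilbert (rules idf)"

lemma prov_RCEA: "prov (Iff A A') \<Longrightarrow> prov (Iff (Cond A B) (Cond A' B))"
  using hilbert.rule[of "[{#Iff A A'#}]" "{#Iff (Cond A B) (Cond A' B)#}" "rules idf"]
  by (auto simp: rules_def CKCEM_def CKIDCEM_def RCEA_def)

lemma prov_RCK: "prov (imp_list Bs B) \<Longrightarrow> prov (imp_list (map (Cond A) Bs) (Cond A B))"
proof -
  have "([{#imp_list Bs B#}], {#imp_list (map (Cond A) Bs) (Cond A B)#}) \<in> rules idf"
    unfolding rules_def CKCEM_def CKIDCEM_def RCK_def by simp blast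
  from hilbert.rule[OF this] show "prov (imp_list Bs B) \<Longrightarrow> ?thesis" by simp
qed

lemma prov_CEM: "prov (Disj (Cond A B) (Cond A (Neg B)))"
  using hilbert.rule[of "[]" "{#Disj (Cond A B) (Cond A (Neg B))#}" "rules idf"]
  by (auto simp: rules_def CKCEM_def CKIDCEM_def CEM_def)

lemma prov_ID: "idf \<Longrightarrow> prov (Cond A A)"
  using hilbert.rule[of "[]" "{#Cond A A#}" "rules idf"]
  by (auto simp: rules_def CKIDCEM_def ID_def)

text \<open>The propositional steps below involve at most three formulas, so each reduces to
  evaluating a concrete formula in the letters 0, 1 and 2.\<close>

lemma prov_taut3:
  assumes "tautology P"
  shows "prov (subst ((!) [F, G, H]) P)"
  using assms by (rule hilbert.taut)

definition theory_set :: "'v fm set \<Rightarrow> bool" where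
  "theory_set T \<longleftrightarrow> (\<forall>F. prov F \<longrightarrow> F \<in> T) \<and> (\<forall>F G. Imp F G \<in> T \<longrightarrow> F \<in> T \<longrightarrow> G \<in> T)"

definition mcs :: "'v fm set \<Rightarrow> bool" where
  "mcs T \<longleftrightarrow> theory_set T \<and> Bot \<notin> T \<and> (\<forall>F. F \<in> T \<or> Neg F \<in> T)"

lemma theory_mp: "theory_set T \<Longrightarrow> Imp F G \<in> T \<Longrightarrow> F \<in> T \<Longrightarrow> G \<in> T"
  by (auto simp: theory_set_def)

lemma theory_taut: "theory_set T \<Longrightarrow> tautology P \<Longrightarrow> subst ((!) [F, G, H]) P \<in> T"
  using prov_taut3 unfolding theory_set_def by blast

lemma tautology_impI:
  assumes "theory_set T" "tautology (Imp P Q)" "subst ((!) [F, G, H]) P \<in> T"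
  shows "subst ((!) [F, G, H]) Q \<in> T"
  using theory_taut[OF assms(1,2), of F G H] theory_mp[OF assms(1)] assms(3) by auto

lemma tautology_imp2I:
  assumes "theory_set T" "tautology (Imp P (Imp P' Q))"
    "subst ((!) [F, G, H]) P \<in> T" "subst ((!) [F, G, H]) P' \<in> T"
  shows "subst ((!) [F, G, H]) Q \<in> T"
proof -
  have "subst ((!) [F, G, H]) (Imp P' Q) \<in> T"
    using tautology_impI[OF assms(1-3)] .
  then show ?thesis using theory_mp[OF assms(1)] assms(4) by auto
qed

lemma theory_explosion:
  assumes "theory_set T" "F \<in> T" "Neg F \<in> T"
  shows "G \<in> T"
  using tautology_imp2I[OF assms(1), of "Var 0" "Neg (Var 0)" "Var 1" F G G] assms(2,3)
  by (simp add: tautology_def)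

lemma theory_Bot:
  assumes "theory_set T" "Bot \<in> T"
  shows "G \<in> T"
  using tautology_impI[OF assms(1), of "Bot" "Var 0" G G G] assms(2)
  by (simp add: tautology_def)

lemma mcs_theory: "mcs T \<Longrightarrow> theory_set T"
  by (simp add: mcs_def)

lemma mcs_Neg: "mcs T \<Longrightarrow> Neg F \<in> T \<longleftrightarrow> F \<notin> T"
  using theory_explosion[of T F Bot] by (auto simp: mcs_def)

lemma mcs_Conj:
  assumes "mcs T"
  shows "Conj F G \<in> T \<longleftrightarrow> F \<in> T \<and> G \<in> T"
proof -
  note T = mcs_theory[OF assms]
  have "F \<in> T" if "Conj F G \<in> T"
    using tautology_impI[OF T, of "Conj (Var 0) (Var 1)" "Var 0" F G G] that
    by (simp add: tautology_def)
  moreover have "G \<in> T" if "Conj F G \<in> T"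
    using tautology_impI[OF T, of "Conj (Var 0) (Var 1)" "Var 1" F G G] that
    by (simp add: tautology_def)
  moreover have "Conj F G \<in> T" if "F \<in> T" "G \<in> T"
    using tautology_imp2I[OF T, of "Var 0" "Var 1" "Conj (Var 0) (Var 1)" F G G] that
    by (simp add: tautology_def)
  ultimately show ?thesis by blast
qed

lemma mcs_Iff: "mcs T \<Longrightarrow> Iff F G \<in> T \<longleftrightarrow> (F \<in> T \<longleftrightarrow> G \<in> T)"
  by (auto simp: mcs_Neg mcs_Conj)

text \<open>By the deduction theorem this set is the theory generated by \<open>T\<close> and
  \<open>F\<close>. It works because theories are closed under modus ponens only;
  \<open>RCEA\<close> and \<open>RCK\<close> stay confined to theorems.\<close>

lemma theory_extend:
  fixes F :: "'v fm"
  assumes T: "theory_set T"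
  shows "theory_set {G. Imp F G \<in> T}"
  unfolding theory_set_def
proof (intro conjI allI impI)
  fix G :: "'v fm" assume "prov G"
  then have "G \<in> T" using T by (auto simp: theory_set_def)
  then show "G \<in> {G. Imp F G \<in> T}"
    using tautology_impI[OF T, of "Var 0" "Imp (Var 1) (Var 0)" G F F]
    by (auto simp: tautology_def)
next
  fix G H :: "'v fm" assume "Imp G H \<in> {G. Imp F G \<in> T}" "G \<in> {G. Imp F G \<in> T}"
  then show "H \<in> {G. Imp F G \<in> T}"
    using tautology_imp2I[OF T, of "Imp (Var 0) (Imp (Var 1) (Var 2))" "Imp (Var 0) (Var 1)" "Imp (Var 0) (Var 2)" F G H]
    by (auto simp: tautology_def)
qed

text \<open>Zorn's lemma is applied to the theories that omit \<open>A\<close>. A maximal one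
  contains \<open>Imp F A\<close> for every \<open>F\<close> outside it, so if it omitted both
  \<open>F\<close> and \<open>Neg F\<close> it would contain \<open>A\<close>.\<close>

lemma lindenbaum:
  fixes A :: "'v fm"
  assumes "\<not> prov A"
  shows "\<exists>T. mcs T \<and> A \<notin> T"
proof -
  let ?\<T> = "{T. theory_set T \<and> A \<notin> T}"
  have base: "Collect prov \<in> ?\<T>"
    using assms by (auto simp: theory_set_def intro: hilbert.mp)
  have "\<exists>M\<in>?\<T>. \<forall>X\<in>?\<T>. M \<subseteq> X \<longrightarrow> X = M"
  proof (rule subset_Zorn_nonempty)
    show "?\<T> \<noteq> {}" using base by blast
  next
    fix \<C> assume \<C>: "\<C> \<noteq> {}" "subset.chain ?\<T> \<C>"
    then have th: "theory_set T" "A \<notin> T" if "T \<in> \<C>" for T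
      using that by (auto simp: subset.chain_def)
    have "theory_set (\<Union>\<C>)"
      unfolding theory_set_def
    proof (intro conjI allI impI)
      fix F :: "'v fm" assume "prov F"
      then show "F \<in> \<Union>\<C>" using \<C>(1) th(1) by (auto simp: theory_set_def)
    next
      fix F G :: "'v fm" assume "Imp F G \<in> \<Union>\<C>" "F \<in> \<Union>\<C>"
      then obtain T T' where "T \<in> \<C>" "T' \<in> \<C>" "Imp F G \<in> T" "F \<in> T'" by blast
      moreover then have "T \<subseteq> T' \<or> T' \<subseteq> T"
        using \<C>(2) by (auto simp: subset.chain_def)
      ultimately show "G \<in> \<Union>\<C>" using theory_mp[OF th(1)] by blast
    qed
    then show "\<Union>\<C> \<in> ?\<T>" using th by blast
  qed
  then obtain M where M: "theory_set M" "A \<notin> M"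
    and max: "\<And>X. theory_set X \<Longrightarrow> A \<notin> X \<Longrightarrow> M \<subseteq> X \<Longrightarrow> X = M" by blast
  have step: "Imp F A \<in> M" if "F \<notin> M" for F
  proof (rule ccontr)
    assume "Imp F A \<notin> M"
    moreover have "M \<subseteq> {G. Imp F G \<in> M}"
      using tautology_impI[OF M(1), of "Var 0" "Imp (Var 1) (Var 0)" _ F F]
      by (auto simp: tautology_def)
    ultimately have "{G. Imp F G \<in> M} = M"
      using max[OF theory_extend[OF M(1)]] by simp
    moreover have "Imp F F \<in> M"
      using theory_taut[OF M(1), of "Imp (Var 0) (Var 0)" F F F] by (simp add: tautology_def)
    ultimately show False using that by blast
  qed
  have "F \<in> M \<or> Neg F \<in> M" for F
  proof (rule ccontr)
    assume "\<not> (F \<in> M \<or> Neg F \<in> M)"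
    then have "Imp F A \<in> M" "Imp (Neg F) A \<in> M" using step by blast+
    then have "A \<in> M"
      using tautology_imp2I[OF M(1), of "Imp (Var 0) (Var 1)" "Imp (Neg (Var 0)) (Var 1)" "Var 1" F A A]
      by (auto simp: tautology_def)
    then show False using M(2) by contradiction
  qed
  then have "mcs M" using M theory_Bot by (auto simp: mcs_def)
  then show ?thesis using M(2) by blast
qed

definition succ :: "'v fm set \<Rightarrow> 'v fm \<Rightarrow> 'v fm set" where
  "succ T C = {F. Cond C F \<in> T}"

text \<open>By \<open>CEM\<close> the consequents of \<open>C\<close> at a maximal consistent set are themselves maximal
  consistent, unless they are contradictory: the canonical successor is unique.\<close>

lemma mcs_succ:
  assumes T: "mcs T" and "Bot \<notin> succ T C"
  shows "mcs (succ T C)"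
proof -
  have "theory_set (succ T C)"
    unfolding theory_set_def
  proof (intro conjI allI impI)
    fix F :: "'a fm" assume "prov F"
    \<comment> \<open>\<open>RCK\<close> with the empty list is necessitation; with two premises,
      below, it distributes the conditional over an implication.\<close>
    then have "prov (Cond C F)" using prov_RCK[of "[]" F C] by (simp add: imp_list_def)
    then show "F \<in> succ T C" using mcs_theory[OF T] by (simp add: succ_def theory_set_def)
  next
    fix F G assume FG: "Imp F G \<in> succ T C" "F \<in> succ T C"
    have "prov (imp_list [Imp F G, F] G)"
      using prov_taut3[of "Imp (Conj (Imp (Var 0) (Var 1)) (Var 0)) (Var 1)" F G G]
      by (auto simp: imp_list_def tautology_def)
    from prov_RCK[OF this, of C]
    have "Imp (Conj (Cond C (Imp F G)) (Cond C F)) (Cond C G) \<in> T"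
      using mcs_theory[OF T] by (simp add: imp_list_def theory_set_def)
    then show "G \<in> succ T C"
      using FG by (auto simp: succ_def mcs_Neg[OF T] mcs_Conj[OF T])
  qed
  moreover have "F \<in> succ T C \<or> Neg F \<in> succ T C" for F
    using prov_CEM[of C F] mcs_theory[OF T] T
    by (auto simp: succ_def theory_set_def mcs_Neg mcs_Conj)
  ultimately show ?thesis using assms(2) by (simp add: mcs_def)
qed

text \<open>The one place where \<open>RCEA\<close> enters completeness: successors depend on the
  antecedent only up to provable equivalence, which a table indexed by extensions can
  represent.\<close>

lemma succ_cong:
  assumes "mcs T" "prov (Iff C C')"
  shows "succ T C = succ T C'"
proof -
  have "Iff (Cond C F) (Cond C' F) \<in> T" for F
    using prov_RCEA[OF assms(2)] mcs_theory[OF assms(1)] by (auto simp: theory_set_def)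
  then show ?thesis by (auto simp: succ_def mcs_Iff[OF assms(1)] simp del: fm.inject)
qed

end

section \<open>Visited worlds and the truth lemma\<close>

text \<open>The antecedent is followed to the successor as well, because under \<open>ID\<close> the
  truth clause below asks whether the successor satisfies it.\<close>

primrec visited :: "'v fm \<Rightarrow> 'v fm set \<Rightarrow> 'v fm set set" where
  "visited Bot T = {T}"
| "visited (Var p) T = {T}"
| "visited (Neg A) T = visited A T"
| "visited (Conj A B) T = visited A T \<union> visited B T"
| "visited (Cond A B) T = insert T
     (if Bot \<in> succ T A then {} else visited A (succ T A) \<union> visited B (succ T A))"

lemma visited_self: "T \<in> visited F T"
  by (induction F) auto

lemma visited_mcs: "mcs idf T \<Longrightarrow> S \<in> visited F T \<Longrightarrow> mcs idf S"
  by (induction F arbitrary: T) (auto split: if_splits dest: mcs_succ)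

lemma visited_card: "finite (visited F T) \<and> card (visited F T) \<le> length (encode idx F)"
proof (induction F arbitrary: T)
  case (Conj A B)
  then show ?case using card_Un_le[of "visited A T" "visited B T"]
    by simp (meson Conj.IH add_mono le_Suc_eq order_trans)
next
  case (Cond A B)
  let ?S = "succ T A"
  have "card (visited A ?S \<union> visited B ?S) \<le> length (encode idx A) + length (encode idx B)"
    using card_Un_le[of "visited A ?S" "visited B ?S"] Cond.IH by (meson add_mono order_trans)
  then show ?case using Cond.IH by (auto simp: card_insert_if)
qed (auto intro: le_SucI)

primrec antecedents :: "'v fm \<Rightarrow> 'v fm set" where
  "antecedents Bot = {}"
| "antecedents (Var p) = {}"
| "antecedents (Neg A) = antecedents A"
| "antecedents (Conj A B) = antecedents A \<union> antecedents B"
| "antecedents (Cond A B) = insert A (antecedents A \<union> antecedents B)"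

primrec vars :: "'v fm \<Rightarrow> 'v set" where
  "vars Bot = {}"
| "vars (Var p) = {p}"
| "vars (Neg A) = vars A"
| "vars (Conj A B) = vars A \<union> vars B"
| "vars (Cond A B) = vars A \<union> vars B"

lemma antecedents_card:
  "finite (antecedents F) \<and> card (antecedents F) \<le> length (encode idx F)"
proof (induction F)
  case (Conj A B)
  then show ?case using card_Un_le[of "antecedents A" "antecedents B"] by simp
next
  case (Cond A B)
  then show ?case using card_Un_le[of "antecedents A" "antecedents B"]
    by (simp add: card_insert_if)
qed auto

lemma vars_card: "finite (vars F) \<and> card (vars F) \<le> length (encode idx F)"
proof (induction F)
  case (Conj A B)
  then show ?case using card_Un_le[of "vars A" "vars B"] by simp
next
  case (Cond A B)
  then show ?case using card_Un_le[of "vars A" "vars B"] by simp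
qed auto

lemma vars_encode: "p \<in> vars F \<Longrightarrow> length (binary (idx p)) \<le> length (encode idx F)"
  by (induction F) auto

lemma antecedents_encode: "C \<in> antecedents F \<Longrightarrow> length (encode idx C) \<le> length (encode idx F)"
  by (induction F) auto

text \<open>A stage between membership and \<open>ext\<close>: the successor is still found through
  the antecedent as a formula, but it counts only if it lies in \<open>W\<close> and, under
  \<open>ID\<close>, satisfies the antecedent.\<close>

primrec truth :: "bool \<Rightarrow> 'v fm set set \<Rightarrow> 'v fm \<Rightarrow> 'v fm set set" where
  "truth idf W Bot = {}"
| "truth idf W (Var p) = {T. Var p \<in> T}"
| "truth idf W (Neg A) = - truth idf W A"
| "truth idf W (Conj A B) = truth idf W A \<inter> truth idf W B"
| "truth idf W (Cond A B) = {T. Bot \<notin> succ T A \<and> succ T A \<in> W \<and> (idf \<longrightarrow> succ T A \<in> truth idf W A)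
     \<longrightarrow> succ T A \<in> truth idf W B}"

text \<open>A local truth lemma: \<open>W\<close> need not be closed under successors, since only
  the worlds inspected by the evaluation at \<open>T\<close> influence the value.\<close>

lemma truth_visited:
  assumes "mcs idf T" "visited F T \<subseteq> W"
  shows "T \<in> truth idf W F \<longleftrightarrow> F \<in> T"
  using assms
proof (induction F arbitrary: T)
  case (Cond A B)
  show ?case
  proof (cases "Bot \<in> succ T A")
    case True
    \<comment> \<open>A contradictory successor set contains every formula, in accordance with the
      vacuous truth of the conditional at a world without successor.\<close>
    have "B \<in> succ T A"
    proof -
      have "prov idf (imp_list [Bot] B)"
        using prov_taut3[of "Imp Bot (Var 0)" idf B B B] by (simp add: imp_list_def tautology_def)
      from prov_RCK[OF this, of A] have "Imp (Cond A Bot) (Cond A B) \<in> T"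
        using mcs_theory[OF Cond.prems(1)] by (simp add: imp_list_def theory_set_def)
      then show ?thesis using theory_mp[OF mcs_theory[OF Cond.prems(1)]] True
        by (auto simp: succ_def)
    qed
    then show ?thesis using True by (simp add: succ_def)
  next
    case False
    then have S: "mcs idf (succ T A)" "visited A (succ T A) \<subseteq> W" "visited B (succ T A) \<subseteq> W"
      using Cond.prems mcs_succ by auto
    have "succ T A \<in> W" using S(2) visited_self by blast
    \<comment> \<open>\<open>Cond A A\<close> is a theorem, so \<open>A\<close> belongs to the
      successor; the hypothesis for \<open>A\<close> turns this into truth, which is why
      \<open>visited\<close> includes the worlds for \<open>A\<close>.\<close>
    moreover have "succ T A \<in> truth idf W A" if idf
      using prov_ID[OF that, of A] mcs_theory[OF Cond.prems(1)] Cond.IH(1)[OF S(1,2)]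
      by (auto simp: succ_def theory_set_def)
    ultimately show ?thesis using Cond.IH(2)[OF S(1,3)] False by (auto simp: succ_def)
  qed
qed (auto simp: mcs_Neg mcs_Conj mcs_def)

section \<open>Finite models as tables\<close>

definition vec :: "nat \<Rightarrow> nat set \<Rightarrow> bool list" where
  "vec N X = map (\<lambda>i. i \<in> X) [0..<N]"

text \<open>The last matching entry wins and \<open>q\<close> is the best payload so far, which is
  what one pass over a tape with one payload register computes.\<close>

fun lookup :: "'p list \<Rightarrow> ('k \<times> 'p list) list \<Rightarrow> 'k \<Rightarrow> 'p list" where
  "lookup q [] k = q"
| "lookup q ((k', p) # es) k = lookup (if k' = k then p else q) es k"

text \<open>Different antecedents may share a key, so agreement of the payloads takes the place of
  injectivity of \<open>key\<close>.\<close>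

lemma lookup_map:
  assumes "\<And>x. x \<in> set xs \<Longrightarrow> key x = k \<Longrightarrow> pay x = p" "\<exists>x\<in>set xs. key x = k"
  shows "lookup q (map (\<lambda>x. (key x, pay x)) xs) k = p"
proof -
  have "lookup q (map (\<lambda>x. (key x, pay x)) xs) k = (if \<exists>x\<in>set xs. key x = k then p else q)"
    using assms(1) by (induction xs arbitrary: q) auto
  then show ?thesis using assms(2) by simp
qed

definition table_val :: "nat \<Rightarrow> (bool list \<times> bool list) list \<Rightarrow> ('v \<Rightarrow> bool list) \<Rightarrow> 'v \<Rightarrow> nat set" where
  "table_val N tv key p = {i. i < N \<and> i < length (lookup [] tv (key p)) \<and> lookup [] tv (key p) ! i}"

text \<open>Defects of a guessed table are repaired here: a missing or short row, an index outside
  the model and, under \<open>ID\<close>, a world outside the antecedent all mean that there is no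
  successor. So every table meets the hypothesis of \<open>soundness\<close>.\<close>

definition table_sel ::
  "bool \<Rightarrow> nat \<Rightarrow> (bool list \<times> nat option list) list \<Rightarrow> nat set \<Rightarrow> nat \<Rightarrow> nat option" where
  "table_sel idf N tc X i = (let p = lookup [] tc (vec N X) in
     if i < N \<and> i < length p \<and> (\<exists>j<N. p ! i = Some j \<and> (idf \<longrightarrow> j \<in> X)) then p ! i else None)"

lemma table_sel_Some:
  "table_sel idf N tc X i = Some j \<longleftrightarrow> i < N \<and> i < length (lookup [] tc (vec N X)) \<and>
     lookup [] tc (vec N X) ! i = Some j \<and> j < N \<and> (idf \<longrightarrow> j \<in> X)"
  by (auto simp: table_sel_def Let_def)

text \<open>The bound adds at most \<open>n\<close> worlds visited by \<open>A\<close> and, for each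
  of at most \<open>n * n\<close> pairs of antecedents, at most \<open>2 * n\<close> worlds visited
  by both members at their separating set. The key of a row is the truth vector of the antecedent,
  so the bounds on lengths are those of the words to be guessed.\<close>

theorem small_model:
  fixes A :: "'v fm"
  assumes "inj (\<lambda>p. binary (idx p))" "\<not> hilbert (rules idf) A"
  defines "n \<equiv> length (encode idx A)"
  shows "\<exists>N tv tc i. i < N \<and> i \<notin> ext (table_val N tv (\<lambda>p. binary (idx p))) (table_sel idf N tc) A \<and>
    N \<le> n + 2 * n ^ 3 \<and> length tv \<le> n \<and> length tc \<le> n \<and>
    (\<forall>(k, p)\<in>set tv. length k \<le> n \<and> length p = N) \<and>
    (\<forall>(k, p)\<in>set tc. length k = N \<and> length p = N \<and> (\<forall>j. Some j \<in> set p \<longrightarrow> j < N))"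
proof -
  obtain T0 where T0: "mcs idf T0" "A \<notin> T0" using lindenbaum[OF assms(2)] by blast
  let ?S = "antecedents A"
  have S: "finite ?S" "card ?S \<le> n" using antecedents_card[of A idx] by (auto simp: n_def)
  \<comment> \<open>\<open>Iff C C'\<close> is not derivable for the pairs of interest, so a maximal
    consistent set omits it and contains exactly one of \<open>C\<close> and
    \<open>C'\<close>.\<close>
  define d where "d C C' = (SOME T. mcs idf T \<and> Iff C C' \<notin> T)" for C C' :: "'v fm"
  have d: "mcs idf (d C C')" "(C \<in> d C C') \<noteq> (C' \<in> d C C')" if "\<not> prov idf (Iff C C')" for C C'
  proof -
    have "mcs idf (d C C') \<and> Iff C C' \<notin> d C C'"
      unfolding d_def using lindenbaum[OF that] by (rule someI_ex)
    then show "mcs idf (d C C')" "(C \<in> d C C') \<noteq> (C' \<in> d C C')" using mcs_Iff by blast+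
  qed
  define I where "I = {(C, C'). C \<in> ?S \<and> C' \<in> ?S \<and> \<not> prov idf (Iff C C')}"
  define D where "D = (\<lambda>(C, C'). visited C (d C C') \<union> visited C' (d C C'))"
  define W where "W = visited A T0 \<union> (\<Union>x\<in>I. D x)"
  have mcsW: "mcs idf T" if "T \<in> W" for T
    using that visited_mcs[OF T0(1)] visited_mcs[OF d(1)] by (fastforce simp: W_def I_def D_def)
  have I: "finite I" "card I \<le> n * n"
  proof -
    have "I \<subseteq> ?S \<times> ?S" by (auto simp: I_def)
    moreover have "card (?S \<times> ?S) \<le> n * n" using S by (simp add: card_cartesian_product mult_mono)
    ultimately show "finite I" "card I \<le> n * n"
      using S(1) by (meson finite_SigmaI finite_subset, meson card_mono finite_SigmaI le_trans S(1))
  qed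
  have D: "finite (D x) \<and> card (D x) \<le> 2 * n" if "x \<in> I" for x
  proof -
    obtain C C' where x: "x = (C, C')" "C \<in> ?S" "C' \<in> ?S" using \<open>x \<in> I\<close> by (auto simp: I_def)
    have "card (D x) \<le> length (encode idx C) + length (encode idx C')"
      using card_Un_le[of "visited C (d C C')" "visited C' (d C C')"]
        visited_card[of C "d C C'" idx] visited_card[of C' "d C C'" idx] by (simp add: D_def x)
    also have "\<dots> \<le> n + n" unfolding n_def by (intro add_mono antecedents_encode x)
    finally show ?thesis using visited_card[of _ _ idx] by (simp add: D_def x)
  qed
  have W: "finite W" "card W \<le> n + 2 * n ^ 3"
  proof -
    show "finite W" using I D visited_card[of A T0 idx] by (auto simp: W_def)
    have "card (\<Union>x\<in>I. D x) \<le> (\<Sum>x\<in>I. card (D x))" using I(1) by (rule card_UN_le)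
    also have "\<dots> \<le> card I * (2 * n)" using sum_bounded_above[of I "\<lambda>x. card (D x)" "2 * n"] D by simp
    also have "\<dots> \<le> (n * n) * (2 * n)" using I(2) by (rule mult_le_mono1)
    finally have "card (\<Union>x\<in>I. D x) \<le> 2 * n ^ 3" by (simp add: power3_eq_cube)
    then show "card W \<le> n + 2 * n ^ 3"
      using card_Un_le[of "visited A T0" "\<Union>x\<in>I. D x"] visited_card[of A T0 idx]
      by (simp add: W_def n_def)
  qed
  define N where "N = card W"
  obtain e where e: "bij_betw e {..<N} W"
    using W(1) ex_bij_betw_nat_finite[of W] by (auto simp: N_def atLeast0LessThan)
  have eW: "e i \<in> W" if "i < N" for i using e that by (auto simp: bij_betw_def)
  define ix where "ix = inv_into {..<N} e"
  have ix: "ix T < N" "e (ix T) = T" if "T \<in> W" for T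
    using that e f_inv_into_f[of T e "{..<N}"] inv_into_into[of T e "{..<N}"]
    by (auto simp: ix_def bij_betw_def)
  define ps where "ps = (SOME ps. set ps = vars A \<and> distinct ps)"
  have ps: "set ps = vars A" "distinct ps"
    using someI_ex[OF finite_distinct_list[of "vars A"]] vars_card[of A idx] by (auto simp: ps_def)
  define cs where "cs = (SOME cs. set cs = ?S \<and> distinct cs)"
  have cs: "set cs = ?S" "distinct cs"
    using someI_ex[OF finite_distinct_list[OF S(1)]] by (auto simp: cs_def)
  let ?key = "\<lambda>p. binary (idx p)"
  define tv where "tv = map (\<lambda>p. (?key p, vec N {i. Var p \<in> e i})) ps"
  define ckey where "ckey C = vec N {i. e i \<in> truth idf W C}" for C
  \<comment> \<open>The restriction that \<open>ID\<close> imposes is left to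
    \<open>table_sel\<close>, which tests membership in the antecedent itself.\<close>
  define cpay where "cpay C = map (\<lambda>i. if Bot \<notin> succ (e i) C \<and> succ (e i) C \<in> W
    then Some (ix (succ (e i) C)) else None) [0..<N]" for C
  define tc where "tc = map (\<lambda>C. (ckey C, cpay C)) cs"
  have tv: "lookup [] tv (?key p) = vec N {i. Var p \<in> e i}" if "p \<in> vars A" for p
    unfolding tv_def using ps that inj_onD[OF assms(1)] by (intro lookup_map) auto
  \<comment> \<open>Otherwise \<open>d C C'\<close> and everything visited from it by either formula
    would lie in \<open>W\<close>. There truth is membership, and membership differs, so the two
    vectors would differ at that world.\<close>
  have equiv: "prov idf (Iff C C')" if "C \<in> ?S" "C' \<in> ?S" "ckey C = ckey C'" for C C'
  proof (rule ccontr)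
    assume np: "\<not> prov idf (Iff C C')"
    let ?T = "d C C'"
    have "(C, C') \<in> I" using that np by (simp add: I_def)
    then have sub: "visited C ?T \<subseteq> W" "visited C' ?T \<subseteq> W"
      by (auto simp: W_def D_def)
    then have "?T \<in> W" using visited_self by blast
    moreover have "\<forall>i<N. (e i \<in> truth idf W C) = (e i \<in> truth idf W C')"
      using that(3) by (simp add: ckey_def vec_def)
    ultimately have "(?T \<in> truth idf W C) = (?T \<in> truth idf W C')"
      using ix[of ?T] by metis
    then show False
      using truth_visited[OF d(1)[OF np] sub(1)] truth_visited[OF d(1)[OF np] sub(2)] d(2)[OF np] by simp
  qed
  have tc: "lookup [] tc (ckey C) = cpay C" if C: "C \<in> ?S" for C
    unfolding tc_def
  proof (rule lookup_map)
    fix C' assume "C' \<in> set cs" "ckey C' = ckey C"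
    \<comment> \<open>Equal keys force provable equivalence, hence the same canonical successors and
      the same payload.\<close>
    then have "prov idf (Iff C' C)" using equiv C cs by simp
    then have "succ (e i) C' = succ (e i) C" if "i < N" for i
      using succ_cong[OF mcsW[OF eW[OF that]]] by blast
    then show "cpay C' = cpay C" by (simp add: cpay_def)
  qed (use C cs in auto)
  let ?E = "ext (table_val N tv ?key) (table_sel idf N tc)"
  have main: "\<forall>i<N. i \<in> ?E F \<longleftrightarrow> e i \<in> truth idf W F" if "vars F \<subseteq> vars A" "antecedents F \<subseteq> ?S" for F
    using that
  proof (induction F)
    case (Var p)
    then show ?case using tv[of p] by (auto simp: table_val_def vec_def)
  next
    case (Cond C B)
    then have IH: "\<forall>i<N. i \<in> ?E C \<longleftrightarrow> e i \<in> truth idf W C" "\<forall>i<N. i \<in> ?E B \<longleftrightarrow> e i \<in> truth idf W B"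
      and C: "C \<in> ?S" by auto
    \<comment> \<open>The extension in the table model has the stored truth vector by the induction
      hypothesis, so the lookup finds the row of \<open>C\<close>.\<close>
    have key: "vec N (?E C) = ckey C" using IH(1) by (simp add: vec_def ckey_def)
    have "table_sel idf N tc (?E C) i = Some j \<longleftrightarrow>
        Bot \<notin> succ (e i) C \<and> succ (e i) C \<in> W \<and> (idf \<longrightarrow> succ (e i) C \<in> truth idf W C) \<and>
        j = ix (succ (e i) C)" if "i < N" for i j
      unfolding table_sel_Some key tc[OF C] using that IH(1) ix by (auto simp: cpay_def)
    then show ?case using IH(2) ix by auto
  qed auto
  have "T0 \<in> W" using visited_self by (auto simp: W_def)
  moreover have "T0 \<notin> truth idf W A"
    using truth_visited[OF T0(1), of A W] T0(2) by (auto simp: W_def)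
  ultimately have "ix T0 < N" "ix T0 \<notin> ?E A" using main[of A] ix[of T0] by auto
  moreover have "length tv \<le> n" "length tc \<le> n"
    using ps cs S(2) vars_card[of A idx] distinct_card[of ps] distinct_card[of cs]
    by (simp_all add: tv_def tc_def n_def)
  moreover have "\<forall>(k, p)\<in>set tv. length k \<le> n \<and> length p = N"
    using ps vars_encode[of _ A idx] by (auto simp: tv_def vec_def n_def)
  moreover have "\<forall>(k, p)\<in>set tc. length k = N \<and> length p = N \<and> (\<forall>j. Some j \<in> set p \<longrightarrow> j < N)"
    using ix by (auto simp: tc_def ckey_def cpay_def vec_def)
  ultimately show ?thesis using W(2) unfolding N_def by blast
qed

section \<open>Timed reasoning about stack programs\<close>

text \<open>A timed possibility in the style of weakest preconditions: nesting \<open>reach\<close>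
  in the postcondition treats sequencing, so rules apply backwards. Proofs start with
  \<open>reach_mono\<close> so that the exact cost stays schematic and is compared with the claimed
  bound at the end.\<close>

definition reach :: "('r, 'a) prog \<Rightarrow> nat \<Rightarrow> (('r \<Rightarrow> 'a list) \<Rightarrow> bool) \<Rightarrow> ('r \<Rightarrow> 'a list) \<Rightarrow> bool" where
  "reach P t Q s \<longleftrightarrow> (\<exists>u\<le>t. \<exists>s'. run P u s s' \<and> Q s')"

lemma reachE:
  assumes "reach P t Q s"
  obtains u s' where "u \<le> t" "run P u s s'" "Q s'"
  using assms unfolding reach_def by blast

lemma reachI: "run P u s s' \<Longrightarrow> u \<le> t \<Longrightarrow> Q s' \<Longrightarrow> reach P t Q s"
  unfolding reach_def by blast

lemma reach_mono: "reach P t Q s \<Longrightarrow> t \<le> u \<Longrightarrow> reach P u Q s"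
  unfolding reach_def by (meson le_trans)

lemma reach_state: "reach P t Q s \<Longrightarrow> s = s' \<Longrightarrow> reach P t Q s'"
  by simp

lemma reach_conseq: "reach P t Q s \<Longrightarrow> (\<And>s'. Q s' \<Longrightarrow> R s') \<Longrightarrow> reach P t R s"
  unfolding reach_def by blast

lemma reach_deterministic:
  "reach P t Q s \<Longrightarrow> deterministic P \<Longrightarrow> run P u s s' \<Longrightarrow> Q s'"
  unfolding reach_def using run_unique by metis

lemma reach_run: "run P t s s' \<Longrightarrow> Q s' \<Longrightarrow> reach P t Q s"
  unfolding reach_def by blast

lemma reach_Skip: "Q s \<Longrightarrow> reach Skip 1 Q s"
  by (rule reach_run[OF run.Skip])

lemma reach_Push: "Q (s(r := a # s r)) \<Longrightarrow> reach (Push r a) 2 Q s"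
  by (rule reach_run[OF run.Push])

lemma reach_Case: "reach (f (peek (s r))) t Q (s(r := tl (s r))) \<Longrightarrow> reach (Case r f) (Suc t) Q s"
  unfolding reach_def by (meson Suc_le_mono run.Case)

lemma reach_Case_Some:
  "s r = a # xs \<Longrightarrow> reach (f (Some a)) t Q (s(r := xs)) \<Longrightarrow> reach (Case r f) (Suc t) Q s"
  by (rule reach_Case) simp

lemma reach_Case_None: "s r = [] \<Longrightarrow> reach (f None) t Q s \<Longrightarrow> reach (Case r f) (Suc t) Q s"
  by (rule reach_Case) (simp add: fun_upd_idem)

lemma reach_Seq:
  assumes "reach P t (reach R u Q) s"
  shows "reach (P ;; R) (Suc (t + u)) Q s"
proof -
  obtain v s' where *: "v \<le> t" "run P v s s'" "reach R u Q s'"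
    by (rule reachE[OF assms])
  obtain w s'' where "w \<le> u" "run R w s' s''" "Q s''"
    by (rule reachE[OF *(3)])
  then show ?thesis using * by (intro reachI[OF run.Seq]) auto
qed

lemma reach_Star_stop: "Q s \<Longrightarrow> reach (Star P) 1 Q s"
  by (rule reach_run[OF run.Star_stop])

lemma reach_Star_step:
  assumes "reach P t (reach (Star P) u Q) s"
  shows "reach (Star P) (Suc (t + u)) Q s"
proof -
  obtain v s' where *: "v \<le> t" "run P v s s'" "reach (Star P) u Q s'"
    by (rule reachE[OF assms])
  obtain w s'' where "w \<le> u" "run (Star P) w s' s''" "Q s''"
    by (rule reachE[OF *(3)])
  then show ?thesis using * by (intro reachI[OF run.Star_step]) auto
qed

text \<open>The guard only peeks and the \<open>Case\<close> then pops, so the \<open>None\<close>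
  branch is never entered.\<close>

definition each :: "'r \<Rightarrow> 'a set \<Rightarrow> ('a \<Rightarrow> ('r, 'a) prog) \<Rightarrow> ('r, 'a) prog" where
  "each r S f = While r (Some ` S) (Case r (\<lambda>x. case x of None \<Rightarrow> Skip | Some a \<Rightarrow> f a))"

lemma deterministic_each [simp]: "deterministic (each r S f) \<longleftrightarrow> (\<forall>a. deterministic (f a))"
  by (simp add: each_def split_option_all)

lemma reach_each_stop: "peek (s r) \<notin> Some ` S \<Longrightarrow> Q s \<Longrightarrow> reach (each r S f) 1 Q s"
  unfolding each_def by (rule reach_run[OF run.While_stop])

lemma reach_While_step:
  assumes "peek (s r) \<in> S" "reach P t (reach (While r S P) u Q) s"
  shows "reach (While r S P) (Suc (t + u)) Q s"
proof -
  obtain v s' where *: "v \<le> t" "run P v s s'" "reach (While r S P) u Q s'"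
    by (rule reachE[OF assms(2)])
  obtain w s'' where "w \<le> u" "run (While r S P) w s' s''" "Q s''"
    by (rule reachE[OF *(3)])
  then show ?thesis using * by (intro reachI[OF run.While_step]) (auto intro: assms(1))
qed

lemma reach_each_step:
  assumes "s r = a # xs" "a \<in> S" "reach (f a) t (reach (each r S f) u Q) (s(r := xs))"
  shows "reach (each r S f) (Suc (Suc (t + u))) Q s"
proof -
  have "reach (each r S f) (Suc (Suc t + u)) Q s"
    unfolding each_def
    by (rule reach_While_step, simp add: assms, rule reach_Case_Some[of s r a xs])
      (use assms(1,3) in \<open>simp_all add: each_def\<close>)
  then show ?thesis by simp
qed

definition move :: "'r \<Rightarrow> 'a set \<Rightarrow> ('a \<Rightarrow> 'a) \<Rightarrow> 'r \<Rightarrow> ('r, 'a) prog" where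
  "move r S g q = each r S (\<lambda>a. Push q (g a))"

definition clear :: "'r \<Rightarrow> ('r, 'a) prog" where
  "clear r = each r UNIV (\<lambda>_. Skip)"

lemma deterministic_move [simp]: "deterministic (move r S g q)" "deterministic (clear r)"
  by (simp_all add: move_def clear_def)

text \<open>Each symbol costs one step for the test, one for the pop and two for the push; the final
  one leaves the loop. Stacks reverse what is moved, hence \<open>rev\<close>.\<close>

lemma reach_move:
  assumes "s r = xs @ ys" "set xs \<subseteq> S" "peek ys \<notin> Some ` S" "r \<noteq> q"
    "Q (s(r := ys, q := rev (map g xs) @ s q))"
  shows "reach (move r S g q) (4 * length xs + 1) Q s"
  using assms
proof (induction xs arbitrary: s)
  case Nil
  then have "s(r := ys, q := s q) = s" by auto
  then show ?case using Nil
    unfolding move_def by (intro reach_mono[OF reach_each_stop]) (auto simp del: fun_upd_apply)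
next
  case (Cons a xs)
  let ?s = "s(r := xs @ ys, q := g a # s q)"
  have "?s(r := ys, q := rev (map g xs) @ ?s q) = s(r := ys, q := rev (map g (a # xs)) @ s q)"
    using Cons.prems(4) by (auto simp: fun_eq_iff)
  then have "Q (?s(r := ys, q := rev (map g xs) @ ?s q))"
    using Cons.prems(5) by (simp only:)
  then have "reach (move r S g q) (4 * length xs + 1) Q ?s"
    by (intro Cons.IH) (use Cons.prems in \<open>simp_all del: fun_upd_apply, auto\<close>)
  then have "reach (move r S g q) (Suc (Suc (2 + (4 * length xs + 1)))) Q s"
    unfolding move_def using Cons.prems by (intro reach_each_step[of s r a "xs @ ys"] reach_Push) auto
  then show ?case by (rule reach_mono) simp
qed

lemma reach_move_all:
  assumes "r \<noteq> q" "Q (s(r := [], q := rev (map g (s r)) @ s q))"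
  shows "reach (move r UNIV g q) (4 * length (s r) + 1) Q s"
  using assms by (intro reach_move[of s r "s r" "[]"]) auto

lemma reach_clear:
  assumes "Q (s(r := []))"
  shows "reach (clear r) (3 * length (s r) + 1) Q s"
  using assms
proof (induction "s r" arbitrary: s)
  case Nil
  then have "s(r := []) = s" by auto
  then show ?case using Nil
    unfolding clear_def by (intro reach_mono[OF reach_each_stop]) (auto simp del: fun_upd_apply)
next
  case (Cons a xs)
  have "reach (clear r) (3 * length xs + 1) Q (s(r := xs))"
    using Cons.hyps(1)[of "s(r := xs)"] Cons.prems by simp
  then have "reach (clear r) (Suc (Suc (1 + (3 * length xs + 1)))) Q s"
    unfolding clear_def using Cons.hyps(2) by (intro reach_each_step[of s r a xs] reach_Skip) auto
  then show ?case unfolding Cons.hyps(2)[symmetric] by (rule reach_mono) simp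
qed

section \<open>Evaluating a formula in a guessed model\<close>

text \<open>Registers: \<open>Iw\<close> input, \<open>Rw\<close> reversed input, \<open>Vs\<close> stack of truth vectors, \<open>Ln\<close> the number of
  worlds in unary, \<open>Tv\<close> and \<open>Tc\<close> the guessed tables for variables and conditionals, \<open>Ka\<close> and \<open>Kb\<close>
  the operands (\<open>Ka\<close> is also the key of a table search), \<open>Pr\<close> the result of a search, \<open>Fl\<close>
  nonempty if the input is malformed; the others are scratch. The tokens double as work symbols:
  in a table, \<open>TVar\<close> ends a key and \<open>TCond\<close> an entry; on \<open>Vs\<close>, \<open>TVar\<close> lies below each vector; \<open>TBot\<close>
  is a unary digit; a partial world index is \<open>TNeg\<close>, or a unary number ended by \<open>TConj\<close>.\<close>

datatype reg = Iw | Rw | Ka | Kb | Kc | Kd | Pl | Pr | Tv | Tc | Ts | Vs | Ln | Lc | Mm | Fl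

abbreviation bits :: "token set" where "bits \<equiv> range TBit"

lemma map_TBit_eq [simp]: "map TBit xs = map TBit ys \<longleftrightarrow> xs = ys"
  by (simp add: inj_map_eq_map inj_def)

section \<open>Searching a table\<close>

text \<open>Compares the key of the top entry with \<open>Ka\<close>; on a match the payload
  replaces the one kept in \<open>Pl\<close>. The entry is saved on \<open>Ts\<close> and the
  consumed part of \<open>Ka\<close> on \<open>Kc\<close>, so both can be restored. Marks on
  \<open>Mm\<close> record disagreement, also when \<open>Ka\<close> is longer than the key.\<close>

definition entry :: "reg \<Rightarrow> (reg, token) prog" where
  "entry T =
     each T bits (\<lambda>b. Push Ts b ;; Case Ka (\<lambda>x. case x of None \<Rightarrow> Push Mm TBot
       | Some a \<Rightarrow> Push Kc a ;; (if a = b then Skip else Push Mm TBot))) ;;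
     Case T (\<lambda>_. Push Ts TVar) ;;
     Case Ka (\<lambda>x. case x of None \<Rightarrow> Skip | Some a \<Rightarrow> Push Ka a ;; Push Mm TBot) ;;
     move Kc UNIV id Ka ;;
     Case Mm (\<lambda>x. case x of
         None \<Rightarrow> clear Pl ;; each T (- {TCond}) (\<lambda>a. Push Ts a ;; Push Pl a)
       | Some _ \<Rightarrow> clear Mm ;; move T (- {TCond}) id Ts) ;;
     Case T (\<lambda>_. Push Ts TCond)"

definition search :: "reg \<Rightarrow> (reg, token) prog" where
  "search T = While T (range Some) (entry T) ;; move Ts UNIV id T ;; move Pl UNIV id Pr"

lemma deterministic_search [simp]: "deterministic (search T)"
proof -
  have "deterministic (entry T)"
    unfolding entry_def by (simp add: split_option_all)
  then show ?thesis by (simp add: search_def)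
qed

text \<open>Of the marks \<open>ms\<close> only emptiness and length matter: one decides the match,
  the other bounds the time to clear \<open>Mm\<close>. A surplus in \<open>Ka\<close> is not
  noticed here but by the test that follows in \<open>entry\<close>.\<close>

lemma reach_compare:
  assumes "s T = map TBit k @ TVar # rest" "T \<notin> {Ts, Ka, Kc, Mm}"
    "\<And>ms. (ms = [] \<longleftrightarrow> length k \<le> length (s Ka) \<and> take (length k) (s Ka) = map TBit k) \<Longrightarrow>
       length ms \<le> length k \<Longrightarrow>
       Q (s(T := TVar # rest, Ts := rev (map TBit k) @ s Ts, Ka := drop (length k) (s Ka),
            Kc := rev (take (length k) (s Ka)) @ s Kc, Mm := ms @ s Mm))"
  shows "reach (each T bits (\<lambda>b. Push Ts b ;; Case Ka (\<lambda>x. case x of None \<Rightarrow> Push Mm TBot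
       | Some a \<Rightarrow> Push Kc a ;; (if a = b then Skip else Push Mm TBot)))) (11 * length k + 1) Q s"
  using assms
proof (induction k arbitrary: s Q)
  case Nil
  have "Q s" using Nil.prems(3)[of "[]"] Nil.prems(1) by (simp add: fun_upd_idem)
  then show ?case using Nil by (intro reach_mono[OF reach_each_stop]) auto
next
  case (Cons b k)
  let ?P = "each T bits (\<lambda>b. Push Ts b ;; Case Ka (\<lambda>x. case x of None \<Rightarrow> Push Mm TBot
       | Some a \<Rightarrow> Push Kc a ;; (if a = b then Skip else Push Mm TBot)))"
  have T: "T \<noteq> Ts" "T \<noteq> Ka" "T \<noteq> Kc" "T \<noteq> Mm" "Ts \<noteq> T" "Ka \<noteq> T" "Kc \<noteq> T" "Mm \<noteq> T"
    using Cons.prems(2) by auto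
  show ?case
  proof (cases "s Ka")
    case Nil
    let ?s = "s(T := map TBit k @ TVar # rest, Ts := TBit b # s Ts, Ka := [], Mm := TBot # s Mm)"
    have "reach ?P (11 * length k + 1) Q ?s"
    proof (rule Cons.IH)
      fix ms :: "token list"
      assume ms: "length ms \<le> length k"
      have "Q (s(T := TVar # rest, Ts := rev (map TBit (b # k)) @ s Ts, Ka := drop (length (b # k)) (s Ka),
            Kc := rev (take (length (b # k)) (s Ka)) @ s Kc, Mm := (ms @ [TBot]) @ s Mm))"
        by (rule Cons.prems(3)) (use Nil ms in auto)
      then show "Q (?s(T := TVar # rest, Ts := rev (map TBit k) @ ?s Ts, Ka := drop (length k) (?s Ka),
            Kc := rev (take (length k) (?s Ka)) @ ?s Kc, Mm := ms @ ?s Mm))"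
        by (rule back_subst[of Q]) (use T Nil in \<open>auto simp: fun_eq_iff\<close>)
    qed (use T in auto)
    note IH = this
    show ?thesis
      apply (rule reach_mono)
       apply (rule reach_each_step[of s T "TBit b" "map TBit k @ TVar # rest"])
         apply (simp add: Cons.prems)
        apply simp
       apply (rule reach_Seq, rule reach_Push, rule reach_Case_None)
        apply (simp add: Nil T)
       apply (simp only: option.case)
       apply (rule reach_Push)
       apply (rule reach_state[OF IH])
       apply (use T Nil in \<open>simp add: fun_eq_iff\<close>)
      apply simp
      done
  next
    case Cons2: (Cons a as)
    let ?ms = "if a = TBit b then [] else [TBot]"
    let ?s = "s(T := map TBit k @ TVar # rest, Ts := TBit b # s Ts, Ka := as, Kc := a # s Kc, Mm := ?ms @ s Mm)"
    have IH: "reach ?P (11 * length k + 1) Q ?s"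
    proof (rule Cons.IH)
      fix ms :: "token list"
      assume ms: "(ms = []) = (length k \<le> length (?s Ka) \<and> take (length k) (?s Ka) = map TBit k)" "length ms \<le> length k"
      have "Q (s(T := TVar # rest, Ts := rev (map TBit (b # k)) @ s Ts, Ka := drop (length (b # k)) (s Ka),
            Kc := rev (take (length (b # k)) (s Ka)) @ s Kc, Mm := (ms @ ?ms) @ s Mm))"
        by (rule Cons.prems(3)) (use Cons2 ms in auto)
      then show "Q (?s(T := TVar # rest, Ts := rev (map TBit k) @ ?s Ts, Ka := drop (length k) (?s Ka),
            Kc := rev (take (length k) (?s Ka)) @ ?s Kc, Mm := ms @ ?s Mm))"
        by (rule back_subst[of Q]) (use T Cons2 in \<open>auto simp: fun_eq_iff\<close>)
    qed (use T in auto)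
    have body: "reach (Push Kc a ;; (if a = TBit b then Skip else Push Mm TBot)) 5
        (reach ?P (11 * length k + 1) Q) (s(T := map TBit k @ TVar # rest, Ts := TBit b # s Ts, Ka := as))"
    proof (cases "a = TBit b")
      case True
      show ?thesis
        unfolding if_P[OF True]
        apply (rule reach_mono)
         apply (rule reach_Seq, rule reach_Push, rule reach_Skip)
         apply (rule reach_state[OF IH])
         apply (use T True in \<open>simp add: fun_eq_iff\<close>)
        apply simp
        done
    next
      case False
      show ?thesis
        unfolding if_not_P[OF False]
        apply (rule reach_mono)
         apply (rule reach_Seq, rule reach_Push, rule reach_Push)
         apply (rule reach_state[OF IH])
         apply (use T False in \<open>simp add: fun_eq_iff\<close>)
        apply simp
        done
    qed
    show ?thesis
      apply (rule reach_mono)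
       apply (rule reach_each_step[of s T "TBit b" "map TBit k @ TVar # rest"])
         apply (simp add: Cons.prems)
        apply simp
       apply (rule reach_Seq, rule reach_Push, rule reach_Case_Some[where a = a and xs = as])
        apply (simp add: T Cons2)
       apply (simp only: option.case)
       apply (rule reach_state[OF body])
       apply (simp add: T)
      apply simp
      done
  qed
qed

lemma reach_copy:
  assumes "s r = xs @ ys" "set xs \<subseteq> S" "peek ys \<notin> Some ` S" "r \<noteq> q" "r \<noteq> q'" "q \<noteq> q'"
    "Q (s(r := ys, q := rev xs @ s q, q' := rev xs @ s q'))"
  shows "reach (each r S (\<lambda>a. Push q a ;; Push q' a)) (7 * length xs + 1) Q s"
  using assms
proof (induction xs arbitrary: s)
  case Nil
  then have "s(r := ys, q := s q, q' := s q') = s" by auto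
  then show ?case using Nil
    by (intro reach_mono[OF reach_each_stop]) (auto simp del: fun_upd_apply)
next
  case (Cons a xs)
  let ?s = "s(r := xs @ ys, q := a # s q, q' := a # s q')"
  have "?s(r := ys, q := rev xs @ ?s q, q' := rev xs @ ?s q') =
      s(r := ys, q := rev (a # xs) @ s q, q' := rev (a # xs) @ s q')"
    using Cons.prems(4-6) by (auto simp: fun_eq_iff)
  then have "Q (?s(r := ys, q := rev xs @ ?s q, q' := rev xs @ ?s q'))"
    using Cons.prems(7) by (simp only:)
  then have IH: "reach (each r S (\<lambda>a. Push q a ;; Push q' a)) (7 * length xs + 1) Q ?s"
    by (intro Cons.IH) (use Cons.prems in \<open>simp_all del: fun_upd_apply, auto\<close>)
  show ?case
    apply (rule reach_mono)
     apply (rule reach_each_step[of s r a "xs @ ys"])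
       apply (use Cons.prems in simp)
      apply (use Cons.prems in simp)
     apply (rule reach_Seq, rule reach_Push, rule reach_Push)
     apply (rule reach_state[OF IH])
     apply (use Cons.prems(4-6) in \<open>simp add: fun_eq_iff\<close>)
    apply simp
    done
qed

text \<open>The time to clear \<open>Pl\<close> is charged to matching entries only; the amortised
  bound for a whole table depends on this.\<close>

lemma reach_entry:
  assumes T: "T = Tv \<or> T = Tc" and sT: "s T = map TBit k' @ TVar # p @ TCond # rest" and p: "TCond \<notin> set p"
    and s: "s Ka = map TBit k" "s Kc = []" "s Mm = []"
    and Q: "Q (s(T := rest, Ts := TCond # rev p @ TVar # rev (map TBit k') @ s Ts,
      Pl := if k' = k then rev p else s Pl))"
  shows "reach (entry T)
    (18 * length k' + 7 * length p + (if k' = k then 3 * length (s Pl) else 0) + 40) Q s"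
proof -
  have TT: "T \<noteq> Ts" "T \<noteq> Ka" "T \<noteq> Kc" "T \<noteq> Mm" "T \<noteq> Pl" "Ts \<noteq> T" "Ka \<noteq> T" "Kc \<noteq> T" "Mm \<noteq> T" "Pl \<noteq> T"
    using T by auto
  let ?U = "7 * length k' + 7 * length p + (if k' = k then 3 * length (s Pl) else 0) + 35"
  show ?thesis
    unfolding entry_def
  proof (rule reach_mono[OF reach_Seq[OF reach_compare[where k = k' and rest = "p @ TCond # rest"], where u = ?U]])
    fix ms :: "token list"
    assume ms: "(ms = []) = (length k' \<le> length (s Ka) \<and> take (length k') (s Ka) = map TBit k')"
      and len: "length ms \<le> length k'"
    let ?s = "s(T := TVar # p @ TCond # rest, Ts := rev (map TBit k') @ s Ts, Ka := drop (length k') (s Ka),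
      Kc := rev (take (length k') (s Ka)) @ s Kc, Mm := ms @ s Mm)"
    show "reach (Case T (\<lambda>_. Push Ts TVar) ;;
     Case Ka (\<lambda>x. case x of None \<Rightarrow> Skip | Some a \<Rightarrow> Push Ka a ;; Push Mm TBot) ;;
     move Kc UNIV id Ka ;;
     Case Mm (\<lambda>x. case x of
         None \<Rightarrow> clear Pl ;; each T (- {TCond}) (\<lambda>a. Push Ts a ;; Push Pl a)
       | Some _ \<Rightarrow> clear Mm ;; move T (- {TCond}) id Ts) ;;
     Case T (\<lambda>_. Push Ts TCond)) ?U Q ?s"
    proof (cases "k' = k")
      case True
      then have ms: "ms = []" using ms s(1) by simp
      show ?thesis
        apply (rule reach_mono)
         apply (rule reach_Seq, rule reach_Case_Some[where a = TVar and xs = "p @ TCond # rest"])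
          apply (simp add: TT)
         apply (rule reach_Push)
         apply (rule reach_Seq, rule reach_Case_None)
          apply (simp add: TT s True)
         apply (simp only: option.case)
         apply (rule reach_Skip)
         apply (rule reach_Seq, rule reach_move_all)
          apply simp
         apply (rule reach_Seq, rule reach_Case_None)
          apply (simp add: TT s ms)
         apply (simp only: option.case)
         apply (rule reach_Seq, rule reach_clear)
         apply (rule reach_copy[where xs = p and ys = "TCond # rest"])
               apply (simp add: TT)
              apply (use p in auto)[1]
             apply (auto simp: TT)[1]
            apply (simp add: TT)
           apply (simp add: TT)
          apply simp
         apply (rule reach_Case_Some[where a = TCond and xs = rest])
          apply (simp add: TT)
         apply (rule reach_Push)
         apply (rule back_subst[of Q, OF Q])
         apply (simp add: fun_eq_iff TT s True ms)
        apply (simp add: TT s True ms)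
        done
    next
      case False
      \<comment> \<open>A mismatch that leaves no mark means that \<open>k'\<close> is a proper
        prefix of \<open>k\<close>. Then \<open>Ka\<close> has a remainder, which is marked
        next.\<close>
      have mm: "(drop (length k') (s Ka) = [] \<longrightarrow> ms \<noteq> [])"
        using ms s(1) False by (auto simp: take_map)
      define ms' where "ms' = (if drop (length k') (s Ka) = [] then ms else TBot # ms)"
      have ms': "ms' \<noteq> []" "length ms' \<le> Suc (length k')" using mm len by (auto simp: ms'_def)
      have mid: "reach (Case Ka (\<lambda>x. case x of None \<Rightarrow> Skip | Some a \<Rightarrow> Push Ka a ;; Push Mm TBot)) 6 R s1"
        if "R (s1(Mm := ms'))" "s1 Ka = drop (length k') (s Ka)" "s1 Mm = ms" for R s1
      proof (cases "s1 Ka")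
        case Nil
        then have "s1(Mm := ms') = s1" using that by (simp add: ms'_def fun_upd_idem)
        then show ?thesis using that Nil
          by (intro reach_mono[OF reach_Case_None]) (auto intro!: reach_Skip simp del: fun_upd_apply)
      next
        case (Cons a as)
        then have *: "ms' = TBot # ms" using that by (simp add: ms'_def)
        show ?thesis
          apply (rule reach_mono)
           apply (rule reach_Case_Some[of s1 Ka a as])
            apply (rule Cons)
           apply (simp only: option.case)
           apply (rule reach_Seq, rule reach_Push, rule reach_Push)
           apply (rule back_subst[of R, OF that(1)])
           apply (simp add: fun_eq_iff * that(3) Cons)
          apply simp
          done
      qed
      show ?thesis
        apply (rule reach_mono)
         apply (rule reach_Seq, rule reach_Case_Some[where a = TVar and xs = "p @ TCond # rest"])
          apply (simp add: TT)
         apply (rule reach_Push)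
         apply (rule reach_Seq, rule mid)
           prefer 2 apply (simp add: TT)
          prefer 2 apply (simp add: TT s)
         apply (rule reach_Seq, rule reach_mono[where t = "4 * length k' + 1"], rule reach_mono, rule reach_move_all)
            apply simp
           prefer 2 apply (simp add: TT s)
          prefer 2 apply (rule order_refl)
         apply (rule reach_Seq, rule reach_Case_Some[where a = "hd ms'" and xs = "tl ms'"])
          apply (simp add: TT ms')
         apply (simp only: option.case)
         apply (rule reach_Seq, rule reach_mono[where t = "3 * length k' + 1"], rule reach_mono, rule reach_clear)
           prefer 2 apply (use ms'(2) in \<open>simp add: TT s\<close>)
          prefer 2 apply (rule order_refl)
         apply (rule reach_move[where xs = p and ys = "TCond # rest"])
              apply (simp add: TT)
             apply (use p in auto)[1]
            apply (auto simp: TT)[1]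
           apply (simp add: TT)
         apply (rule reach_Case_Some[where a = TCond and xs = rest])
          apply (simp add: TT)
         apply (rule reach_Push)
         apply (rule back_subst[of Q, OF Q])
         apply (simp add: fun_eq_iff TT s False)
        apply (simp add: TT s False)
        done
    qed
  qed (use TT sT in auto)
qed

definition table_word :: "('p list \<Rightarrow> token list) \<Rightarrow> (bool list \<times> 'p list) list \<Rightarrow> token list" where
  "table_word pe es = concat (map (\<lambda>(k, p). map TBit k @ TVar # pe p @ [TCond]) es)"

lemma table_word_simps [simp]:
  "table_word pe [] = []"
  "table_word pe ((k, p) # es) = map TBit k @ TVar # pe p @ TCond # table_word pe es"
  by (simp_all add: table_word_def)

lemma length_lookup: "length (pe (lookup q es k)) \<le> length (pe q) + length (table_word pe es)"
proof (induction es arbitrary: q)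
  case (Cons e es)
  obtain k' p where e: "e = (k', p)" by (cases e)
  show ?case using Cons[of "if k' = k then p else q"] by (auto simp: e)
qed simp

text \<open>Amortisation: \<open>3 * length (pe q)\<close> is a potential for the payload lying on
  \<open>Pl\<close>, which is cleared at most once, by the next match.\<close>

lemma reach_entries:
  assumes T: "T = Tv \<or> T = Tc" and pe: "\<And>p. TCond \<notin> set (pe p)"
    and "s T = table_word pe es" "s Ka = map TBit k" "s Kc = []" "s Mm = []" "s Pl = rev (pe q)"
    and "Q (s(T := [], Ts := rev (table_word pe es) @ s Ts, Pl := rev (pe (lookup q es k))))"
  shows "reach (While T (range Some) (entry T)) (25 * length (table_word pe es) + 3 * length (pe q) + 1) Q s"
  using assms(3-)
proof (induction es arbitrary: s q)
  case Nil
  then have "s(T := [], Ts := s Ts, Pl := rev (pe q)) = s" by (auto simp: fun_eq_iff)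
  then have "Q s" using Nil.prems(6) by (simp del: fun_upd_apply)
  then show ?case using Nil.prems(1)
    by (intro reach_mono[OF reach_run[OF run.While_stop]]) auto
next
  case (Cons e es)
  obtain k' p where e: "e = (k', p)" by (cases e)
  have TT: "T \<noteq> Ts" "T \<noteq> Ka" "T \<noteq> Kc" "T \<noteq> Mm" "T \<noteq> Pl" "Ts \<noteq> T" "Ka \<noteq> T" "Kc \<noteq> T" "Mm \<noteq> T" "Pl \<noteq> T"
    using T by auto
  let ?q = "if k' = k then p else q"
  let ?s = "s(T := table_word pe es, Ts := TCond # rev (pe p) @ TVar # rev (map TBit k') @ s Ts,
      Pl := if k' = k then rev (pe p) else s Pl)"
  have "?s(T := [], Ts := rev (table_word pe es) @ ?s Ts, Pl := rev (pe (lookup ?q es k))) =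
      s(T := [], Ts := rev (table_word pe (e # es)) @ s Ts, Pl := rev (pe (lookup q (e # es) k)))"
    by (auto simp: fun_eq_iff e TT)
  then have "Q (?s(T := [], Ts := rev (table_word pe es) @ ?s Ts, Pl := rev (pe (lookup ?q es k))))"
    using Cons.prems(6) by (simp only:)
  then have IH: "reach (While T (range Some) (entry T)) (25 * length (table_word pe es) + 3 * length (pe ?q) + 1) Q ?s"
    by (rule Cons.IH[rotated -1]) (use Cons.prems TT in simp_all)
  show ?case
    apply (rule reach_mono)
     apply (rule reach_While_step)
      apply (simp add: Cons.prems(1) e peek_def split: list.split)
     apply (rule reach_entry[OF T _ pe])
         apply (simp add: Cons.prems(1) e)
        apply (rule Cons.prems)+
     apply (rule IH)
    apply (use Cons.prems in \<open>simp add: e\<close>)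
    done
qed

lemma reach_search:
  assumes T: "T = Tv \<or> T = Tc" and pe: "\<And>p. TCond \<notin> set (pe p)" "pe [] = []"
    and s: "s T = table_word pe es" "s Ka = map TBit k"
      "s Kc = []" "s Mm = []" "s Pl = []" "s Ts = []" "s Pr = []"
    and Q: "Q (s(Pr := pe (lookup [] es k)))"
  shows "reach (search T) (33 * length (table_word pe es) + 5) Q s"
proof -
  have TT: "T \<noteq> Ts" "T \<noteq> Pr" "T \<noteq> Pl" "Ts \<noteq> T" "Pr \<noteq> T" "Pl \<noteq> T"
    using T by auto
  have len: "length (pe (lookup [] es k)) \<le> length (table_word pe es)"
    using length_lookup[of pe "[]" es k] pe(2) by simp
  show ?thesis
    unfolding search_def
    apply (rule reach_mono)
     apply (rule reach_Seq, rule reach_entries[OF T pe(1) s(1-4), where q = "[]"])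
      apply (simp add: s pe)
     apply (rule reach_Seq, rule reach_move_all)
      apply (simp add: TT)
     apply (rule reach_move_all)
      apply simp
     apply (rule back_subst[of Q, OF Q])
     apply (use s TT in \<open>simp add: fun_eq_iff\<close>)
    apply (use s TT len in \<open>simp add: pe\<close>)
    done
qed

section \<open>Evaluating a conditional at every world\<close>

definition restore :: "reg \<Rightarrow> token option \<Rightarrow> (reg, token) prog" where
  "restore r x = (case x of None \<Rightarrow> Skip | Some a \<Rightarrow> Push r a)"

text \<open>\<open>Case\<close> pops, so a mere look at the top has to push it back.\<close>

definition inspect :: "reg \<Rightarrow> (token option \<Rightarrow> (reg, token) prog) \<Rightarrow> (reg, token) prog" where
  "inspect r f = Case r (\<lambda>x. restore r x ;; f x)"

definition transfer :: "reg \<Rightarrow> reg \<Rightarrow> (reg, token) prog" where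
  "transfer r q = Case r (restore q)"

lemma deterministic_inspect [simp]: "deterministic (inspect r f) \<longleftrightarrow> (\<forall>x. deterministic (f x))"
  and deterministic_transfer [simp]: "deterministic (transfer r q)"
  by (simp_all add: inspect_def transfer_def restore_def split_option_all)

lemma reach_inspect:
  assumes "reach (f (peek (s r))) t Q s"
  shows "reach (inspect r f) (t + 4) Q s"
proof (cases "s r")
  case Nil
  show ?thesis
    unfolding inspect_def
    apply (rule reach_mono)
     apply (rule reach_Case_None[of s r, OF Nil])
     apply (simp only: restore_def option.case)
     apply (rule reach_Seq, rule reach_Skip)
     apply (use assms Nil in simp)
    apply simp
    done
next
  case (Cons a xs)
  have "s(r := xs, r := a # (s(r := xs)) r) = s" using Cons by auto
  then show ?thesis
    unfolding inspect_def
    apply -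
    apply (rule reach_mono)
     apply (rule reach_Case_Some[of s r, OF Cons])
     apply (simp only: restore_def option.case)
     apply (rule reach_Seq, rule reach_Push)
     apply (rule reach_state[of _ t])
      apply (use assms Cons in simp)
     apply simp
    apply simp
    done
qed

lemma reach_transfer:
  assumes "r \<noteq> q" "Q (s(r := tl (s r), q := take 1 (s r) @ s q))"
  shows "reach (transfer r q) 3 Q s"
proof (cases "s r")
  case Nil
  then have "s(r := tl (s r), q := take 1 (s r) @ s q) = s" by auto
  then have "Q s" using assms(2) by simp
  then show ?thesis
    unfolding transfer_def restore_def
    apply -
    apply (rule reach_mono)
     apply (rule reach_Case_None[of s r, OF Nil])
     apply (simp only: option.case)
     apply (rule reach_Skip)
     apply simp_all
    done
next
  case (Cons a xs)
  show ?thesis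
    unfolding transfer_def restore_def
    apply (rule reach_mono)
     apply (rule reach_Case_Some[of s r, OF Cons])
     apply (simp only: option.case)
     apply (rule reach_Push)
     apply (use assms Cons in simp)
    apply simp
    done
qed

text \<open>Random access by counting: the \<open>j\<close> unary digits on \<open>Pr\<close> shift
  \<open>j\<close> symbols off both vectors, whose tops are then the values at world
  \<open>j\<close>. Running off the vector (\<open>a = None\<close>) is the range check. The bit is
  false only if a selected world refutes the conditional, so malformed blocks yield true.\<close>

definition block :: "bool \<Rightarrow> (reg, token) prog" where
  "block idf =
     each Pr {TBot} (\<lambda>_. transfer Ka Kc ;; transfer Kb Kd) ;;
     Case Pr (\<lambda>x. inspect Ka (\<lambda>a. inspect Kb (\<lambda>b.
       Push Vs (TBit (\<not> (x = Some TConj \<and> a \<noteq> None \<and> b = Some (TBit False) \<and>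
         (idf \<longrightarrow> a = Some (TBit True)))))))) ;;
     move Kc UNIV id Ka ;; move Kd UNIV id Kb"

lemma reach_transfers:
  assumes "s Pr = replicate j TBot @ rest" "peek rest \<noteq> Some TBot"
    "Q (s(Pr := rest, Ka := drop j (s Ka), Kc := rev (take j (s Ka)) @ s Kc,
       Kb := drop j (s Kb), Kd := rev (take j (s Kb)) @ s Kd))"
  shows "reach (each Pr {TBot} (\<lambda>_. transfer Ka Kc ;; transfer Kb Kd)) (9 * j + 1) Q s"
  using assms
proof (induction j arbitrary: s)
  case 0
  then have "s(Pr := rest, Ka := drop 0 (s Ka), Kc := rev (take 0 (s Ka)) @ s Kc,
       Kb := drop 0 (s Kb), Kd := rev (take 0 (s Kb)) @ s Kd) = s" by auto
  then have "Q s" using 0 by (simp only:)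
  then show ?case using 0 by (intro reach_mono[OF reach_each_stop]) auto
next
  case (Suc j)
  let ?s = "s(Pr := replicate j TBot @ rest, Ka := tl (s Ka), Kc := take 1 (s Ka) @ s Kc,
       Kb := tl (s Kb), Kd := take 1 (s Kb) @ s Kd)"
  have *: "rev (take (Suc j) xs) = rev (take j (tl xs)) @ take 1 xs" for xs :: "token list"
    by (cases xs) auto
  have "?s(Pr := rest, Ka := drop j (?s Ka), Kc := rev (take j (?s Ka)) @ ?s Kc,
       Kb := drop j (?s Kb), Kd := rev (take j (?s Kb)) @ ?s Kd) =
     s(Pr := rest, Ka := drop (Suc j) (s Ka), Kc := rev (take (Suc j) (s Ka)) @ s Kc,
       Kb := drop (Suc j) (s Kb), Kd := rev (take (Suc j) (s Kb)) @ s Kd)"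
    unfolding * by (simp add: fun_eq_iff drop_Suc)
  then have "Q (?s(Pr := rest, Ka := drop j (?s Ka), Kc := rev (take j (?s Ka)) @ ?s Kc,
       Kb := drop j (?s Kb), Kd := rev (take j (?s Kb)) @ ?s Kd))"
    using Suc.prems(3) by (simp only:)
  then have IH: "reach (each Pr {TBot} (\<lambda>_. transfer Ka Kc ;; transfer Kb Kd)) (9 * j + 1) Q ?s"
    by (rule Suc.IH[rotated -1]) (use Suc.prems in simp_all)
  show ?case
    apply (rule reach_mono)
     apply (rule reach_each_step[of s Pr TBot "replicate j TBot @ rest"])
       apply (simp add: Suc.prems)
      apply simp
     apply (rule reach_Seq, rule reach_transfer)
      apply simp
     apply (rule reach_transfer)
      apply simp
     apply (rule reach_state[OF IH])
     apply (simp add: fun_eq_iff)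
    apply simp
    done
qed

lemma reach_block:
  assumes s: "s Pr = replicate j TBot @ rest" "peek rest \<noteq> Some TBot" "s Ka = map TBit x" "s Kb = map TBit y"
    "s Kc = []" "s Kd = []" "length x = length y"
    and Q: "Q (s(Pr := tl rest,
      Vs := TBit (\<not> (peek rest = Some TConj \<and> j < length x \<and> \<not> y ! j \<and> (idf \<longrightarrow> x ! j))) # s Vs))"
  shows "reach (block idf) (17 * j + 20) Q s"
proof -
  have peek: "peek (drop j (map TBit z)) = (if j < length z then Some (TBit (z ! j)) else None)" for z
    by (cases "j < length z") (simp_all add: drop_map flip: Cons_nth_drop_Suc)
  show ?thesis
    unfolding block_def
    apply (rule reach_mono)
     apply (rule reach_Seq, rule reach_transfers[of s j rest, OF s(1,2)])
     apply (rule reach_Seq, rule reach_Case, rule reach_inspect, rule reach_inspect, rule reach_Push)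
     apply (rule reach_Seq, rule reach_move_all)
      apply simp
     apply (rule reach_move_all)
      apply simp
     apply (rule back_subst[of Q, OF Q])
     apply (simp add: fun_eq_iff s peek)
     apply (auto simp: s simp flip: drop_map take_map)[1]
    apply (simp add: s)
    done
qed

fun blk :: "nat option \<Rightarrow> token list" where
  "blk None = [TNeg]"
| "blk (Some j) = replicate j TBot @ [TConj]"

definition blks :: "nat option list \<Rightarrow> token list" where
  "blks p = concat (map blk p)"

lemma blks_simps [simp]: "blks [] = []" "blks (x # p) = blk x @ blks p"
  by (simp_all add: blks_def)

text \<open>The conditional clause read on truth vectors; an index beyond \<open>length x\<close>
  counts as no successor, as in \<open>table_sel\<close>.\<close>

definition outcome :: "bool \<Rightarrow> bool list \<Rightarrow> bool list \<Rightarrow> nat option \<Rightarrow> bool" where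
  "outcome idf x y sel \<longleftrightarrow> (\<forall>j. sel = Some j \<and> j < length x \<and> (idf \<longrightarrow> x ! j) \<longrightarrow> y ! j)"

definition nth_opt :: "'p option list \<Rightarrow> nat \<Rightarrow> 'p option" where
  "nth_opt p i = (if i < length p then p ! i else None)"

lemma nth_opt_simps [simp]:
  "nth_opt [] i = None" "nth_opt (x # p) 0 = x" "nth_opt (x # p) (Suc i) = nth_opt p i"
  by (simp_all add: nth_opt_def)

lemma reach_block_head:
  assumes s: "s Pr = blks p" "s Ka = map TBit x" "s Kb = map TBit y"
    "s Kc = []" "s Kd = []" "length x = length y"
    and Q: "Q (s(Pr := blks (tl p), Vs := TBit (outcome idf x y (nth_opt p 0)) # s Vs))"
  shows "reach (block idf) (17 * (length (blks p) - length (blks (tl p))) + 20) Q s"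
proof (cases p)
  case Nil
  have "reach (block idf) (17 * 0 + 20) Q s"
    by (rule reach_block[where rest = "[]", OF _ _ s(2-)])
      (use s Q Nil in \<open>simp_all add: outcome_def\<close>)
  then show ?thesis by (rule reach_mono) simp
next
  case (Cons a p')
  show ?thesis
  proof (cases a)
    case None
    have "reach (block idf) (17 * 0 + 20) Q s"
      by (rule reach_block[where rest = "TNeg # blks p'", OF _ _ s(2-)])
        (use s Q Cons None in \<open>simp_all add: outcome_def\<close>)
    then show ?thesis by (rule reach_mono) simp
  next
    case (Some j)
    have *: "outcome idf x y (Some j) \<longleftrightarrow> \<not> (j < length x \<and> \<not> y ! j \<and> (idf \<longrightarrow> x ! j))"
      by (auto simp: outcome_def)
    have "reach (block idf) (17 * j + 20) Q s"
      by (rule reach_block[where rest = "TConj # blks p'", OF _ _ s(2-)])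
        (use s Q Cons Some in \<open>simp_all add: *\<close>)
    then show ?thesis by (rule reach_mono) (simp add: Cons Some)
  qed
qed

text \<open>The time for a block is charged to the symbols it consumes, so the differences of
  lengths telescope over the worlds.\<close>

lemma reach_blocks:
  assumes "s Ln = replicate n TBot" "s Pr = blks p" "s Ka = map TBit x" "s Kb = map TBit y"
    "s Kc = []" "s Kd = []" "length x = length y"
    "Q (s(Ln := [], Lc := replicate n TBot @ s Lc, Pr := blks (drop n p),
        Vs := rev (map (\<lambda>i. TBit (outcome idf x y (nth_opt p i))) [0..<n]) @ s Vs))"
  shows "reach (each Ln UNIV (\<lambda>_. Push Lc TBot ;; block idf))
    (25 * n + 17 * (length (blks p) - length (blks (drop n p))) + 1) Q s"
  using assms
proof (induction n arbitrary: s p)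
  case 0
  then have "s(Ln := [], Lc := s Lc, Pr := blks p, Vs := s Vs) = s" by (auto simp: fun_eq_iff)
  then have "Q s" using 0(8) by (simp del: fun_upd_apply)
  then show ?case using 0 by (intro reach_mono[OF reach_each_stop]) auto
next
  case (Suc n)
  let ?s = "s(Ln := replicate n TBot, Lc := TBot # s Lc, Pr := blks (tl p),
    Vs := TBit (outcome idf x y (nth_opt p 0)) # s Vs)"
  have nth: "nth_opt (tl p) i = nth_opt p (Suc i)" for i
    by (cases p) (simp_all add: nth_opt_def)
  have "?s(Ln := [], Lc := replicate n TBot @ ?s Lc, Pr := blks (drop n (tl p)),
        Vs := rev (map (\<lambda>i. TBit (outcome idf x y (nth_opt (tl p) i))) [0..<n]) @ ?s Vs) =
      s(Ln := [], Lc := replicate (Suc n) TBot @ s Lc, Pr := blks (drop (Suc n) p),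
        Vs := rev (map (\<lambda>i. TBit (outcome idf x y (nth_opt p i))) [0..<Suc n]) @ s Vs)"
    unfolding map_upt_Suc nth by (simp add: fun_eq_iff drop_Suc replicate_app_Cons_same)
  then have "Q (?s(Ln := [], Lc := replicate n TBot @ ?s Lc, Pr := blks (drop n (tl p)),
        Vs := rev (map (\<lambda>i. TBit (outcome idf x y (nth_opt (tl p) i))) [0..<n]) @ ?s Vs))"
    using Suc.prems(8) by (simp only:)
  then have IH: "reach (each Ln UNIV (\<lambda>_. Push Lc TBot ;; block idf))
    (25 * n + 17 * (length (blks (tl p)) - length (blks (drop n (tl p)))) + 1) Q ?s"
    by (rule Suc.IH[rotated -1]) (use Suc.prems in simp_all)
  have len: "length (blks (tl q)) \<le> length (blks q)" for q
    by (cases q) simp_all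
  have len2: "length (blks (drop n q)) \<le> length (blks q)" for q
    by (induction n arbitrary: q) (auto simp: drop_Suc intro: le_trans[OF _ len])
  show ?case
    apply (rule reach_mono)
     apply (rule reach_each_step[of s Ln TBot "replicate n TBot"])
       apply (simp add: Suc.prems)
      apply simp
     apply (rule reach_Seq, rule reach_Push)
     apply (rule reach_block_head[where x = x and y = y and p = p])
           apply (simp_all add: Suc.prems)[6]
     apply (rule reach_state[OF IH])
     apply (simp add: fun_eq_iff)
    apply (use len[of p] len2[of "tl p"] in \<open>simp add: drop_Suc\<close>)
    done
qed

lemma reach_bits:
  assumes "s Ln = replicate n TBot" "s Pr = map TBit p"
    "Q (s(Ln := [], Lc := replicate n TBot @ s Lc, Pr := map TBit (drop n p),
        Vs := rev (map (\<lambda>i. TBit (i < length p \<and> p ! i)) [0..<n]) @ s Vs))"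
  shows "reach (each Ln UNIV (\<lambda>_. Push Lc TBot ;; Case Pr (\<lambda>x. Push Vs (TBit (x = Some (TBit True))))))
    (8 * n + 1) Q s"
  using assms
proof (induction n arbitrary: s p)
  case 0
  then have "s(Ln := [], Lc := s Lc, Pr := map TBit p, Vs := s Vs) = s" by (auto simp: fun_eq_iff)
  then have "Q s" using 0(3) by (simp del: fun_upd_apply)
  then show ?case using 0 by (intro reach_mono[OF reach_each_stop]) auto
next
  case (Suc n)
  let ?s = "s(Ln := replicate n TBot, Lc := TBot # s Lc, Pr := map TBit (tl p),
    Vs := TBit (0 < length p \<and> p ! 0) # s Vs)"
  have nth: "(i < length (tl p) \<and> tl p ! i) = (Suc i < length p \<and> p ! Suc i)" for i
    by (cases p) simp_all
  have "?s(Ln := [], Lc := replicate n TBot @ ?s Lc, Pr := map TBit (drop n (tl p)),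
        Vs := rev (map (\<lambda>i. TBit (i < length (tl p) \<and> tl p ! i)) [0..<n]) @ ?s Vs) =
      s(Ln := [], Lc := replicate (Suc n) TBot @ s Lc, Pr := map TBit (drop (Suc n) p),
        Vs := rev (map (\<lambda>i. TBit (i < length p \<and> p ! i)) [0..<Suc n]) @ s Vs)"
    unfolding map_upt_Suc nth by (simp add: fun_eq_iff drop_Suc replicate_app_Cons_same)
  then have "Q (?s(Ln := [], Lc := replicate n TBot @ ?s Lc, Pr := map TBit (drop n (tl p)),
        Vs := rev (map (\<lambda>i. TBit (i < length (tl p) \<and> tl p ! i)) [0..<n]) @ ?s Vs))"
    using Suc.prems(3) by (simp only:)
  then have IH: "reach (each Ln UNIV (\<lambda>_. Push Lc TBot ;; Case Pr (\<lambda>x. Push Vs (TBit (x = Some (TBit True))))))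
      (8 * n + 1) Q ?s"
    by (rule Suc.IH[rotated -1]) (use Suc.prems in simp_all)
  show ?case
    apply (rule reach_mono)
     apply (rule reach_each_step[of s Ln TBot "replicate n TBot"])
       apply (simp add: Suc.prems)
      apply simp
     apply (rule reach_Seq, rule reach_Push, rule reach_Case, rule reach_Push)
     apply (rule reach_state[OF IH])
     apply (cases p; simp add: fun_eq_iff Suc.prems)
    apply simp
    done
qed

lemma reach_zeros:
  assumes "s Ln = replicate n TBot"
    "Q (s(Ln := [], Lc := replicate n TBot @ s Lc, Vs := replicate n (TBit False) @ s Vs))"
  shows "reach (each Ln UNIV (\<lambda>_. Push Lc TBot ;; Push Vs (TBit False))) (7 * n + 1) Q s"
  using assms
proof (induction n arbitrary: s)
  case 0
  then have "s(Ln := [], Lc := s Lc, Vs := s Vs) = s" by (auto simp: fun_eq_iff)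
  then have "Q s" using 0(2) by (simp del: fun_upd_apply)
  then show ?case using 0 by (intro reach_mono[OF reach_each_stop]) auto
next
  case (Suc n)
  let ?s = "s(Ln := replicate n TBot, Lc := TBot # s Lc, Vs := TBit False # s Vs)"
  have "?s(Ln := [], Lc := replicate n TBot @ ?s Lc, Vs := replicate n (TBit False) @ ?s Vs) =
      s(Ln := [], Lc := replicate (Suc n) TBot @ s Lc, Vs := replicate (Suc n) (TBit False) @ s Vs)"
    by (simp add: fun_eq_iff replicate_app_Cons_same)
  then have "Q (?s(Ln := [], Lc := replicate n TBot @ ?s Lc, Vs := replicate n (TBit False) @ ?s Vs))"
    using Suc.prems(2) by (simp only:)
  then have IH: "reach (each Ln UNIV (\<lambda>_. Push Lc TBot ;; Push Vs (TBit False))) (7 * n + 1) Q ?s"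
    by (rule Suc.IH[rotated -1]) (use Suc.prems in simp_all)
  show ?case
    apply (rule reach_mono)
     apply (rule reach_each_step[of s Ln TBot "replicate n TBot"])
       apply (simp add: Suc.prems)
      apply simp
     apply (rule reach_Seq, rule reach_Push, rule reach_Push)
     apply (rule reach_state[OF IH])
     apply (simp add: fun_eq_iff)
    apply simp
    done
qed

lemma reach_conj:
  assumes "s Ka = map TBit x" "s Kb = map TBit y" "length x = length y"
    "Q (s(Ka := [], Kb := [], Vs := rev (map TBit (map2 (\<and>) x y)) @ s Vs))"
  shows "reach (each Ka UNIV (\<lambda>a. Case Kb (\<lambda>b. Push Vs (TBit (a = TBit True \<and> b = Some (TBit True))))))
    (5 * length x + 1) Q s"
  using assms
proof (induction x arbitrary: s y)
  case Nil
  then have "s(Ka := [], Kb := [], Vs := s Vs) = s" by (auto simp: fun_eq_iff)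
  then have "Q s" using Nil(4) Nil(3) by (simp del: fun_upd_apply)
  then show ?case using Nil by (intro reach_mono[OF reach_each_stop]) auto
next
  case (Cons a x)
  obtain b y' where y: "y = b # y'" using Cons.prems(3) by (cases y) auto
  let ?s = "s(Ka := map TBit x, Kb := map TBit y', Vs := TBit (a \<and> b) # s Vs)"
  have "?s(Ka := [], Kb := [], Vs := rev (map TBit (map2 (\<and>) x y')) @ ?s Vs) =
      s(Ka := [], Kb := [], Vs := rev (map TBit (map2 (\<and>) (a # x) y)) @ s Vs)"
    by (simp add: fun_eq_iff y)
  then have "Q (?s(Ka := [], Kb := [], Vs := rev (map TBit (map2 (\<and>) x y')) @ ?s Vs))"
    using Cons.prems(4) by (simp only:)
  then have IH: "reach (each Ka UNIV (\<lambda>a. Case Kb (\<lambda>b. Push Vs (TBit (a = TBit True \<and> b = Some (TBit True))))))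
    (5 * length x + 1) Q ?s"
    by (rule Cons.IH[rotated -1]) (use Cons.prems y in simp_all)
  show ?case
    apply (rule reach_mono)
     apply (rule reach_each_step[of s Ka "TBit a" "map TBit x"])
       apply (simp add: Cons.prems)
      apply simp
     apply (rule reach_Case, rule reach_Push)
     apply (rule reach_state[OF IH])
     apply (simp add: fun_eq_iff Cons.prems y)
    apply simp
    done
qed

section \<open>The stack evaluator\<close>

fun flip :: "token \<Rightarrow> token" where
  "flip (TBit b) = TBit (\<not> b)"
| "flip a = a"

text \<open>Prefix notation read backwards: both operands lie on \<open>Vs\<close> when their
  connective arrives, the first one on top. The bits of a variable arrive before their
  \<open>TVar\<close>, in reverse, and pushing them on \<open>Ka\<close> restores the numeral. For
  \<open>TCond\<close> the antecedent vector lands on \<open>Ka\<close>, where \<open>search\<close>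
  expects its key.\<close>

definition op :: "bool \<Rightarrow> token \<Rightarrow> (reg, token) prog" where
  "op idf t = (case t of
     TBit b \<Rightarrow> Push Ka (TBit b)
   | TBot \<Rightarrow> Push Vs TVar ;; each Ln UNIV (\<lambda>_. Push Lc TBot ;; Push Vs (TBit False)) ;; move Lc UNIV id Ln
   | TVar \<Rightarrow> search Tv ;; clear Ka ;; Push Vs TVar ;;
       each Ln UNIV (\<lambda>_. Push Lc TBot ;; Case Pr (\<lambda>x. Push Vs (TBit (x = Some (TBit True))))) ;;
       move Lc UNIV id Ln ;; clear Pr
   | TNeg \<Rightarrow> move Vs bits flip Ka ;; move Ka UNIV id Vs
   | TConj \<Rightarrow> move Vs bits id Ka ;; Case Vs (\<lambda>_. Skip) ;; move Vs bits id Kb ;;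
       each Ka UNIV (\<lambda>a. Case Kb (\<lambda>b. Push Vs (TBit (a = TBit True \<and> b = Some (TBit True)))))
   | TCond \<Rightarrow> move Vs bits id Ka ;; Case Vs (\<lambda>_. Skip) ;; move Vs bits id Kb ;; search Tc ;;
       each Ln UNIV (\<lambda>_. Push Lc TBot ;; block idf) ;; move Lc UNIV id Ln ;;
       clear Ka ;; clear Kb ;; clear Pr)"

lemma deterministic_op [simp]: "deterministic (op idf t)"
  by (cases t) (simp_all add: op_def block_def)

definition ready :: "nat \<Rightarrow> (bool list \<times> bool list) list \<Rightarrow> (bool list \<times> nat option list) list \<Rightarrow>
    (reg \<Rightarrow> token list) \<Rightarrow> bool" where
  "ready N tv tc s \<longleftrightarrow> s Kb = [] \<and> s Kc = [] \<and> s Kd = [] \<and> s Pl = [] \<and> s Pr = [] \<and>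
     s Ts = [] \<and> s Lc = [] \<and> s Mm = [] \<and> s Ln = replicate N TBot \<and>
     s Tv = table_word (map TBit) tv \<and> s Tc = table_word blks tc"

text \<open>A common bound for all symbols, up to the length of a numeral. The conditional
  dominates: per table symbol it spends 33 steps on the search, 17 on the blocks and 3 on
  clearing.\<close>

definition cost :: "nat \<Rightarrow> (bool list \<times> bool list) list \<Rightarrow> (bool list \<times> nat option list) list \<Rightarrow> nat" where
  "cost N tv tc = 60 * (N + length (table_word (map TBit) tv) + length (table_word blks tc)) + 60"

lemma TCond_notin_blks: "TCond \<notin> set (blks p)"
proof (induction p)
  case (Cons x p)
  then show ?case by (cases x) auto
qed simp

lemma op_Bot:
  assumes "ready N tv tc s" "Q (s(Vs := rev (map TBit (replicate N False)) @ TVar # s Vs))"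
  shows "reach (op idf TBot) (cost N tv tc) Q s"
  unfolding op_def token.case
  apply (rule reach_mono)
   apply (rule reach_Seq, rule reach_Push)
   apply (rule reach_Seq, rule reach_zeros[where n = N])
    apply (use assms(1) in \<open>simp add: ready_def\<close>)
   apply (rule reach_move_all)
    apply simp
   apply (rule back_subst[of Q, OF assms(2)])
   apply (use assms(1) in \<open>simp add: fun_eq_iff ready_def\<close>)
  apply (use assms(1) in \<open>simp add: ready_def cost_def\<close>)
  done

lemma op_Neg:
  assumes "ready N tv tc s" "s Ka = []" "s Vs = rev (map TBit v) @ TVar # vs" "length v = N"
    "Q (s(Vs := rev (map TBit (map Not v)) @ TVar # vs))"
  shows "reach (op idf TNeg) (cost N tv tc) Q s"
  unfolding op_def token.case
  apply (rule reach_mono)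
   apply (rule reach_Seq, rule reach_move[where ys = "TVar # vs"])
       apply (rule assms(3))
      apply auto[1]
     apply auto[1]
    apply simp
   apply (rule reach_move_all)
    apply simp
   apply (rule back_subst[of Q, OF assms(5)])
   apply (use assms(2) in \<open>simp add: fun_eq_iff rev_map\<close>)
  apply (use assms(1,2,4) in \<open>simp add: ready_def cost_def\<close>)
  done

lemma op_Conj:
  assumes "ready N tv tc s" "s Ka = []"
    "s Vs = rev (map TBit x) @ TVar # rev (map TBit y) @ TVar # vs" "length x = N" "length y = N"
    "Q (s(Vs := rev (map TBit (map2 (\<and>) x y)) @ TVar # vs))"
  shows "reach (op idf TConj) (cost N tv tc) Q s"
  unfolding op_def token.case
  apply (rule reach_mono)
   apply (rule reach_Seq, rule reach_move[where ys = "TVar # rev (map TBit y) @ TVar # vs"])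
       apply (rule assms(3))
      apply auto[1]
     apply auto[1]
    apply simp
   apply (rule reach_Seq, rule reach_Case_Some[where a = TVar and xs = "rev (map TBit y) @ TVar # vs"])
    apply simp
   apply (rule reach_Skip)
   apply (rule reach_Seq, rule reach_move[where xs = "rev (map TBit y)" and ys = "TVar # vs"])
       apply simp
      apply auto[1]
     apply auto[1]
    apply simp
   apply (rule reach_conj[where x = x and y = y])
      apply (simp add: rev_map assms)
     apply (use assms(1) in \<open>simp add: rev_map ready_def\<close>)
    apply (simp add: assms)
   apply (rule back_subst[of Q, OF assms(6)])
   apply (use assms(1,2) in \<open>simp add: fun_eq_iff rev_map ready_def\<close>)
  apply (use assms(4,5) in \<open>simp add: cost_def\<close>)
  done

lemma op_Var:
  assumes "ready N tv tc s" "s Ka = map TBit k"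
    "Q (s(Ka := [], Vs := rev (map TBit (map (\<lambda>i. i < length (lookup [] tv k) \<and> lookup [] tv k ! i) [0..<N])) @
       TVar # s Vs))"
  shows "reach (op idf TVar) (cost N tv tc + 3 * length k) Q s"
  unfolding op_def token.case
  apply (rule reach_mono)
   apply (rule reach_Seq, rule reach_search[where pe = "map TBit" and es = tv and k = k])
              apply simp
             apply auto[1]
            apply simp
           apply (use assms(1,2) in \<open>simp_all add: ready_def\<close>)[7]
   apply (rule reach_Seq, rule reach_clear)
   apply (rule reach_Seq, rule reach_Push)
   apply (rule reach_Seq, rule reach_bits[where n = N and p = "lookup [] tv k"])
     apply (use assms(1) in \<open>simp add: ready_def\<close>)
    apply simp
   apply (rule reach_Seq, rule reach_move_all)
    apply simp
   apply (rule reach_clear)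
   apply (rule back_subst[of Q, OF assms(3)])
   apply (use assms(1) in \<open>simp add: fun_eq_iff ready_def o_def\<close>)
  apply (use assms(1,2) length_lookup[of "map TBit" "[]" tv k] in \<open>simp add: ready_def cost_def\<close>)
  done

lemma length_blks_lookup: "length (blks (drop n (lookup [] tc x))) \<le> length (table_word blks tc)"
proof -
  have "length (blks (drop n p)) \<le> length (blks p)" for p :: "nat option list"
    by (metis append_take_drop_id blks_def concat_append le_add2 length_append map_append)
  then show ?thesis using length_lookup[of blks "[]" tc x] by (auto intro: order_trans)
qed

lemma op_Cond:
  assumes "ready N tv tc s" "s Ka = []"
    "s Vs = rev (map TBit x) @ TVar # rev (map TBit y) @ TVar # vs" "length x = N" "length y = N"
    "Q (s(Vs := rev (map TBit (map (\<lambda>i. outcome idf x y (nth_opt (lookup [] tc x) i)) [0..<N])) @ TVar # vs))"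
  shows "reach (op idf TCond) (cost N tv tc) Q s"
  unfolding op_def token.case
  apply (rule reach_mono)
   apply (rule reach_Seq, rule reach_move[where ys = "TVar # rev (map TBit y) @ TVar # vs"])
       apply (rule assms(3))
      apply auto[1]
     apply auto[1]
    apply simp
   apply (rule reach_Seq, rule reach_Case_Some[where a = TVar and xs = "rev (map TBit y) @ TVar # vs"])
    apply simp
   apply (rule reach_Skip)
   apply (rule reach_Seq, rule reach_move[where xs = "rev (map TBit y)" and ys = "TVar # vs"])
       apply simp
      apply auto[1]
     apply auto[1]
    apply simp
   apply (rule reach_Seq, rule reach_search[where pe = blks and es = tc and k = x])
              apply simp
             apply (rule TCond_notin_blks)
            apply simp
           apply (use assms(1,2) in \<open>simp_all add: ready_def rev_map\<close>)[7]
   apply (rule reach_Seq, rule reach_blocks[where n = N and p = "lookup [] tc x" and x = x and y = y])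
          apply (use assms(1,2,4,5) in \<open>simp_all add: ready_def rev_map\<close>)[7]
   apply (rule reach_Seq, rule reach_move_all)
    apply simp
   apply (rule reach_Seq, rule reach_clear)
   apply (rule reach_Seq, rule reach_clear)
   apply (rule reach_clear)
   apply (rule back_subst[of Q, OF assms(6)])
   apply (use assms(1,2) in \<open>simp add: fun_eq_iff ready_def o_def\<close>)
  apply (use assms(1,2,4,5) length_blks_lookup[of N tc x] length_blks_lookup[of 0 tc x]
    in \<open>simp add: ready_def cost_def\<close>)
  done

lemma vec_empty: "vec N {} = replicate N False"
  by (simp add: vec_def map_replicate_const)

lemma vec_Compl: "vec N (- X) = map Not (vec N X)"
  by (simp add: vec_def)

lemma vec_Int: "vec N (X \<inter> Y) = map2 (\<and>) (vec N X) (vec N Y)"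
  by (rule nth_equalityI) (simp_all add: vec_def)

lemma length_vec [simp]: "length (vec N X) = N"
  by (simp add: vec_def)

lemma vec_table_val:
  "map (\<lambda>i. i < length (lookup [] tv (key p)) \<and> lookup [] tv (key p) ! i) [0..<N] = vec N (table_val N tv key p)"
  by (simp add: vec_def table_val_def)

text \<open>The machine tests the range of an index against the length of the vector,
  \<open>table_sel\<close> against \<open>N\<close>; the tests agree because vectors have length
  \<open>N\<close>.\<close>

lemma vec_Cond:
  "map (\<lambda>i. outcome idf (vec N X) (vec N Y) (nth_opt (lookup [] tc (vec N X)) i)) [0..<N] =
   vec N {i. \<forall>u. table_sel idf N tc X i = Some u \<longrightarrow> u \<in> Y}"
proof -
  have "outcome idf (vec N X) (vec N Y) (nth_opt (lookup [] tc (vec N X)) i) \<longleftrightarrow>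
      (\<forall>u. table_sel idf N tc X i = Some u \<longrightarrow> u \<in> Y)" if "i < N" for i
    using that unfolding outcome_def table_sel_Some nth_opt_def by (auto simp: vec_def)
  then show ?thesis by (simp add: vec_def[of N "{i. _ i}"])
qed

lemma op_Bit: "Q (s(Ka := TBit b # s Ka)) \<Longrightarrow> reach (op idf (TBit b)) 2 Q s"
  unfolding op_def token.case by (rule reach_Push)

lemma reach_read_bits:
  assumes "s Rw = map TBit cs @ rest"
    "reach (each Rw UNIV (op idf)) T Q (s(Rw := rest, Ka := rev (map TBit cs) @ s Ka))"
  shows "reach (each Rw UNIV (op idf)) (T + 4 * length cs) Q s"
  using assms
proof (induction cs arbitrary: s)
  case Nil
  then have "s(Rw := rest, Ka := s Ka) = s" by auto
  then show ?case using Nil by (simp del: fun_upd_apply)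
next
  case (Cons c cs)
  have IH: "reach (each Rw UNIV (op idf)) (T + 4 * length cs) Q
      (s(Rw := map TBit cs @ rest, Ka := TBit c # s Ka))"
    by (rule Cons.IH)
      (simp, rule reach_state[OF Cons.prems(2)], simp add: fun_eq_iff)
  show ?case
    apply (rule reach_mono)
     apply (rule reach_each_step[of s Rw "TBit c" "map TBit cs @ rest"])
       apply (simp add: Cons.prems)
      apply simp
     apply (rule op_Bit)
     apply (rule reach_state[OF IH])
     apply (simp add: fun_eq_iff)
    apply simp
    done
qed

text \<open>The hypothesis about the rest of the word is a continuation, so the induction applies to
  subformulas inside a word. In the binary cases it is used for the second operand first in time,
  since the word is reversed. \<open>L\<close> bounds all numerals uniformly, which makes the total
  a product.\<close>

lemma reach_eval:
  fixes idx :: "'v \<Rightarrow> nat"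
  defines "key \<equiv> \<lambda>p. binary (idx p)"
  assumes "ready N tv tc s" "s Ka = []" "s Rw = rev (encode idx A) @ rest" "length (encode idx A) \<le> L"
    "reach (each Rw UNIV (op idf)) T Q (s(Rw := rest,
       Vs := rev (map TBit (vec N (ext (table_val N tv key) (table_sel idf N tc) A))) @ TVar # s Vs))"
  shows "reach (each Rw UNIV (op idf)) (T + length (encode idx A) * (cost N tv tc + 3 * L + 5)) Q s"
  using assms(2-)
proof (induction A arbitrary: s rest T)
  case Bot
  show ?case
    apply (rule reach_mono)
     apply (rule reach_each_step[of s Rw TBot rest])
       apply (simp add: Bot)
      apply simp
     apply (rule op_Bot[where N = N and tv = tv and tc = tc])
      apply (use Bot in \<open>simp add: ready_def\<close>)
     apply (rule reach_state[OF Bot(5)])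
     apply (simp add: fun_eq_iff vec_empty)
    apply simp
    done
next
  case (Var p)
  let ?k = "binary (idx p)"
  have "reach (each Rw UNIV (op idf)) (T + cost N tv tc + 3 * length ?k + 2) Q
      (s(Rw := TVar # rest, Ka := map TBit ?k))"
    apply (rule reach_mono)
     apply (rule reach_each_step[of _ Rw TVar rest])
       apply simp
      apply simp
     apply (rule op_Var[where N = N and tv = tv and tc = tc and k = ?k])
       apply (use Var in \<open>simp add: ready_def\<close>)
      apply simp
     apply (rule reach_state[OF Var(5)])
     apply (simp add: fun_eq_iff vec_table_val[of tv key p, symmetric] Var(2))
     apply (simp add: key_def)
    apply simp
    done
  then have "reach (each Rw UNIV (op idf)) (T + cost N tv tc + 3 * length ?k + 2 + 4 * length (rev ?k)) Q s"
    by (intro reach_read_bits[where rest = "TVar # rest"]) (simp_all add: Var rev_map)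
  then show ?case
    by (rule reach_mono) (use Var(4) in \<open>simp add: algebra_simps\<close>)
next
  case (Neg A)
  let ?v = "vec N (ext (table_val N tv key) (table_sel idf N tc) A)"
  let ?s = "s(Rw := TNeg # rest, Vs := rev (map TBit ?v) @ TVar # s Vs)"
  have "reach (each Rw UNIV (op idf)) (T + cost N tv tc + 2) Q ?s"
    apply (rule reach_mono)
     apply (rule reach_each_step[of _ Rw TNeg rest])
       apply simp
      apply simp
     apply (rule op_Neg[where N = N and tv = tv and tc = tc and v = ?v and vs = "s Vs"])
         apply (use Neg.prems in \<open>simp add: ready_def\<close>)
        apply (use Neg.prems in simp)
       apply simp
      apply simp
     apply (rule reach_state[OF Neg.prems(5)])
     apply (simp add: fun_eq_iff vec_Compl)
    apply simp
    done
  then have "reach (each Rw UNIV (op idf))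
      (T + cost N tv tc + 2 + length (encode idx A) * (cost N tv tc + 3 * L + 5)) Q s"
    by (rule Neg.IH[where rest = "TNeg # rest", rotated -1]) (use Neg.prems in \<open>simp_all add: ready_def\<close>)
  then show ?case by (rule reach_mono) simp
next
  case (Conj A B)
  let ?a = "vec N (ext (table_val N tv key) (table_sel idf N tc) A)"
  let ?b = "vec N (ext (table_val N tv key) (table_sel idf N tc) B)"
  let ?s1 = "s(Rw := rev (encode idx A) @ TConj # rest, Vs := rev (map TBit ?b) @ TVar # s Vs)"
  let ?s2 = "?s1(Rw := TConj # rest, Vs := rev (map TBit ?a) @ TVar # ?s1 Vs)"
  have "reach (each Rw UNIV (op idf)) (T + cost N tv tc + 2) Q ?s2"
    apply (rule reach_mono)
     apply (rule reach_each_step[of _ Rw TConj rest])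
       apply simp
      apply simp
     apply (rule op_Conj[where N = N and tv = tv and tc = tc and x = ?a and y = ?b and vs = "s Vs"])
          apply (use Conj.prems in \<open>simp add: ready_def\<close>)
         apply (use Conj.prems in simp)
        apply simp
       apply simp
      apply simp
     apply (rule reach_state[OF Conj.prems(5)])
     apply (simp add: fun_eq_iff vec_Int)
    apply simp
    done
  then have "reach (each Rw UNIV (op idf))
      (T + cost N tv tc + 2 + length (encode idx A) * (cost N tv tc + 3 * L + 5)) Q ?s1"
    by (rule Conj.IH(1)[where rest = "TConj # rest", rotated -1]) (use Conj.prems in \<open>simp_all add: ready_def\<close>)
  then have "reach (each Rw UNIV (op idf))
      (T + cost N tv tc + 2 + length (encode idx A) * (cost N tv tc + 3 * L + 5) +
        length (encode idx B) * (cost N tv tc + 3 * L + 5)) Q s"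
    by (rule Conj.IH(2)[where rest = "rev (encode idx A) @ TConj # rest", rotated -1]) (use Conj.prems in \<open>simp_all add: ready_def\<close>)
  then show ?case by (rule reach_mono) (simp add: algebra_simps)
next
  case (Cond A B)
  let ?A = "ext (table_val N tv key) (table_sel idf N tc) A"
  let ?a = "vec N (ext (table_val N tv key) (table_sel idf N tc) A)"
  let ?b = "vec N (ext (table_val N tv key) (table_sel idf N tc) B)"
  let ?s1 = "s(Rw := rev (encode idx A) @ TCond # rest, Vs := rev (map TBit ?b) @ TVar # s Vs)"
  let ?s2 = "?s1(Rw := TCond # rest, Vs := rev (map TBit ?a) @ TVar # ?s1 Vs)"
  have "reach (each Rw UNIV (op idf)) (T + cost N tv tc + 2) Q ?s2"
    apply (rule reach_mono)
     apply (rule reach_each_step[of _ Rw TCond rest])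
       apply simp
      apply simp
     apply (rule op_Cond[where N = N and tv = tv and tc = tc and x = ?a and y = ?b and vs = "s Vs"])
          apply (use Cond.prems in \<open>simp add: ready_def\<close>)
         apply (use Cond.prems in simp)
        apply simp
       apply simp
      apply simp
     apply (rule reach_state[OF Cond.prems(5)])
     apply (simp add: fun_eq_iff vec_Cond)
    apply simp
    done
  then have "reach (each Rw UNIV (op idf))
      (T + cost N tv tc + 2 + length (encode idx A) * (cost N tv tc + 3 * L + 5)) Q ?s1"
    by (rule Cond.IH(1)[where rest = "TCond # rest", rotated -1]) (use Cond.prems in \<open>simp_all add: ready_def\<close>)
  then have "reach (each Rw UNIV (op idf))
      (T + cost N tv tc + 2 + length (encode idx A) * (cost N tv tc + 3 * L + 5) +
        length (encode idx B) * (cost N tv tc + 3 * L + 5)) Q s"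
    by (rule Cond.IH(2)[where rest = "rev (encode idx A) @ TCond # rest", rotated -1]) (use Cond.prems in \<open>simp_all add: ready_def\<close>)
  then show ?case by (rule reach_mono) (simp add: algebra_simps)
qed

section \<open>Recognising well-formed words\<close>

text \<open>Counting the formulas still expected makes well-formedness recognisable in one pass with
  a unary counter.\<close>

primrec formulas :: "('v \<Rightarrow> nat) \<Rightarrow> nat \<Rightarrow> token list \<Rightarrow> bool" where
  "formulas idx 0 w \<longleftrightarrow> w = []"
| "formulas idx (Suc c) w \<longleftrightarrow> (\<exists>A w'. w = encode idx A @ w' \<and> formulas idx c w')"

text \<open>Makes numerals self-delimiting: after \<open>TVar\<close> the maximal block of bits is
  the numeral.\<close>

lemma formulas_not_bit: "formulas idx c w \<Longrightarrow> peek w \<notin> Some ` bits"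
proof (cases c)
  case (Suc c')
  assume "formulas idx c w"
  then obtain A w' where "w = encode idx A @ w'" using Suc by auto
  then show ?thesis by (cases A) auto
qed auto

lemma formulas_Nil: "formulas idx (Suc c) [] \<longleftrightarrow> False"
proof -
  have "encode idx A \<noteq> []" for A by (cases A) auto
  then show ?thesis by simp
qed

lemma formulas_Bot: "formulas idx (Suc c) (TBot # w) \<longleftrightarrow> formulas idx c w"
proof
  assume "formulas idx (Suc c) (TBot # w)"
  then obtain A w' where A: "TBot # w = encode idx A @ w'" "formulas idx c w'" by auto
  then show "formulas idx c w" by (cases A) auto
qed (auto intro!: exI[of _ Bot])

lemma formulas_Bit: "formulas idx c (TBit b # w) \<longleftrightarrow> False"
  using formulas_not_bit[of idx c "TBit b # w"] by auto

lemma formulas_Neg: "formulas idx (Suc c) (TNeg # w) \<longleftrightarrow> formulas idx (Suc c) w"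
proof
  assume "formulas idx (Suc c) (TNeg # w)"
  then obtain A w' where A: "TNeg # w = encode idx A @ w'" "formulas idx c w'" by auto
  then show "formulas idx (Suc c) w" by (cases A) auto
next
  assume "formulas idx (Suc c) w"
  then obtain A w' where A: "w = encode idx A @ w'" "formulas idx c w'" by auto
  then show "formulas idx (Suc c) (TNeg # w)" by (auto intro!: exI[of _ "Neg A"])
qed

lemma formulas_Conj: "formulas idx (Suc c) (TConj # w) \<longleftrightarrow> formulas idx (Suc (Suc c)) w"
proof
  assume "formulas idx (Suc c) (TConj # w)"
  then obtain A w' where A: "TConj # w = encode idx A @ w'" "formulas idx c w'" by auto
  then show "formulas idx (Suc (Suc c)) w" by (cases A) auto
next
  assume "formulas idx (Suc (Suc c)) w"
  then obtain A B w' where A: "w = encode idx A @ encode idx B @ w'" "formulas idx c w'" by auto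
  then show "formulas idx (Suc c) (TConj # w)" by (auto intro!: exI[of _ "Conj A B"])
qed

lemma formulas_Cond: "formulas idx (Suc c) (TCond # w) \<longleftrightarrow> formulas idx (Suc (Suc c)) w"
proof
  assume "formulas idx (Suc c) (TCond # w)"
  then obtain A w' where A: "TCond # w = encode idx A @ w'" "formulas idx c w'" by auto
  then show "formulas idx (Suc (Suc c)) w" by (cases A) auto
next
  assume "formulas idx (Suc (Suc c)) w"
  then obtain A B w' where A: "w = encode idx A @ encode idx B @ w'" "formulas idx c w'" by auto
  then show "formulas idx (Suc c) (TCond # w)" by (auto intro!: exI[of _ "Cond A B"])
qed

lemma bits_prefix_eq:
  assumes "map TBit bs @ w = map TBit bs' @ w'" "peek w \<notin> Some ` bits" "peek w' \<notin> Some ` bits"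
  shows "bs = bs' \<and> w = w'"
  using assms
proof (induction bs arbitrary: bs')
  case Nil
  then show ?case by (cases bs') auto
next
  case (Cons b bs)
  then show ?case by (cases bs') auto
qed

lemma formulas_Var:
  assumes "peek w \<notin> Some ` bits"
  shows "formulas idx (Suc c) (TVar # map TBit bs @ w) \<longleftrightarrow> bs \<in> range (\<lambda>p. binary (idx p)) \<and> formulas idx c w"
proof
  assume "formulas idx (Suc c) (TVar # map TBit bs @ w)"
  then obtain A w' where A: "TVar # map TBit bs @ w = encode idx A @ w'" "formulas idx c w'" by auto
  then obtain p where "A = Var p" by (cases A) auto
  then have "map TBit bs @ w = map TBit (binary (idx p)) @ w'" using A by simp
  from bits_prefix_eq[OF this assms formulas_not_bit[OF A(2)]] A(2)
  show "bs \<in> range (\<lambda>p. binary (idx p)) \<and> formulas idx c w" by auto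
next
  assume "bs \<in> range (\<lambda>p. binary (idx p)) \<and> formulas idx c w"
  then obtain p where "bs = binary (idx p)" "formulas idx c w" by auto
  then show "formulas idx (Suc c) (TVar # map TBit bs @ w)" by (auto intro!: exI[of _ "Var p"])
qed

section \<open>Recognising numerals of variables\<close>

text \<open>Which numerals occur depends on the range of \<open>idx\<close>, so the test is a
  parameter. It takes linear time, finds the numeral reversed on \<open>Kb\<close>, and reports an
  error on \<open>Fl\<close> instead of failing, because malformed words must be accepted.\<close>

definition checks :: "(reg, token) prog \<Rightarrow> bool list set \<Rightarrow> nat \<Rightarrow> bool" where
  "checks chk G c \<longleftrightarrow> deterministic chk \<and> (\<forall>s bs Q. s Kb = rev (map TBit bs) \<longrightarrow>
     Q (s(Kb := [], Fl := if bs \<in> G then s Fl else TBot # s Fl)) \<longrightarrow> reach chk (c * (length bs + 1)) Q s)"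

lemma binary_zero: "binary 0 = []"
  by (subst binary.simps) simp

lemma binary_pos: "0 < n \<Longrightarrow> binary n = odd n # binary (n div 2)"
  by (subst binary.simps) simp

lemma range_binary: "range binary = {bs. bs = [] \<or> last bs}"
proof -
  have "binary n = [] \<or> last (binary n)" for n
  proof (induction n rule: less_induct)
    case (less n)
    show ?case
    proof (cases "n = 0")
      case False
      show ?thesis
      proof (cases "n div 2 = 0")
        case True
        then have "n = 1" using False by auto
        then show ?thesis by (simp add: binary_pos binary_zero)
      next
        case 2: False
        then show ?thesis using less[of "n div 2"] False by (auto simp: binary_pos)
      qed
    qed (simp add: binary_zero)
  qed
  moreover have "\<exists>n. bs = binary n" if "bs = [] \<or> last bs" for bs
    using that
  proof (induction bs)
    case Nil
    then show ?case using binary_zero by metis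
  next
    case (Cons b bs)
    have "bs = [] \<or> last bs" using Cons.prems by (auto split: if_splits)
    then obtain n where n: "bs = binary n" using Cons.IH by blast
    \<comment> \<open>If \<open>n = 0\<close> then \<open>bs\<close> is empty and the premise makes
      \<open>b\<close> true; this excludes a leading zero.\<close>
    have "0 < 2 * n + of_bool b"
      using Cons.prems n by (cases "n = 0") (auto simp: binary_zero)
    then have "b # bs = binary (2 * n + of_bool b)" by (subst binary_pos) (auto simp: n)
    then show ?case by blast
  qed
  ultimately show ?thesis by blast
qed

lemma inj_binary: "inj binary"
proof (rule injI)
  fix m n assume "binary m = binary n"
  then show "m = n"
  proof (induction m arbitrary: n rule: less_induct)
    case (less m)
    show ?case
    proof (cases "m = 0 \<or> n = 0")
      case True
      then show ?thesis using less.prems by (cases "m = 0"; cases "n = 0") (auto simp: binary_zero binary_pos)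
    next
      case False
      then have "odd m = odd n" "binary (m div 2) = binary (n div 2)"
        using less.prems by (auto simp: binary_pos)
      then have "m div 2 = n div 2" using less.IH[of "m div 2" "n div 2"] False by auto
      then show ?thesis using \<open>odd m = odd n\<close> by (metis odd_two_times_div_two_succ dvd_mult_div_cancel)
    qed
  qed
qed

text \<open>For enumerations onto all naturals. The most significant bit comes last in a numeral,
  hence lies on top of \<open>Kb\<close>, and must not be zero.\<close>

definition last_checker :: "(reg, token) prog" where
  "last_checker = Case Kb (\<lambda>x. if x = Some (TBit False) then Push Fl TBot else Skip) ;; clear Kb"

lemma last_checker: "checks last_checker (range binary) 7"
  unfolding checks_def
proof (intro conjI allI impI)
  show "deterministic last_checker" by (simp add: last_checker_def)
next
  fix s :: "reg \<Rightarrow> token list" and bs Q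
  assume s: "s Kb = rev (map TBit bs)"
    and Q: "Q (s(Kb := [], Fl := if bs \<in> range binary then s Fl else TBot # s Fl))"
  show "reach last_checker (7 * (length bs + 1)) Q s"
  proof (cases "bs = [] \<or> last bs")
    case True
    then have "peek (s Kb) \<noteq> Some (TBit False)"
      unfolding s by (cases bs rule: rev_cases) auto
    then show ?thesis
      unfolding last_checker_def
      apply -
      apply (rule reach_mono)
       apply (rule reach_Seq, rule reach_Case)
       apply (simp only: if_False)
       apply (rule reach_Skip, rule reach_clear)
       apply (rule back_subst[of Q, OF Q])
       apply (use True in \<open>simp add: fun_eq_iff range_binary\<close>)
      apply (simp add: s)
      done
  next
    case False
    then have "peek (s Kb) = Some (TBit False)"
      unfolding s by (cases bs rule: rev_cases) auto
    then show ?thesis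
      unfolding last_checker_def
      apply -
      apply (rule reach_mono)
       apply (rule reach_Seq, rule reach_Case)
       apply (simp only: simp_thms if_True)
       apply (rule reach_Push, rule reach_clear)
       apply (rule back_subst[of Q, OF Q])
       apply (use False in \<open>simp add: fun_eq_iff range_binary\<close>)
      apply (simp add: s)
      done
  qed
qed

text \<open>For enumerations onto a finite segment: a decision tree stored in the program, where
  \<open>F\<close> is the set of remainders that would complete an admissible reversed
  numeral.\<close>

primrec finite_checker :: "nat \<Rightarrow> bool list set \<Rightarrow> (reg, token) prog" where
  "finite_checker 0 F = Case Kb (\<lambda>x. case x of
      None \<Rightarrow> if [] \<in> F then Skip else Push Fl TBot
    | Some _ \<Rightarrow> Push Fl TBot ;; clear Kb)"
| "finite_checker (Suc k) F = Case Kb (\<lambda>x. case x of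
      None \<Rightarrow> if [] \<in> F then Skip else Push Fl TBot
    | Some a \<Rightarrow> finite_checker k {l. (a = TBit True) # l \<in> F})"

lemma deterministic_finite_checker: "deterministic (finite_checker k F)"
  by (induction k arbitrary: F) (simp_all add: split_option_all)

lemma reach_finite_checker:
  assumes "\<forall>l\<in>F. length l \<le> k" "s Kb = map TBit bs"
    "Q (s(Kb := [], Fl := if bs \<in> F then s Fl else TBot # s Fl))"
  shows "reach (finite_checker k F) (k + 3 * length bs + 5) Q s"
  using assms
proof (induction k arbitrary: F s bs)
  case 0
  show ?case
  proof (cases bs)
    case Nil
    have K: "s Kb = []" using 0 Nil by simp
    have *: "s(Kb := []) = s" using K by auto
    show ?thesis
    proof (cases "[] \<in> F")
      case True
      then have "Q s" using 0(3) Nil * by (simp del: fun_upd_apply)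
      then show ?thesis
        using True K by (simp, intro reach_mono[OF reach_Case_None[of s Kb]]) (auto intro: reach_Skip)
    next
      case False
      then have "Q (s(Fl := TBot # s Fl))" using 0(3) Nil * by (simp del: fun_upd_apply)
      then show ?thesis
        using False K by (simp, intro reach_mono[OF reach_Case_None[of s Kb]]) (auto intro!: reach_Push simp del: fun_upd_apply)
    qed
  next
    case (Cons b l)
    then have "bs \<notin> F" using 0 by auto
    show ?thesis
      unfolding finite_checker.simps
      apply (rule reach_mono)
       apply (rule reach_Case_Some[of s Kb "TBit b" "map TBit l"])
        apply (simp add: 0 Cons)
       apply (simp only: option.case)
       apply (rule reach_Seq, rule reach_Push, rule reach_clear)
       apply (rule back_subst[of Q, OF 0(3)])
       apply (use \<open>bs \<notin> F\<close> in \<open>simp add: fun_eq_iff\<close>)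
      apply (simp add: Cons)
      done
  qed
next
  case (Suc k)
  show ?case
  proof (cases bs)
    case Nil
    have K: "s Kb = []" using Suc.prems Nil by simp
    have *: "s(Kb := []) = s" using K by auto
    show ?thesis
    proof (cases "[] \<in> F")
      case True
      then have "Q s" using Suc.prems(3) Nil * by (simp del: fun_upd_apply)
      then show ?thesis
        using True K by (simp, intro reach_mono[OF reach_Case_None[of s Kb]]) (auto intro: reach_Skip)
    next
      case False
      then have "Q (s(Fl := TBot # s Fl))" using Suc.prems(3) Nil * by (simp del: fun_upd_apply)
      then show ?thesis
        using False K by (simp, intro reach_mono[OF reach_Case_None[of s Kb]]) (auto intro!: reach_Push simp del: fun_upd_apply)
    qed
  next
    case (Cons b l)
    let ?F = "{l. (TBit b = TBit True) # l \<in> F}"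
    let ?s = "s(Kb := map TBit l)"
    have eq: "?s(Kb := [], Fl := if l \<in> ?F then ?s Fl else TBot # ?s Fl) =
        s(Kb := [], Fl := if bs \<in> F then s Fl else TBot # s Fl)"
      by (simp add: fun_eq_iff Cons)
    have "Q (?s(Kb := [], Fl := if l \<in> ?F then ?s Fl else TBot # ?s Fl))"
      unfolding eq by (rule Suc.prems)
    then have IH: "reach (finite_checker k ?F) (k + 3 * length l + 5) Q ?s"
      by (rule Suc.IH[rotated -1]) (use Suc.prems(1) in auto)
    show ?thesis
      unfolding finite_checker.simps
      apply (rule reach_mono)
       apply (rule reach_Case_Some[of s Kb "TBit b" "map TBit l"])
        apply (simp add: Suc.prems Cons)
       apply (simp only: option.case)
       apply (rule IH)
      apply (simp add: Cons)
      done
  qed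
qed

lemma finite_checker:
  assumes "finite G"
  shows "\<exists>chk c. checks chk G c"
proof -
  let ?F = "rev ` G"
  obtain k where k: "\<forall>l\<in>?F. length l \<le> k"
    using finite_maxlen[of ?F] assms by (auto intro: less_imp_le)
  have "checks (finite_checker k ?F) G (k + 5)"
    unfolding checks_def
  proof (intro conjI allI impI)
    fix s :: "reg \<Rightarrow> token list" and bs Q
    assume s: "s Kb = rev (map TBit bs)"
      and Q: "Q (s(Kb := [], Fl := if bs \<in> G then s Fl else TBot # s Fl))"
    have *: "rev bs \<in> ?F \<longleftrightarrow> bs \<in> G" by (metis imageE image_eqI rev_rev_ident)
    have "reach (finite_checker k ?F) (k + 3 * length (rev bs) + 5) Q s"
      by (rule reach_finite_checker[OF k]) (use s Q * in \<open>simp_all add: rev_map\<close>)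
    then show "reach (finite_checker k ?F) ((k + 5) * (length bs + 1)) Q s"
      by (rule reach_mono) (simp add: algebra_simps)
  qed (rule deterministic_finite_checker)
  then show ?thesis by blast
qed

lemma checker_exists:
  fixes idx :: "'v \<Rightarrow> nat"
  assumes "enumeration idx"
  shows "\<exists>chk c. checks chk (range (\<lambda>p. binary (idx p))) c"
proof -
  have *: "range (\<lambda>p. binary (idx p)) = binary ` range idx" by auto
  from assms consider "range idx = UNIV" | n where "range idx = {..<n}"
    by (auto simp: enumeration_def)
  then show ?thesis
  proof cases
    case 1
    then show ?thesis unfolding * using last_checker by metis
  next
    case 2
    then show ?thesis unfolding * by (intro finite_checker) simp
  qed
qed

section \<open>Scanning the input\<close>

text \<open>A predictive parser with the number of expected formulas on \<open>Lc\<close>. The same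
  pass reverses the word onto \<open>Rw\<close> for the evaluator.\<close>

definition scan :: "(reg, token) prog \<Rightarrow> token \<Rightarrow> (reg, token) prog" where
  "scan chk t = Push Rw t ;; Case Lc (\<lambda>x. case x of None \<Rightarrow> Push Fl TBot | Some _ \<Rightarrow>
     (case t of
       TBot \<Rightarrow> Skip
     | TVar \<Rightarrow> each Iw bits (\<lambda>b. Push Rw b ;; Push Kb b) ;; chk
     | TNeg \<Rightarrow> Push Lc TBot
     | TConj \<Rightarrow> Push Lc TBot ;; Push Lc TBot
     | TCond \<Rightarrow> Push Lc TBot ;; Push Lc TBot
     | TBit b \<Rightarrow> Push Fl TBot))"

lemma deterministic_scan: "deterministic chk \<Longrightarrow> deterministic (scan chk t)"
  by (cases t) (simp_all add: scan_def split_option_all)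

definition scanned :: "('v \<Rightarrow> nat) \<Rightarrow> nat \<Rightarrow> token list \<Rightarrow> (reg \<Rightarrow> token list) \<Rightarrow> (reg \<Rightarrow> token list) \<Rightarrow> bool" where
  "scanned idx c w s s' \<longleftrightarrow> s' Iw = [] \<and> s' Rw = rev w @ s Rw \<and>
     (s' Fl = [] \<and> s' Lc = [] \<longleftrightarrow> s Fl = [] \<and> formulas idx c w) \<and>
     (\<forall>r. r \<notin> {Iw, Rw, Lc, Fl} \<longrightarrow> s' r = s r)"

lemma split_bits:
  obtains bs w' where "w = map TBit bs @ w'" "peek w' \<notin> Some ` bits"
proof (induction w arbitrary: thesis)
  case Nil
  show ?case by (rule Nil[of "[]" "[]"]) auto
next
  case (Cons t w)
  show ?case
  proof (cases "t \<in> bits")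
    case True
    then obtain b where "t = TBit b" by auto
    moreover obtain bs w' where "w = map TBit bs @ w'" "peek w' \<notin> Some ` bits" by (rule Cons.IH)
    ultimately show ?thesis by (intro Cons.prems[of "b # bs" w']) auto
  next
    case False
    then show ?thesis by (intro Cons.prems[of "[]" "t # w"]) auto
  qed
qed

text \<open>The induction is on the length of the word because one iteration at \<open>TVar\<close>
  consumes a whole numeral.\<close>

lemma reach_scan:
  fixes idx :: "'v \<Rightarrow> nat"
  assumes chk: "checks chk (range (\<lambda>p. binary (idx p))) m"
    and "s Iw = w" "s Lc = replicate c TBot" "s Kb = []"
  shows "reach (each Iw UNIV (scan chk)) ((m + 15) * length w + 1) (scanned idx c w s) s"
  using assms(2-)
proof (induction w arbitrary: s c rule: length_induct)
  case (1 w)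
  note prems = 1(2-4)
  show ?case
  proof (cases w)
    case Nil
    have "scanned idx c w s s"
      using prems Nil formulas_Nil[of idx] by (cases c) (auto simp: scanned_def)
    then show ?thesis using prems Nil by (intro reach_mono[OF reach_each_stop]) auto
  next
    case (Cons t w')
    \<comment> \<open>One iteration leading from \<open>w\<close> to \<open>w''\<close> in
      \<open>k\<close> steps; the last inequality says that the symbols consumed pay for it.\<close>
    have body: ?thesis
      if step: "reach (each Iw UNIV (scan chk)) ((m + 15) * length w'' + 1) (scanned idx c' w'' s1) s1
          \<Longrightarrow> reach (scan chk t) k (reach (each Iw UNIV (scan chk)) ((m + 15) * length w'' + 1) (scanned idx c w s)) (s(Iw := w'))"
        and s1: "s1 Iw = w''" "s1 Lc = replicate c' TBot" "s1 Kb = []"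
        and le: "length w'' \<le> length w'" "k + 2 \<le> (m + 15) * (length w - length w'')"
      for w'' c' s1 k
    proof -
      have "reach (each Iw UNIV (scan chk)) ((m + 15) * length w'' + 1) (scanned idx c' w'' s1) s1"
        using 1(1) s1 le(1) Cons by simp
      from step[OF this] have "reach (each Iw UNIV (scan chk)) (Suc (Suc (k + ((m + 15) * length w'' + 1)))) (scanned idx c w s) s"
        by (intro reach_each_step[of s Iw t w']) (use prems Cons in auto)
      then show ?thesis
      proof (rule reach_mono)
        have "(m + 15) * (length w - length w'') + (m + 15) * length w'' = (m + 15) * length w"
          using le(1) Cons by (simp flip: distrib_left)
        then show "Suc (Suc (k + ((m + 15) * length w'' + 1))) \<le> (m + 15) * length w + 1"
          using le(2) by linarith
      qed
    qed
    have simple: ?thesis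
      if step: "\<And>Q. Q s1 \<Longrightarrow> reach (scan chk t) 12 Q (s(Iw := w'))"
        and s1: "s1 Iw = w'" "s1 Lc = replicate c' TBot" "s1 Kb = []" "s1 Rw = t # s Rw"
          "s1 Fl = [] \<and> formulas idx c' w' \<longleftrightarrow> s Fl = [] \<and> formulas idx c w"
          "\<And>r. r \<notin> {Iw, Rw, Lc, Fl} \<Longrightarrow> s1 r = s r" for s1 c'
    proof (rule body[OF _ s1(1-3), of 12])
      have "scanned idx c w s = scanned idx c' w' s1"
        using s1 Cons by (auto simp: scanned_def fun_eq_iff)
      then show "reach (each Iw UNIV (scan chk)) ((m + 15) * length w' + 1) (scanned idx c' w' s1) s1 \<Longrightarrow>
          reach (scan chk t) 12 (reach (each Iw UNIV (scan chk)) ((m + 15) * length w' + 1) (scanned idx c w s)) (s(Iw := w'))"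
        using step by simp
    qed (use Cons in auto)
    show ?thesis
    proof (cases c)
      case 0
      show ?thesis
      proof (rule simple)
        fix Q assume "Q (s(Iw := w', Rw := t # s Rw, Fl := TBot # s Fl))"
        note Q = this
        show "reach (scan chk t) 12 Q (s(Iw := w'))"
          unfolding scan_def
          apply (rule reach_mono)
           apply (rule reach_Seq, rule reach_Push)
           apply (rule reach_Case_None)
            apply (use prems 0 in simp)
           apply (simp only: option.case)
           apply (rule reach_Push)
           apply (rule back_subst[of Q, OF Q])
           apply (simp add: fun_eq_iff)
          apply simp
          done
      qed (use 0 prems Cons in auto)
    next
      case (Suc d)
      have Lc: "s Lc = TBot # replicate d TBot" using prems Suc by simp
      have pop: "reach (scan chk t) 12 Q (s(Iw := w'))"
        if "reach (case t of
             TBot \<Rightarrow> Skip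
           | TVar \<Rightarrow> each Iw bits (\<lambda>b. Push Rw b ;; Push Kb b) ;; chk
           | TNeg \<Rightarrow> Push Lc TBot
           | TConj \<Rightarrow> Push Lc TBot ;; Push Lc TBot
           | TCond \<Rightarrow> Push Lc TBot ;; Push Lc TBot
           | TBit b \<Rightarrow> Push Fl TBot) 8 Q (s(Iw := w', Rw := t # s Rw, Lc := replicate d TBot))" for Q
        unfolding scan_def
        apply (rule reach_mono)
         apply (rule reach_Seq, rule reach_Push)
         apply (rule reach_Case_Some[where a = TBot and xs = "replicate d TBot"])
          apply (simp add: Lc)
         apply (simp only: option.case)
         apply (rule reach_state[OF that])
         apply (simp add: fun_eq_iff)
        apply simp
        done
      show ?thesis
      proof (cases t)
        case TBot
        show ?thesis
          by (rule simple[of "s(Iw := w', Rw := t # s Rw, Lc := replicate d TBot)" d], rule pop,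
              unfold TBot token.case, rule reach_mono[OF reach_Skip])
            (use TBot prems Cons Suc formulas_Bot[of idx] in \<open>auto simp del: formulas.simps\<close>)
      next
        case (TBit b)
        show ?thesis
          by (rule simple[of "s(Iw := w', Rw := t # s Rw, Lc := replicate d TBot, Fl := TBot # s Fl)" d], rule pop,
              unfold TBit token.case, rule reach_mono[OF reach_Push])
            (use TBit prems Cons Suc formulas_Bit[of idx] in \<open>auto simp del: formulas.simps\<close>)
      next
        case TNeg
        show ?thesis
          by (rule simple[of "s(Iw := w', Rw := t # s Rw, Lc := replicate (Suc d) TBot)" "Suc d"], rule pop,
              unfold TNeg token.case, rule reach_mono[OF reach_Push])
            (use TNeg prems Cons Suc formulas_Neg[of idx] in \<open>auto simp del: formulas.simps\<close>)
      next
        case TConj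
        show ?thesis
          by (rule simple[of "s(Iw := w', Rw := t # s Rw, Lc := replicate (Suc (Suc d)) TBot)" "Suc (Suc d)"], rule pop,
              unfold TConj token.case, rule reach_mono[OF reach_Seq[OF reach_Push]], rule reach_Push)
            (use TConj prems Cons Suc formulas_Conj[of idx] in \<open>auto simp del: formulas.simps\<close>)
      next
        case TCond
        show ?thesis
          by (rule simple[of "s(Iw := w', Rw := t # s Rw, Lc := replicate (Suc (Suc d)) TBot)" "Suc (Suc d)"], rule pop,
              unfold TCond token.case, rule reach_mono[OF reach_Seq[OF reach_Push]], rule reach_Push)
            (use TCond prems Cons Suc formulas_Cond[of idx] in \<open>auto simp del: formulas.simps\<close>)
      next
        case TVar
        obtain bs w'' where w': "w' = map TBit bs @ w''" "peek w'' \<notin> Some ` bits" by (rule split_bits)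
        let ?G = "range (\<lambda>p. binary (idx p))"
        let ?s1 = "s(Iw := w'', Rw := rev (map TBit bs) @ TVar # s Rw, Lc := replicate d TBot,
          Fl := if bs \<in> ?G then s Fl else TBot # s Fl)"
        have "scanned idx c w s = scanned idx d w'' ?s1"
          using formulas_Var[OF w'(2), of idx d bs] Cons TVar Suc w' 1(4)
          by (auto simp: scanned_def fun_eq_iff simp del: formulas.simps)
        note sc = this
        show ?thesis
        proof (rule body[of w'' d ?s1 "(7 * length bs + 1) + m * (length bs + 1) + 5"])
          assume R: "reach (each Iw UNIV (scan chk)) ((m + 15) * length w'' + 1) (scanned idx d w'' ?s1) ?s1"
          have R': "reach (each Iw UNIV (scan chk)) ((m + 15) * length w'' + 1) (scanned idx c w s) ?s1"
            using R unfolding sc .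
          have chk': "reach chk (m * (length bs + 1)) Q s'"
            if "s' Kb = rev (map TBit bs)" "Q (s'(Kb := [], Fl := if bs \<in> ?G then s' Fl else TBot # s' Fl))" for Q s'
            using chk that by (auto simp: checks_def)
          have "reach (scan chk t) ((7 * length bs + 1) + m * (length bs + 1) + 5) Q (s(Iw := w'))"
            if "Q ?s1" for Q
            unfolding scan_def TVar token.case
            apply (rule reach_mono)
             apply (rule reach_Seq, rule reach_Push)
             apply (rule reach_Case_Some[where a = TBot and xs = "replicate d TBot"])
              apply (simp add: Lc)
             apply (simp only: option.case)
             apply (rule reach_Seq, rule reach_copy[where xs = "map TBit bs" and ys = w''])
                   apply (simp add: w')
                  apply auto[1]
                 apply (rule w')
                apply simp
               apply simp
              apply simp
             apply (rule chk')
              apply (use prems(3) in simp)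
             apply (rule back_subst[of Q, OF that])
             apply (use prems(3) in \<open>simp add: fun_eq_iff\<close>)
            apply simp
            done
          from this[of "reach (each Iw UNIV (scan chk)) ((m + 15) * length w'' + 1) (scanned idx c w s)", OF R']
          show "reach (scan chk t) ((7 * length bs + 1) + m * (length bs + 1) + 5)
             (reach (each Iw UNIV (scan chk)) ((m + 15) * length w'' + 1) (scanned idx c w s)) (s(Iw := w'))" .
        qed (use prems w' Cons in \<open>simp_all add: algebra_simps\<close>)
      qed
    qed
  qed
qed

section \<open>The decision procedure\<close>

lemma reach_Choice1: "reach P t Q s \<Longrightarrow> reach (Choice P R) (Suc t) Q s"
  by (auto elim!: reachE intro: reachI run.Choice1)

lemma reach_Choice2: "reach R t Q s \<Longrightarrow> reach (Choice P R) (Suc t) Q s"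
  by (auto elim!: reachE intro: reachI run.Choice2)

section \<open>Guessing tables\<close>

text \<open>The guesses are not deterministic, so two notions are required: this one confines every
  run, and \<open>generable\<close> provides one timed run for a chosen word.\<close>

definition generates :: "('r, 'a) prog \<Rightarrow> 'r \<Rightarrow> 'a list set \<Rightarrow> bool" where
  "generates P r X \<longleftrightarrow> (\<forall>t s s'. run P t s s' \<longrightarrow> (\<exists>x\<in>X. s' = s(r := x @ s r)))"

definition generable :: "('r, 'a) prog \<Rightarrow> 'r \<Rightarrow> 'a list \<Rightarrow> nat \<Rightarrow> bool" where
  "generable P r x t \<longleftrightarrow> (\<forall>Q s. Q (s(r := x @ s r)) \<longrightarrow> reach P t Q s)"

lemma generatesE:
  assumes "generates P r (range f)" "run P t s s'"
  obtains x where "s' = s(r := f x @ s r)"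
  using assms unfolding generates_def by blast

lemma generableD: "generable P r x t \<Longrightarrow> Q (s(r := x @ s r)) \<Longrightarrow> reach P t Q s"
  unfolding generable_def by blast

lemma generates_mono: "generates P r X \<Longrightarrow> X \<subseteq> Y \<Longrightarrow> generates P r Y"
  unfolding generates_def by blast

lemma generates_Push: "generates (Push r a) r {[a]}"
  by (auto simp: generates_def)

lemma generates_Seq:
  assumes "generates P r X" "generates Q r Y"
  shows "generates (P ;; Q) r {y @ x | x y. x \<in> X \<and> y \<in> Y}"
  unfolding generates_def
proof (intro allI impI)
  fix t s s' assume "run (P ;; Q) t s s'"
  then obtain t1 t2 s1 where "run P t1 s s1" "run Q t2 s1 s'" by auto
  then obtain x y where "x \<in> X" "s1 = s(r := x @ s r)" "y \<in> Y" "s' = s1(r := y @ s1 r)"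
    using assms unfolding generates_def by meson
  then show "\<exists>x\<in>{y @ x | x y. x \<in> X \<and> y \<in> Y}. s' = s(r := x @ s r)"
    by (intro bexI[of _ "y @ x"]) auto
qed

lemma generates_Choice:
  "generates P r X \<Longrightarrow> generates Q r Y \<Longrightarrow> generates (Choice P Q) r (X \<union> Y)"
  unfolding generates_def by blast

lemma generates_Star:
  assumes "generates P r X"
  shows "generates (Star P) r {concat xs | xs. set xs \<subseteq> X}"
proof -
  have "\<exists>xs. set xs \<subseteq> X \<and> s' = s(r := concat xs @ s r)" if "run (Star P) t s s'" for t s s'
    using that
  proof (induction "Star P" t s s' rule: run.induct)
    case (Star_stop s)
    then show ?case by (intro exI[of _ "[]"]) auto
  next
    case (Star_step t s s1 u s')
    obtain xs where xs: "set xs \<subseteq> X" "s' = s1(r := concat xs @ s1 r)" using Star_step by blast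
    obtain x where x: "x \<in> X" "s1 = s(r := x @ s r)" using assms Star_step(1) unfolding generates_def by blast
    show ?case using xs x by (intro exI[of _ "xs @ [x]"]) auto
  qed
  then show ?thesis unfolding generates_def by blast
qed

lemma generable_mono: "generable P r x t \<Longrightarrow> t \<le> u \<Longrightarrow> generable P r x u"
  unfolding generable_def using reach_mono by blast

lemma generable_Push: "generable (Push r a) r [a] 2"
  unfolding generable_def by (auto intro: reach_Push)

lemma generable_Seq:
  assumes "generable P r x t" "generable Q r y u"
  shows "generable (P ;; Q) r (y @ x) (Suc (t + u))"
  unfolding generable_def
proof (intro allI impI)
  fix R s assume "R (s(r := (y @ x) @ s r))"
  then have "reach Q u R (s(r := x @ s r))"
    using assms(2) unfolding generable_def by simp
  then have "reach P t (reach Q u R) s"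
    using assms(1) unfolding generable_def by blast
  then show "reach (P ;; Q) (Suc (t + u)) R s" by (rule reach_Seq)
qed

lemma generable_Choice1: "generable P r x t \<Longrightarrow> generable (Choice P Q) r x (Suc t)"
  unfolding generable_def by (auto intro: reach_Choice1)

lemma generable_Choice2: "generable Q r x t \<Longrightarrow> generable (Choice P Q) r x (Suc t)"
  unfolding generable_def by (auto intro: reach_Choice2)

text \<open>Since pieces are nonempty, the overhead of an iteration is charged to one symbol of its
  piece; this is the added 1 in \<open>k + 1\<close>.\<close>

lemma generable_Star:
  assumes "\<And>x. x \<in> set xs \<Longrightarrow> x \<noteq> [] \<and> generable P r x (k * length x)"
  shows "generable (Star P) r (concat xs) ((k + 1) * length (concat xs) + 1)"
  using assms
proof (induction xs rule: rev_induct)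
  case Nil
  then show ?case unfolding generable_def by (auto intro: reach_mono[OF reach_Star_stop])
next
  case (snoc x xs)
  have IH: "generable (Star P) r (concat xs) ((k + 1) * length (concat xs) + 1)"
    using snoc by simp
  have x: "x \<noteq> []" "generable P r x (k * length x)" using snoc.prems by auto
  show ?case
    unfolding generable_def
  proof (intro allI impI)
    fix Q s assume "Q (s(r := concat (xs @ [x]) @ s r))"
    then have "reach (Star P) ((k + 1) * length (concat xs) + 1) Q (s(r := x @ s r))"
      using IH unfolding generable_def by simp
    then have "reach P (k * length x) (reach (Star P) ((k + 1) * length (concat xs) + 1) Q) s"
      using x(2) unfolding generable_def by blast
    then have "reach (Star P) (Suc (k * length x + ((k + 1) * length (concat xs) + 1))) Q s"
      by (rule reach_Star_step)
    then show "reach (Star P) ((k + 1) * length (concat (xs @ [x])) + 1) Q s"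
      by (rule reach_mono) (use x(1) in \<open>cases x; simp add: algebra_simps\<close>)
  qed
qed

definition guess_bits :: "reg \<Rightarrow> (reg, token) prog" where
  "guess_bits r = Star (Choice (Push r (TBit True)) (Push r (TBit False)))"

definition guess_blocks :: "reg \<Rightarrow> (reg, token) prog" where
  "guess_blocks r = Star (Choice (Push r TNeg) (Push r TConj ;; Star (Push r TBot)))"

text \<open>Pushing prepends, so an entry is produced from its end: terminator, payload, separator,
  key.\<close>

definition guess_table :: "reg \<Rightarrow> (reg, token) prog \<Rightarrow> (reg, token) prog" where
  "guess_table r P = Star (Push r TCond ;; P ;; Push r TVar ;; guess_bits r)"

lemma concat_singletons: "concat (map (\<lambda>x. [f x]) xs) = map f xs"
  by (induction xs) auto

lemma lists_of_image: "set xs \<subseteq> f ` X \<Longrightarrow> \<exists>ys. xs = map f ys"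
  by (metis ex_map_conv image_iff subsetD)

lemma generates_bits: "generates (guess_bits r) r (range (map TBit))"
proof -
  have "generates (guess_bits r) r {concat xs | xs. set xs \<subseteq> {[TBit True]} \<union> {[TBit False]}}"
    unfolding guess_bits_def by (intro generates_Star generates_Choice generates_Push)
  moreover have "concat xs \<in> range (map TBit)" if "set xs \<subseteq> {[TBit True]} \<union> {[TBit False]}" for xs
  proof -
    have "set xs \<subseteq> (\<lambda>b. [TBit b]) ` UNIV" using that by auto
    from lists_of_image[OF this] show ?thesis by (auto simp: concat_singletons)
  qed
  ultimately show ?thesis by (elim generates_mono) auto
qed

lemma generable_bits: "generable (guess_bits r) r (map TBit bs) (4 * length bs + 1)"
proof -
  have "generable (guess_bits r) r (concat (map (\<lambda>b. [TBit b]) bs)) ((3 + 1) * length (concat (map (\<lambda>b. [TBit b]) bs)) + 1)"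
    unfolding guess_bits_def
  proof (rule generable_Star)
    fix x assume "x \<in> set (map (\<lambda>b. [TBit b]) bs)"
    then obtain b where x: "x = [TBit b]" by auto
    have "generable (Choice (Push r (TBit True)) (Push r (TBit False))) r x (Suc 2)"
      unfolding x by (cases b) (simp_all only: generable_Choice1[OF generable_Push] generable_Choice2[OF generable_Push])
    then show "x \<noteq> [] \<and> generable (Choice (Push r (TBit True)) (Push r (TBit False))) r x (3 * length x)"
      by (simp add: x numeral_3_eq_3 numeral_2_eq_2)
  qed
  then show ?thesis by (simp add: concat_singletons)
qed

lemma generates_ticks: "generates (Star (Push r TBot)) r (range (\<lambda>n. replicate n TBot))"
proof -
  have "generates (Star (Push r TBot)) r {concat xs | xs. set xs \<subseteq> {[TBot]}}"
    by (intro generates_Star generates_Push)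
  moreover have "concat xs \<in> range (\<lambda>n. replicate n TBot)" if "set xs \<subseteq> {[TBot]}" for xs
  proof -
    have "xs = replicate (length xs) [TBot]" using that by (induction xs) auto
    moreover have "concat (replicate n [TBot]) = replicate n TBot" for n by (induction n) auto
    ultimately show ?thesis by (metis rangeI)
  qed
  ultimately show ?thesis by (elim generates_mono) auto
qed

lemma generable_ticks: "generable (Star (Push r TBot)) r (replicate n TBot) (3 * n + 1)"
proof -
  have "concat (replicate n [TBot]) = replicate n TBot" for n by (induction n) auto
  then show ?thesis
    using generable_Star[of "replicate n [TBot]" "Push r TBot" r 2] generable_Push[of r TBot]
    by (simp split: if_splits)
qed

lemma generates_blocks: "generates (guess_blocks r) r (range blks)"
proof -
  let ?X = "{[TNeg]} \<union> {y @ x | x y. x \<in> {[TConj]} \<and> y \<in> range (\<lambda>n. replicate n TBot)}"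
  have "generates (guess_blocks r) r {concat xs | xs. set xs \<subseteq> ?X}"
    unfolding guess_blocks_def
    by (intro generates_Star generates_Choice generates_Seq generates_Push generates_ticks)
  moreover have "concat xs \<in> range blks" if "set xs \<subseteq> ?X" for xs
  proof -
    have "?X \<subseteq> range blk"
      using blk.simps[symmetric] by (auto simp del: blk.simps)
    then have "set xs \<subseteq> range blk" using that by blast
    from lists_of_image[OF this] show ?thesis by (auto simp: blks_def)
  qed
  ultimately show ?thesis by (elim generates_mono) auto
qed

lemma generable_blocks: "generable (guess_blocks r) r (blks p) (6 * length (blks p) + 1)"
proof -
  have "generable (guess_blocks r) r (concat (map blk p)) ((5 + 1) * length (concat (map blk p)) + 1)"
    unfolding guess_blocks_def
  proof (rule generable_Star)
    fix x assume "x \<in> set (map blk p)"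
    then obtain a where x: "x = blk a" by auto
    show "x \<noteq> [] \<and> generable (Choice (Push r TNeg) (Push r TConj ;; Star (Push r TBot))) r x (5 * length x)"
    proof (cases a)
      case None
      then show ?thesis using generable_mono[OF generable_Choice1[OF generable_Push[of r TNeg]]] by (simp add: x)
    next
      case (Some j)
      have "generable (Choice (Push r TNeg) (Push r TConj ;; Star (Push r TBot))) r (replicate j TBot @ [TConj])
          (Suc (Suc (2 + (3 * j + 1))))"
        by (intro generable_Choice2 generable_Seq generable_Push generable_ticks)
      then show ?thesis using Some by (auto simp: x elim: generable_mono)
    qed
  qed
  then show ?thesis by (simp add: blks_def)
qed

lemma generates_table:
  assumes "generates P r (range pe)"
  shows "generates (guess_table r P) r (range (table_word pe))"
proof -
  let ?e = "\<lambda>(k, p). map TBit k @ TVar # pe p @ [TCond]"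
  have "generates (Push r TCond ;; P ;; Push r TVar ;; guess_bits r) r (range ?e)"
    by (rule generates_mono[OF generates_Seq[OF generates_Push
          generates_Seq[OF assms generates_Seq[OF generates_Push generates_bits]]]])
      (auto simp: image_iff, rule exI, rule exI, rule refl)
  from generates_Star[OF this] have "generates (guess_table r P) r {concat xs | xs. set xs \<subseteq> range ?e}"
    unfolding guess_table_def .
  moreover have "concat xs \<in> range (table_word pe)" if "set xs \<subseteq> range ?e" for xs
    using lists_of_image[OF that] by (auto simp: table_word_def)
  ultimately show ?thesis by (elim generates_mono) auto
qed

lemma generable_table:
  assumes "\<And>p. generable P r (pe p) (6 * length (pe p) + 1)"
  shows "generable (guess_table r P) r (table_word pe es) (7 * length (table_word pe es) + 1)"
proof -
  let ?e = "\<lambda>(k, p). map TBit k @ TVar # pe p @ [TCond]"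
  have "generable (guess_table r P) r (concat (map ?e es)) ((6 + 1) * length (concat (map ?e es)) + 1)"
    unfolding guess_table_def
  proof (rule generable_Star)
    fix x assume "x \<in> set (map ?e es)"
    then obtain k p where x: "x = map TBit k @ TVar # pe p @ [TCond]" by auto
    have "generable (Push r TCond ;; P ;; Push r TVar ;; guess_bits r) r
        (((map TBit k @ [TVar]) @ pe p) @ [TCond]) (Suc (2 + Suc (6 * length (pe p) + 1 + Suc (2 + (4 * length k + 1)))))"
      by (intro generable_Seq generable_Push generable_bits assms)
    then show "x \<noteq> [] \<and> generable (Push r TCond ;; P ;; Push r TVar ;; guess_bits r) r x (6 * length x)"
      by (auto simp: x elim!: generable_mono)
  qed
  then show ?thesis by (simp add: table_word_def)
qed

text \<open>The lengths are unbounded, which does no harm: every run yields tables of the right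
  format, and the time bound concerns one good run.\<close>

definition guess :: "(reg, token) prog" where
  "guess = Star (Push Ln TBot) ;; guess_table Tv (guess_bits Tv) ;; guess_table Tc (guess_blocks Tc)"

text \<open>Looks for a world that refutes the formula. Meeting the \<open>TVar\<close> below the
  vector means that there is none, and the run blocks.\<close>

definition verdict :: "(reg, token) prog" where
  "verdict = each Vs {TBit True} (\<lambda>_. Skip) ;; Case Vs (\<lambda>x. if x = Some (TBit False) then Skip else Fail)"

text \<open>The scan starts with one expected formula. A counter that is not exhausted at the end is
  an error too and becomes a mark on \<open>Fl\<close>; any mark leads straight to
  acceptance.\<close>

definition decide :: "bool \<Rightarrow> (reg, token) prog \<Rightarrow> (reg, token) prog" where
  "decide idf chk = Push Lc TBot ;; each Iw UNIV (scan chk) ;;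
     Case Lc (\<lambda>x. if x = None then Skip else Push Fl TBot) ;;
     Case Fl (\<lambda>x. if x = None then guess ;; each Rw UNIV (op idf) ;; verdict else Skip)"

lemma run_guess:
  assumes "run guess t s s'"
  obtains N tv tc where "s' = s(Ln := replicate N TBot @ s Ln, Tv := table_word (map TBit) tv @ s Tv,
    Tc := table_word blks tc @ s Tc)"
proof -
  from assms obtain t1 t2 t3 s1 s2 where r: "run (Star (Push Ln TBot)) t1 s s1"
    "run (guess_table Tv (guess_bits Tv)) t2 s1 s2" "run (guess_table Tc (guess_blocks Tc)) t3 s2 s'"
    unfolding guess_def by auto
  obtain N where 1: "s1 = s(Ln := replicate N TBot @ s Ln)"
    by (rule generatesE[OF generates_ticks r(1)])
  obtain tv where 2: "s2 = s1(Tv := table_word (map TBit) tv @ s1 Tv)"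
    by (rule generatesE[OF generates_table[OF generates_bits] r(2)])
  obtain tc where 3: "s' = s2(Tc := table_word blks tc @ s2 Tc)"
    by (rule generatesE[OF generates_table[OF generates_blocks] r(3)])
  show ?thesis by (rule that[of N tv tc]) (simp add: 1 2 3)
qed

lemma reach_guess:
  assumes "Q (s(Ln := replicate N TBot @ s Ln, Tv := table_word (map TBit) tv @ s Tv,
    Tc := table_word blks tc @ s Tc))"
  shows "reach guess (cost N tv tc) Q s"
proof -
  have 1: "reach (Star (Push Ln TBot)) (3 * N + 1) R s'" if "R (s'(Ln := replicate N TBot @ s' Ln))" for R s'
    using that by (rule generableD[OF generable_ticks])
  have 2: "reach (guess_table Tv (guess_bits Tv)) (7 * length (table_word (map TBit) tv) + 1) R s'"
    if "R (s'(Tv := table_word (map TBit) tv @ s' Tv))" for R s'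
    using that by (rule generableD[OF generable_table[OF generable_mono[OF generable_bits]], rotated]) simp
  have 3: "reach (guess_table Tc (guess_blocks Tc)) (7 * length (table_word blks tc) + 1) R s'"
    if "R (s'(Tc := table_word blks tc @ s' Tc))" for R s'
    using that by (rule generableD[OF generable_table[OF generable_blocks]])
  show ?thesis
    unfolding guess_def
    apply (rule reach_mono)
     apply (rule reach_Seq, rule 1, rule reach_Seq, rule 2, rule 3)
     apply (rule back_subst[of Q, OF assms])
     apply (simp add: fun_eq_iff)
    apply (simp add: cost_def)
    done
qed

lemma reach_verdict_scan:
  assumes "s Vs = xs @ ys" "set xs \<subseteq> {TBit True}" "peek ys \<noteq> Some (TBit True)" "Q (s(Vs := ys))"
  shows "reach (each Vs {TBit True} (\<lambda>_. Skip)) (3 * length xs + 1) Q s"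
  using assms
proof (induction xs arbitrary: s)
  case Nil
  then have "s(Vs := ys) = s" by auto
  then show ?case using Nil by (intro reach_mono[OF reach_each_stop]) (auto simp del: fun_upd_apply)
next
  case (Cons x xs)
  have IH: "reach (each Vs {TBit True} (\<lambda>_. Skip)) (3 * length xs + 1) Q (s(Vs := xs @ ys))"
    by (rule Cons.IH) (use Cons.prems in \<open>simp_all add: fun_upd_same del: fun_upd_apply\<close>)
  show ?case
    apply (rule reach_mono)
     apply (rule reach_each_step[of s Vs x "xs @ ys"])
       apply (use Cons.prems in simp)
      apply (use Cons.prems in simp)
     apply (rule reach_Skip)
     apply (rule IH)
    apply simp
    done
qed

lemma split_True:
  assumes "False \<in> set v"
  obtains m v' where "v = replicate m True @ False # v'"
  using assms
proof (induction v arbitrary: thesis)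
  case (Cons b v)
  show ?case
  proof (cases b)
    case True
    then obtain m v' where "v = replicate m True @ False # v'" using Cons by auto
    then show ?thesis using True by (intro Cons.prems(1)[of "Suc m" v']) auto
  next
    case False
    then show ?thesis by (intro Cons.prems(1)[of 0 v]) auto
  qed
qed simp

lemma reach_verdict:
  assumes "s Vs = map TBit v @ vs" "False \<in> set v"
  shows "reach verdict (3 * length v + 4) (\<lambda>_. True) s"
proof -
  obtain m v' where v: "v = replicate m True @ False # v'" by (rule split_True[OF assms(2)])
  show ?thesis
    unfolding verdict_def
    apply (rule reach_mono)
     apply (rule reach_Seq, rule reach_verdict_scan[where xs = "replicate m (TBit True)" and ys = "TBit False # map TBit v' @ vs"])
        apply (simp add: assms v)
       apply auto[1]
      apply simp
     apply (rule reach_Case_Some[where a = "TBit False" and xs = "map TBit v' @ vs"])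
      apply simp
     apply (simp only: simp_thms if_True)
     apply (rule reach_Skip)
     apply simp
    apply (simp add: v)
    done
qed

lemma run_verdict:
  assumes "run verdict t s s'" "s Vs = map TBit v @ TVar # vs"
  shows "False \<in> set v"
proof (rule ccontr)
  assume "False \<notin> set v"
  then have "\<forall>b\<in>set v. b" by (metis (full_types))
  then have "set (map TBit v) \<subseteq> {TBit True}" by auto
  then have R: "reach (each Vs {TBit True} (\<lambda>_. Skip)) (3 * length (map TBit v) + 1) (\<lambda>s'. s' Vs = TVar # vs) s"
    using assms(2) by (intro reach_verdict_scan[where ys = "TVar # vs"]) auto
  from assms(1) obtain t1 t2 s1 where r: "run (each Vs {TBit True} (\<lambda>_. Skip)) t1 s s1"
    "run (Case Vs (\<lambda>x. if x = Some (TBit False) then Skip else Fail)) t2 s1 s'"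
    unfolding verdict_def by (meson run_SeqE)
  have "s1 Vs = TVar # vs" using reach_deterministic[OF R _ r(1)] by simp
  then show False using r(2) by auto
qed

lemma ready_after_guess:
  assumes "scanned idx (Suc 0) w ((initial Iw w)(Lc := [TBot])) s1" "s1 Lc = []"
    and "s2 = s1(Ln := replicate N TBot @ s1 Ln, Tv := table_word (map TBit) tv @ s1 Tv,
      Tc := table_word blks tc @ s1 Tc)"
  shows "ready N tv tc s2" "s2 Ka = []" "s2 Rw = rev w" "s2 Vs = []"
  using assms by (auto simp: scanned_def ready_def initial_def)

lemma reach_scan_initial:
  fixes idx :: "'v \<Rightarrow> nat"
  assumes "checks chk (range (\<lambda>p. binary (idx p))) m"
  shows "reach (each Iw UNIV (scan chk)) ((m + 15) * length w + 1)
    (scanned idx (Suc 0) w ((initial Iw w)(Lc := [TBot]))) ((initial Iw w)(Lc := [TBot]))"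
  by (rule reach_scan[OF assms]) (simp_all add: initial_def)

lemma scanned_initial:
  assumes "scanned idx (Suc 0) w ((initial Iw w)(Lc := [TBot])) s1"
  shows "s1 Fl = [] \<and> s1 Lc = [] \<longleftrightarrow> (\<exists>A. w = encode idx A)"
  using assms by (auto simp: scanned_def initial_def)

lemma reach_eval_verdict:
  fixes idx :: "'v \<Rightarrow> nat"
  assumes "ready N tv tc s" "s Ka = []" "s Rw = rev (encode idx A)" "s Vs = []"
  shows "reach (each Rw UNIV (op idf)) (1 + length (encode idx A) * (cost N tv tc + 3 * length (encode idx A) + 5))
    (\<lambda>s'. s' Vs = map TBit (rev (vec N (ext (table_val N tv (\<lambda>p. binary (idx p))) (table_sel idf N tc) A))) @ [TVar]) s"
  by (rule reach_eval[OF assms(1,2), where rest = "[]"], simp add: assms, simp, rule reach_each_stop)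
    (simp_all add: assms rev_map)

text \<open>On an encoded theorem the deterministic scan leaves no mark, whatever is guessed is a
  model, and \<open>soundness\<close> makes the result vector constantly true, on which
  \<open>verdict\<close> has no run.\<close>

lemma run_decide:
  fixes idx :: "'v \<Rightarrow> nat"
  assumes chk: "checks chk (range (\<lambda>p. binary (idx p))) m"
    and run: "run (decide idf chk) t (initial Iw w) s'"
  shows "w \<notin> {encode idx A | A. hilbert (rules idf) A}"
proof
  assume "w \<in> {encode idx A | A. hilbert (rules idf) A}"
  then obtain A where A: "w = encode idx A" "hilbert (rules idf) A" by auto
  let ?s0 = "(initial Iw w)(Lc := [TBot])"
  have s0: "(initial Iw w)(Lc := TBot # initial Iw w Lc) = ?s0" by (simp add: initial_def)
  from run obtain t1 t2 t3 s1 s2 where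
    r1: "run (each Iw UNIV (scan chk)) t1 ?s0 s1" and
    r2: "run (Case Lc (\<lambda>x. if x = None then Skip else Push Fl TBot)) t2 s1 s2" and
    r3: "run (Case Fl (\<lambda>x. if x = None then guess ;; each Rw UNIV (op idf) ;; verdict else Skip)) t3 s2 s'"
    unfolding decide_def by (elim run_SeqE run_PushE) (metis s0)
  have sc: "scanned idx (Suc 0) w ?s0 s1"
    using reach_deterministic[OF reach_scan_initial[OF chk] _ r1] chk
    by (simp add: deterministic_scan checks_def)
  then have Fl: "s1 Fl = []" "s1 Lc = []" using scanned_initial[OF sc] A by auto
  then have "s1(Lc := tl (s1 Lc)) = s1" by auto
  then have s2: "s2 = s1" using r2 Fl by (auto simp del: fun_upd_apply)
  have "s1(Fl := tl (s1 Fl)) = s1" using Fl by auto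
  then obtain t4 where "run (guess ;; each Rw UNIV (op idf) ;; verdict) t4 s1 s'"
    using r3 Fl unfolding s2 by (elim run_CaseE) simp
  then obtain t5 t6 t7 s3 s4 where r5: "run guess t5 s1 s3" and
    r6: "run (each Rw UNIV (op idf)) t6 s3 s4" and r7: "run verdict t7 s4 s'"
    by (meson run_SeqE)
  obtain N tv tc where s3: "s3 = s1(Ln := replicate N TBot @ s1 Ln, Tv := table_word (map TBit) tv @ s1 Tv,
    Tc := table_word blks tc @ s1 Tc)" by (rule run_guess[OF r5])
  let ?E = "ext (table_val N tv (\<lambda>p. binary (idx p))) (table_sel idf N tc) A"
  have "s4 Vs = map TBit (rev (vec N ?E)) @ [TVar]"
    using reach_deterministic[OF reach_eval_verdict _ r6, of N tv tc idx A]
      ready_after_guess[OF sc Fl(2) s3] A(1) by simp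
  then have "False \<in> set (rev (vec N ?E))" by (rule run_verdict[OF r7])
  then obtain i where "i \<notin> ?E" by (auto simp: vec_def)
  \<comment> \<open>\<open>table_sel\<close> discards selected worlds outside the antecedent, so the
    guessed model validates \<open>ID\<close> when required.\<close>
  moreover have "i \<in> ?E" using A(2) by (rule soundness) (simp add: table_sel_Some)
  ultimately show False by contradiction
qed

lemma length_blks: "(\<And>j. Some j \<in> set p \<Longrightarrow> j < N) \<Longrightarrow> length (blks p) \<le> length p * (N + 1)"
proof (induction p)
  case (Cons x p)
  have "length (blk x) \<le> N + 1" using Cons.prems[of "the x"] by (cases x) auto
  then show ?case using Cons by (simp add: add_mono)
qed simp

lemma length_table_word:
  "(\<And>k p. (k, p) \<in> set es \<Longrightarrow> length k + length (pe p) + 2 \<le> b) \<Longrightarrow>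
   length (table_word pe es) \<le> length es * b"
proof (induction es)
  case (Cons e es)
  obtain k p where e: "e = (k, p)" by (cases e)
  have "length k + length (pe p) + 2 \<le> b" "length (table_word pe es) \<le> length es * b"
    using Cons.prems[of k p] Cons.IH Cons.prems by (simp_all add: e)
  then show ?case by (simp add: e)
qed simp

text \<open>Origin of the degree: \<open>N\<close> is cubic, a row of the conditional table has
  \<open>N\<close> blocks of at most \<open>N + 1\<close> symbols, there are linearly many rows, and
  a search may be made for each symbol of the word.\<close>

lemma reach_decide:
  fixes idx :: "'v \<Rightarrow> nat"
  assumes idx: "inj idx" and chk: "checks chk (range (\<lambda>p. binary (idx p))) m"
    and w: "w \<notin> {encode idx A | A. hilbert (rules idf) A}"
  shows "reach (decide idf chk) ((m + 6000) * (length w + 1) ^ 8) (\<lambda>_. True) (initial Iw w)"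
proof -
  let ?s0 = "(initial Iw w)(Lc := [TBot])"
  \<comment> \<open>The shift by one makes powers of \<open>x\<close> increasing in the exponent
    even for the empty word.\<close>
  define x where "x = length w + 1"
  have x: "1 \<le> x" "length w \<le> x" by (simp_all add: x_def)
  let ?K = "5500 * x ^ 8"
  have K: "8 \<le> ?K" using one_le_power[OF x(1), of 8] by linarith
  have rest: "reach (Case Lc (\<lambda>x. if x = None then Skip else Push Fl TBot) ;;
     Case Fl (\<lambda>x. if x = None then guess ;; each Rw UNIV (op idf) ;; verdict else Skip)) ?K (\<lambda>_. True) s1"
    if sc: "scanned idx (Suc 0) w ?s0 s1" for s1
  proof (cases "\<exists>A. w = encode idx A")
    case False
    show ?thesis
    proof (cases "s1 Lc")
      case Nil
      then obtain a as where Fl: "s1 Fl = a # as"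
        using scanned_initial[OF sc] False by (cases "s1 Fl") auto
      have "reach (Case Lc (\<lambda>x. if x = None then Skip else Push Fl TBot) ;;
          Case Fl (\<lambda>x. if x = None then guess ;; each Rw UNIV (op idf) ;; verdict else Skip)) 8 (\<lambda>_. True) s1"
        apply (rule reach_mono)
         apply (rule reach_Seq, rule reach_Case_None[of s1 Lc, OF Nil])
         apply (simp only: simp_thms if_True)
         apply (rule reach_Skip)
         apply (rule reach_Case_Some[of s1 Fl, OF Fl])
         apply (simp only: option.distinct if_False)
         apply (rule reach_Skip)
         apply simp_all
        done
      then show ?thesis using K by (rule reach_mono)
    next
      case (Cons b bs)
      have "reach (Case Lc (\<lambda>x. if x = None then Skip else Push Fl TBot) ;;
          Case Fl (\<lambda>x. if x = None then guess ;; each Rw UNIV (op idf) ;; verdict else Skip)) 8 (\<lambda>_. True) s1"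
        apply (rule reach_mono)
         apply (rule reach_Seq, rule reach_Case_Some[of s1 Lc, OF Cons])
         apply (simp only: option.distinct if_False)
         apply (rule reach_Push)
         apply (rule reach_Case_Some[where a = TBot and xs = "s1 Fl"])
          apply simp
         apply (simp only: option.distinct if_False)
         apply (rule reach_Skip)
         apply simp_all
        done
      then show ?thesis using K by (rule reach_mono)
    qed
  next
    case True
    then obtain A where A: "w = encode idx A" by blast
    then have Fl: "s1 Fl = []" "s1 Lc = []" using scanned_initial[OF sc] by auto
    have np: "\<not> hilbert (rules idf) A" using w A by blast
    have "inj (\<lambda>p. binary (idx p))"
      using inj_compose[OF inj_binary idx] by (simp add: o_def)
    from small_model[OF this np, folded A] obtain N tv tc i where i: "i < N"
      "i \<notin> ext (table_val N tv (\<lambda>p. binary (idx p))) (table_sel idf N tc) A"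
      and N: "N \<le> length w + 2 * length w ^ 3" and len: "length tv \<le> length w" "length tc \<le> length w"
      and tv: "\<forall>(k, p)\<in>set tv. length k \<le> length w \<and> length p = N"
      and tc: "\<forall>(k, p)\<in>set tc. length k = N \<and> length p = N \<and> (\<forall>j. Some j \<in> set p \<longrightarrow> j < N)"
      by (elim exE conjE) (rule that)
    have x3: "x \<le> x ^ 3" "1 \<le> x ^ 3" using x(1) by (simp_all add: self_le_power)
    have x6: "x ^ 3 \<le> x ^ 6" using x(1) by (simp add: power_increasing)
    have "length w ^ 3 \<le> x ^ 3" using x(2) by (rule power_mono) simp
    then have N3: "N \<le> 3 * x ^ 3" using N x(2) x3 by linarith
    have Tv: "length (table_word (map TBit) tv) \<le> 6 * x ^ 4"
    proof -
      have "length (table_word (map TBit) tv) \<le> length tv * (6 * x ^ 3)"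
      proof (rule length_table_word)
        fix k p assume "(k, p) \<in> set tv"
        then show "length k + length (map TBit p) + 2 \<le> 6 * x ^ 3"
          using bspec[OF tv, of "(k, p)"] N3 x(2) x3 by simp
      qed
      also have "\<dots> \<le> x * (6 * x ^ 3)" using len(1) x(2) by (intro mult_le_mono1) simp
      finally show ?thesis by (simp add: power_def)
    qed
    \<comment> \<open>A row consists of a key of at most \<open>3 * x ^ 3\<close> symbols, a payload
      of at most \<open>12 * x ^ 6\<close> and two separators, together at most
      \<open>17 * x ^ 6\<close>.\<close>
    have Tc: "length (table_word blks tc) \<le> 17 * x ^ 7"
    proof -
      have "length (table_word blks tc) \<le> length tc * (17 * x ^ 6)"
      proof (rule length_table_word)
        fix k p assume "(k, p) \<in> set tc"
        then have p: "length k = N" "length p = N" "\<And>j. Some j \<in> set p \<Longrightarrow> j < N"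
          using bspec[OF tc, of "(k, p)"] by auto
        have "length (blks p) \<le> N * (N + 1)"
          using length_blks[of p N] p by simp
        also have "\<dots> \<le> (3 * x ^ 3) * (4 * x ^ 3)"
          using N3 x3 by (intro mult_le_mono) linarith+
        also have "\<dots> = 12 * x ^ 6" by (simp add: power_def)
        finally show "length k + length (blks p) + 2 \<le> 17 * x ^ 6"
          using p(1) N3 x3 x6 by linarith
      qed
      also have "\<dots> \<le> x * (17 * x ^ 6)" using len(2) x(2) by (intro mult_le_mono1) simp
      finally show ?thesis by (simp add: power_def)
    qed
    have pw: "1 \<le> x ^ 7" "x ^ 3 \<le> x ^ 7" "x ^ 4 \<le> x ^ 7" "x ^ 7 \<le> x ^ 8" "x \<le> x ^ 7"
      using x(1) by (simp_all add: power_increasing self_le_power)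
    \<comment> \<open>\<open>1620\<close> is \<open>60 * (3 + 6 + 17) + 60\<close>. Powers are
      replaced by variables so that the inequality becomes linear; the later estimates proceed
      likewise.\<close>
    have cost: "cost N tv tc \<le> 1620 * x ^ 7"
    proof -
      have "60 * (a + b + c) + 60 \<le> 1620 * z"
        if "a \<le> 3 * u" "b \<le> 6 * v" "c \<le> 17 * z" "1 \<le> z" "u \<le> z" "v \<le> z" for a b c u v z :: nat
        using that by simp
      from this[OF N3 Tv Tc pw(1-3)] show ?thesis by (simp add: cost_def)
    qed
    have "length w * (cost N tv tc + 3 * length w + 5) \<le> x * (1620 * x ^ 7 + 3 * x ^ 7 + 5 * x ^ 7)"
    proof (rule mult_le_mono[OF x(2)])
      have "c + 3 * l + 5 \<le> 1620 * z + 3 * z + 5 * z"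
        if "c \<le> 1620 * z" "l \<le> y" "y \<le> z" "1 \<le> z" for c l y z :: nat
        using that by simp
      from this[OF cost x(2) pw(5,1)] show "cost N tv tc + 3 * length w + 5 \<le> 1620 * x ^ 7 + 3 * x ^ 7 + 5 * x ^ 7" .
    qed
    also have "\<dots> = 1628 * x ^ 8" by (simp add: power_def)
    finally have eval: "length w * (cost N tv tc + 3 * length w + 5) \<le> 1628 * x ^ 8" .
    let ?E = "ext (table_val N tv (\<lambda>p. binary (idx p))) (table_sel idf N tc) A"
    let ?s3 = "s1(Ln := replicate N TBot @ s1 Ln, Tv := table_word (map TBit) tv @ s1 Tv,
        Tc := table_word blks tc @ s1 Tc)"
    have "False \<in> set (vec N ?E)" using i by (auto simp: vec_def)
    then have verdict: "reach verdict (3 * N + 4) (\<lambda>_. True) s"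
      if "s Vs = map TBit (rev (vec N ?E)) @ [TVar]" for s
      using reach_verdict[where s = s and v = "rev (vec N ?E)" and vs = "[TVar]"] that by simp
    have "reach (each Rw UNIV (op idf)) (1 + length w * (cost N tv tc + 3 * length w + 5))
        (reach verdict (3 * N + 4) (\<lambda>_. True)) ?s3"
      using reach_eval_verdict[OF ready_after_guess[OF sc Fl(2) refl, unfolded A], folded A] verdict
      by (rule reach_conseq)
    note ev = this
    have "2 + (4 + (c + (3 + (e + (3 * n + 4))))) \<le> 5500 * y"
      if "c \<le> 1620 * z" "e \<le> 1628 * y" "n \<le> 3 * u" "u \<le> z" "z \<le> y" "1 \<le> z" for c e n u y z :: nat
      using that by simp
    from this[OF cost eval N3 pw(2,4,1)] have time: "Suc (Suc 1 + Suc (Suc (cost N tv tc +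
        Suc (1 + length w * (cost N tv tc + 3 * length w + 5) + (3 * N + 4))))) \<le> ?K"
      by simp
    show ?thesis
      apply (rule reach_mono)
       apply (rule reach_Seq, rule reach_Case_None[of s1 Lc, OF Fl(2)])
       apply (simp only: simp_thms if_True)
       apply (rule reach_Skip)
       apply (rule reach_Case_None[of s1 Fl, OF Fl(1)])
       apply (simp only: simp_thms if_True)
       apply (rule reach_Seq, rule reach_guess[where N = N and tv = tv and tc = tc])
       apply (rule reach_Seq, rule ev)
      apply (rule time)
      done
  qed
  have "reach (decide idf chk) (Suc (2 + Suc ((m + 15) * length w + 1 + ?K))) (\<lambda>_. True) (initial Iw w)"
    unfolding decide_def
  proof (rule reach_Seq, rule reach_Push, rule reach_Seq)
    have s0: "(initial Iw w)(Lc := TBot # initial Iw w Lc) = ?s0" by (simp add: initial_def)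
    show "reach (each Iw UNIV (scan chk)) ((m + 15) * length w + 1)
      (reach (Case Lc (\<lambda>x. if x = None then Skip else Push Fl TBot) ;;
         Case Fl (\<lambda>x. if x = None then guess ;; each Rw UNIV (op idf) ;; verdict else Skip)) ?K (\<lambda>_. True))
      ((initial Iw w)(Lc := TBot # initial Iw w Lc))"
      unfolding s0 using reach_scan_initial[OF chk] rest by (rule reach_conseq)
  qed
  moreover have "Suc (2 + Suc ((m + 15) * length w + 1 + ?K)) \<le> (m + 6000) * x ^ 8"
  proof -
    have x8: "x \<le> x ^ 8" "1 \<le> x ^ 8" using x(1) by (simp_all add: self_le_power)
    have "(m + 15) * length w \<le> (m + 15) * x ^ 8" using x(2) x8 by (intro mult_le_mono2) simp
    then show ?thesis using x8 by (simp add: algebra_simps)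
  qed
  ultimately show ?thesis unfolding x_def by (rule reach_mono)
qed

lemma derivable_coNP:
  fixes idx :: "'v \<Rightarrow> nat"
  assumes "enumeration idx"
  shows "{encode idx A | A. hilbert (rules idf) A} \<in> coNP"
proof -
  obtain chk m where chk: "checks chk (range (\<lambda>p. binary (idx p))) m"
    using checker_exists[OF assms] by blast
  have idx: "inj idx" using assms by (simp add: enumeration_def)
  let ?L = "{encode idx A | A. hilbert (rules idf) A}"
  \<comment> \<open>\<open>[:1, 1:]\<close> is the polynomial x + 1, so this is the bound of
    \<open>reach_decide\<close>.\<close>
  let ?p = "smult (m + 6000) ([:1, 1:] ^ 8)"
  let ?rs = "[Rw, Ka, Kb, Kc, Kd, Pl, Pr, Tv, Tc, Ts, Vs, Ln, Lc, Mm, Fl]"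
  have "- ?L \<in> NP"
  proof (rule stack_program_NP[where P = "decide idf chk" and p = ?p and rs = ?rs and ?r0.0 = Iw])
    have "r \<in> set (Iw # ?rs)" for r by (cases r) simp_all
    then show "set (Iw # ?rs) = UNIV" by blast
    show "Iw \<notin> set ?rs" by simp
    show time: "\<exists>t \<le> poly ?p (length w). \<exists>s. run (decide idf chk) t (initial Iw w) s" if "w \<in> - ?L" for w
    proof -
      have "reach (decide idf chk) ((m + 6000) * (length w + 1) ^ 8) (\<lambda>_. True) (initial Iw w)"
        using reach_decide[OF idx chk] that by blast
      moreover have "poly ?p (length w) = (m + 6000) * (length w + 1) ^ 8" by simp
      ultimately show ?thesis unfolding reach_def by metis
    qed
    show "w \<in> - ?L \<longleftrightarrow> (\<exists>t s. run (decide idf chk) t (initial Iw w) s)" for w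
      using time[of w] run_decide[OF chk] by blast
  qed
  then show ?thesis by (simp add: coNP_def)
qed

theorem theorem7p3:
  fixes idx :: "'v \<Rightarrow> nat"
  assumes "enumeration idx"
  shows "{encode idx A | A. hilbert CKCEM A} \<in> coNP \<and>
         {encode idx A | A. hilbert CKIDCEM A} \<in> coNP"
  using derivable_coNP[OF assms, of False] derivable_coNP[OF assms, of True]
  by (simp add: rules_def)

end
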